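(* Let $X$ be a coarse metric space and let $i\colon X\to Z$ be an admissible compactification of $X$. Then there are canonical injective $*$-homomorphisms $$C(Z,D\otimes\mathbb{K})\to C(\eta X,D\otimes\mathbb{K})\to\bar{\mathfrak{c}}(X,D),$$ $$C(Z\setminus X,D\otimes\mathbb{K})\to C(\partial_\eta X,D\otimes\mathbb{K})\to\mathfrak{c}(X,D)$$ for any $C^*$-algebra $D$. Moreover, any class in $K_*\bigl(C(\partial_\eta X,D\otimes\mathbb{K})\bigr)$ is the image of a class in $K_*\bigl(C(Z\setminus X,D\otimes\mathbb{K})\bigr)$ for some admissible compactification $Z$ of $X$.
   Context: A coarse metric space is a metric space $(X,d)$ whose bounded subsets are relatively compact. A map $f$ from $X$ to a metric space has vanishing variation if for every $R>0$ the function $\mathrm{Var}_R f(x)=\sup\{d(f(x),f(y)):d(x,y)\le R\}$ vanishes at infinity (for each $\epsilon>0$, $\{x:\mathrm{Var}_Rf(x)\ge\epsilon\}$ is bounded). $\mathbb{K}$ is the algebra of compact operators on a separable Hilbert space. $\bar{\mathfrak{c}}(X,D)$ is the $C^*$-algebra of bounded continuous functions $X\to D\otimes\mathbb{K}$ of vanishing variation and $\mathfrak{c}(X,D)=\bar{\mathfrak{c}}(X,D)/C_0(X,D\otimes\mathbb{K})$. The Higson compactification $\eta X$ is the maximal ideal space of the $C^*$-algebra of bounded continuous functions $X\to\mathbb C$ of vanishing variation, and the Higson corona is $\partial_\eta X=\eta X\setminus X$. A metrizable compactification $i\colon X\to Z$ is admissible if there is a metric on $Z$ generating the topology of $Z$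 for which $i$ has vanishing variation. *)

theory Defs
  imports "HOL-Analysis.Analysis" "HOL-Algebra.QuotRing" "HOL-Algebra.Module"
begin

section \<open>C*-algebras\<close>

text \<open>C*-algebras are carrier-based records, since function algebras, quotients and unitizations
  have to be formed. They need not be unital: the field \<^const>\<open>one\<close> inherited from
  rings is unconstrained and is only used for unitizations and \<open>complex_cstar\<close>.\<close>

definition complex_ring :: "complex ring" where
  "complex_ring = \<lparr>carrier = UNIV, monoid.mult = (*), one = 1, ring.zero = 0, add = (+)\<rparr>"

record 'a cstar_alg = "(complex, 'a) module" +
  adj :: "'a \<Rightarrow> 'a"
  cnorm :: "'a \<Rightarrow> real"

text \<open>Set to \<open>0\<close> off the carrier because \<^locale>\<open>Metric_space\<close> asks for symmetry and
  nonnegativity on the whole type.\<close>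

definition cstar_dist :: "'a cstar_alg \<Rightarrow> 'a \<Rightarrow> 'a \<Rightarrow> real" where
  "cstar_dist A x y =
     (if x \<in> carrier A \<and> y \<in> carrier A then cnorm A (x \<ominus>\<^bsub>A\<^esub> y) else 0)"

definition cstar_topology :: "'a cstar_alg \<Rightarrow> 'a topology" where
  "cstar_topology A = Metric_space.mtopology (carrier A) (cstar_dist A)"

locale cstar_algebra = Module.module complex_ring A for A :: "'a cstar_alg" (structure) +
  assumes mult_closed: "x \<in> carrier A \<Longrightarrow> y \<in> carrier A \<Longrightarrow> x \<otimes> y \<in> carrier A"
    and mult_assoc: "x \<in> carrier A \<Longrightarrow> y \<in> carrier A \<Longrightarrow> z \<in> carrier A \<Longrightarrow>
      (x \<otimes> y) \<otimes> z = x \<otimes> (y \<otimes> z)"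
    and distrib_right: "x \<in> carrier A \<Longrightarrow> y \<in> carrier A \<Longrightarrow> z \<in> carrier A \<Longrightarrow>
      (x \<oplus> y) \<otimes> z = x \<otimes> z \<oplus> y \<otimes> z"
    and distrib_left: "x \<in> carrier A \<Longrightarrow> y \<in> carrier A \<Longrightarrow> z \<in> carrier A \<Longrightarrow>
      x \<otimes> (y \<oplus> z) = x \<otimes> y \<oplus> x \<otimes> z"
    and smult_mult_left: "x \<in> carrier A \<Longrightarrow> y \<in> carrier A \<Longrightarrow>
      (c \<odot> x) \<otimes> y = c \<odot> (x \<otimes> y)"
    and smult_mult_right: "x \<in> carrier A \<Longrightarrow> y \<in> carrier A \<Longrightarrow>
      x \<otimes> (c \<odot> y) = c \<odot> (x \<otimes> y)"
    and adj_closed: "x \<in> carrier A \<Longrightarrow> adj A x \<in> carrier A"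
    and adj_adj: "x \<in> carrier A \<Longrightarrow> adj A (adj A x) = x"
    and adj_add: "x \<in> carrier A \<Longrightarrow> y \<in> carrier A \<Longrightarrow> adj A (x \<oplus> y) = adj A x \<oplus> adj A y"
    and adj_smult: "x \<in> carrier A \<Longrightarrow> adj A (c \<odot> x) = cnj c \<odot> adj A x"
    and adj_mult: "x \<in> carrier A \<Longrightarrow> y \<in> carrier A \<Longrightarrow> adj A (x \<otimes> y) = adj A y \<otimes> adj A x"
    and cnorm_nonneg: "x \<in> carrier A \<Longrightarrow> 0 \<le> cnorm A x"
    and cnorm_eq_0: "x \<in> carrier A \<Longrightarrow> cnorm A x = 0 \<longleftrightarrow> x = \<zero>"
    and cnorm_add: "x \<in> carrier A \<Longrightarrow> y \<in> carrier A \<Longrightarrow>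
      cnorm A (x \<oplus> y) \<le> cnorm A x + cnorm A y"
    and cnorm_smult: "x \<in> carrier A \<Longrightarrow> cnorm A (c \<odot> x) = cmod c * cnorm A x"
    and cnorm_mult: "x \<in> carrier A \<Longrightarrow> y \<in> carrier A \<Longrightarrow>
      cnorm A (x \<otimes> y) \<le> cnorm A x * cnorm A y"
    and cstar_identity: "x \<in> carrier A \<Longrightarrow> cnorm A (adj A x \<otimes> x) = (cnorm A x)\<^sup>2"
    and complete: "Metric_space.mcomplete (carrier A) (cstar_dist A)"

definition star_hom :: "'a cstar_alg \<Rightarrow> 'b cstar_alg \<Rightarrow> ('a \<Rightarrow> 'b) \<Rightarrow> bool" where
  "star_hom A B \<phi> \<longleftrightarrow> \<phi> \<in> carrier A \<rightarrow> carrier B \<and>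
     (\<forall>x\<in>carrier A. \<forall>y\<in>carrier A. \<phi> (x \<oplus>\<^bsub>A\<^esub> y) = \<phi> x \<oplus>\<^bsub>B\<^esub> \<phi> y) \<and>
     (\<forall>x\<in>carrier A. \<forall>y\<in>carrier A. \<phi> (x \<otimes>\<^bsub>A\<^esub> y) = \<phi> x \<otimes>\<^bsub>B\<^esub> \<phi> y) \<and>
     (\<forall>c. \<forall>x\<in>carrier A. \<phi> (c \<odot>\<^bsub>A\<^esub> x) = c \<odot>\<^bsub>B\<^esub> \<phi> x) \<and>
     (\<forall>x\<in>carrier A. \<phi> (adj A x) = adj B (\<phi> x))"

definition injective_star_hom :: "'a cstar_alg \<Rightarrow> 'b cstar_alg \<Rightarrow> ('a \<Rightarrow> 'b) \<Rightarrow> bool" where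
  "injective_star_hom A B \<phi> \<longleftrightarrow> star_hom A B \<phi> \<and> inj_on \<phi> (carrier A)"

definition complex_cstar :: "complex cstar_alg" where
  "complex_cstar = \<lparr>carrier = UNIV, monoid.mult = (*), one = 1, ring.zero = 0, add = (+),
     smult = (*), adj = cnj, cnorm = cmod\<rparr>"

text \<open>For a closed two-sided ideal \<open>I\<close>; ring structure as in \<^const>\<open>FactRing\<close>,
  with the quotient norm.\<close>

definition cstar_quotient :: "'a cstar_alg \<Rightarrow> 'a set \<Rightarrow> 'a set cstar_alg" where
  "cstar_quotient A I = \<lparr>carrier = carrier (A Quot I), monoid.mult = monoid.mult (A Quot I),
     one = one (A Quot I), ring.zero = ring.zero (A Quot I), add = add (A Quot I),
     smult = (\<lambda>c S. \<Union>a\<in>S. I +>\<^bsub>A\<^esub> (c \<odot>\<^bsub>A\<^esub> a)),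
     adj = (\<lambda>S. \<Union>a\<in>S. I +>\<^bsub>A\<^esub> adj A a),
     cnorm = (\<lambda>S. Inf (cnorm A ` S))\<rparr>"

text \<open>The norm is the C*-norm of the unitization: for non-unital \<open>A\<close> the supremum is the norm of
  \<open>(a, l)\<close> acting on \<open>A\<close> by left multiplication and dominates \<open>\<bar>l\<bar>\<close>; for unital
  \<open>A\<close> the unitization is the direct sum of \<open>A\<close> and \<open>\<complex>\<close> by \<open>(a, l) \<mapsto> (a + l 1, l)\<close>.\<close>

definition unitization :: "'a cstar_alg \<Rightarrow> ('a \<times> complex) cstar_alg" where
  "unitization A = \<lparr>carrier = carrier A \<times> UNIV,
     monoid.mult = (\<lambda>(a, l) (b, m).
       (a \<otimes>\<^bsub>A\<^esub> b \<oplus>\<^bsub>A\<^esub> l \<odot>\<^bsub>A\<^esub> b \<oplus>\<^bsub>A\<^esub> m \<odot>\<^bsub>A\<^esub> a, l * m)),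
     one = (\<zero>\<^bsub>A\<^esub>, 1),
     ring.zero = (\<zero>\<^bsub>A\<^esub>, 0),
     add = (\<lambda>(a, l) (b, m). (a \<oplus>\<^bsub>A\<^esub> b, l + m)),
     smult = (\<lambda>c (a, l). (c \<odot>\<^bsub>A\<^esub> a, c * l)),
     adj = (\<lambda>(a, l). (adj A a, cnj l)),
     cnorm = (\<lambda>(a, l). max (cmod l)
       (SUP b\<in>{b \<in> carrier A. cnorm A b \<le> 1}. cnorm A (a \<otimes>\<^bsub>A\<^esub> b \<oplus>\<^bsub>A\<^esub> l \<odot>\<^bsub>A\<^esub> b)))\<rparr>"

definition unitization_map :: "('a \<Rightarrow> 'b) \<Rightarrow> 'a \<times> complex \<Rightarrow> 'b \<times> complex" where
  "unitization_map \<phi> = (\<lambda>(a, l). (\<phi> a, l))"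


section \<open>Compact operators and the tensor product\<close>

text \<open>A complex Hilbert space is a real one (with inner product the real part of the complex inner
  product) with a compatible complex scalar multiplication: multiplication by \<open>\<i>\<close> is orthogonal.
  The complex inner product is determined by its real part, operator norms agree, and the
  adjoint of a complex-linear operator is its adjoint for the real inner product.\<close>

class complex_hilbert = real_inner + complete_space +
  fixes scaleC :: "complex \<Rightarrow> 'a \<Rightarrow> 'a"
  assumes scaleC_add_right: "scaleC c (x + y) = scaleC c x + scaleC c y"
    and scaleC_add_left: "scaleC (c + d) x = scaleC c x + scaleC d x"
    and scaleC_scaleC: "scaleC c (scaleC d x) = scaleC (c * d) x"
    and scaleC_of_real: "scaleC (complex_of_real r) x = scaleR r x"
    and inner_scaleC_ii: "inner (scaleC \<i> x) (scaleC \<i> y) = inner x y"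

definition compact_operators :: "('h::complex_hilbert \<Rightarrow> 'h) cstar_alg" where
  "compact_operators = \<lparr>carrier = {T. bounded_linear T \<and> (\<forall>c x. T (scaleC c x) = scaleC c (T x)) \<and>
       compact (closure (T ` cball 0 1))},
     monoid.mult = (\<circ>), one = id,
     ring.zero = (\<lambda>x. 0), add = (\<lambda>S T x. S x + T x),
     smult = (\<lambda>c T x. scaleC c (T x)), adj = adjoint, cnorm = onorm\<rparr>"

text \<open>\<open>T\<close> with \<open>\<tau> a b\<close> in the role of the elementary tensors is a C*-completion of the algebraic
  tensor product of \<open>A\<close> and \<open>B\<close>: the *-homomorphism from the algebraic tensor product induced by
  \<open>\<tau>\<close> has dense range, and it is injective (every element of the algebraic tensor product is a sum
  of elementary tensors whose second legs are linearly independent, and such a sum vanishes only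
  if all first legs do). If \<open>A\<close> or \<open>B\<close> is nuclear, as the compact operators are, such a \<open>T\<close> is
  unique up to isomorphism.\<close>

definition linearly_independent :: "'a cstar_alg \<Rightarrow> nat \<Rightarrow> (nat \<Rightarrow> 'a) \<Rightarrow> bool" where
  "linearly_independent A n b \<longleftrightarrow>
     (\<forall>c. (\<Oplus>\<^bsub>A\<^esub>k\<in>{..<n}. c k \<odot>\<^bsub>A\<^esub> b k) = \<zero>\<^bsub>A\<^esub> \<longrightarrow> (\<forall>k<n. c k = 0))"

definition cstar_tensor_product ::
  "'a cstar_alg \<Rightarrow> 'b cstar_alg \<Rightarrow> 't cstar_alg \<Rightarrow> ('a \<Rightarrow> 'b \<Rightarrow> 't) \<Rightarrow> bool" where
  "cstar_tensor_product A B T \<tau> \<longleftrightarrow> cstar_algebra T \<and>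
     (\<forall>a\<in>carrier A. \<forall>b\<in>carrier B. \<tau> a b \<in> carrier T) \<and>
     (\<forall>a\<in>carrier A. \<forall>a'\<in>carrier A. \<forall>b\<in>carrier B. \<tau> (a \<oplus>\<^bsub>A\<^esub> a') b = \<tau> a b \<oplus>\<^bsub>T\<^esub> \<tau> a' b) \<and>
     (\<forall>a\<in>carrier A. \<forall>b\<in>carrier B. \<forall>b'\<in>carrier B. \<tau> a (b \<oplus>\<^bsub>B\<^esub> b') = \<tau> a b \<oplus>\<^bsub>T\<^esub> \<tau> a b') \<and>
     (\<forall>c. \<forall>a\<in>carrier A. \<forall>b\<in>carrier B. \<tau> (c \<odot>\<^bsub>A\<^esub> a) b = c \<odot>\<^bsub>T\<^esub> \<tau> a b \<and>
       \<tau> a (c \<odot>\<^bsub>B\<^esub> b) = c \<odot>\<^bsub>T\<^esub> \<tau> a b) \<and>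
     (\<forall>a\<in>carrier A. \<forall>a'\<in>carrier A. \<forall>b\<in>carrier B. \<forall>b'\<in>carrier B.
       \<tau> a b \<otimes>\<^bsub>T\<^esub> \<tau> a' b' = \<tau> (a \<otimes>\<^bsub>A\<^esub> a') (b \<otimes>\<^bsub>B\<^esub> b')) \<and>
     (\<forall>a\<in>carrier A. \<forall>b\<in>carrier B. adj T (\<tau> a b) = \<tau> (adj A a) (adj B b)) \<and>
     (\<forall>n a b. a \<in> {..<n} \<rightarrow> carrier A \<longrightarrow> b \<in> {..<n} \<rightarrow> carrier B \<longrightarrow> linearly_independent B n b \<longrightarrow>
       (\<Oplus>\<^bsub>T\<^esub>k\<in>{..<n}. \<tau> (a k) (b k)) = \<zero>\<^bsub>T\<^esub> \<longrightarrow> (\<forall>k<n. a k = \<zero>\<^bsub>A\<^esub>)) \<and>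
     cstar_topology T closure_of
       {\<Oplus>\<^bsub>T\<^esub>k\<in>{..<n}. \<tau> (a k) (b k) |n a b. a \<in> {..<n::nat} \<rightarrow> carrier A \<and> b \<in> {..<n} \<rightarrow> carrier B}
       = carrier T"


section \<open>Function algebras\<close>

text \<open>Functions on \<open>S\<close> are extensional. Inserting \<open>0\<close> makes the supremum norm right for
  empty \<open>S\<close> (the corona of a bounded space is empty).\<close>

definition pointwise_algebra :: "'y set \<Rightarrow> ('y \<Rightarrow> 'b) set \<Rightarrow> 'b cstar_alg \<Rightarrow> ('y \<Rightarrow> 'b) cstar_alg" where
  "pointwise_algebra S F B = \<lparr>carrier = F,
     monoid.mult = (\<lambda>f g. \<lambda>y\<in>S. f y \<otimes>\<^bsub>B\<^esub> g y), one = (\<lambda>y\<in>S. \<one>\<^bsub>B\<^esub>),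
     ring.zero = (\<lambda>y\<in>S. \<zero>\<^bsub>B\<^esub>), add = (\<lambda>f g. \<lambda>y\<in>S. f y \<oplus>\<^bsub>B\<^esub> g y),
     smult = (\<lambda>c f. \<lambda>y\<in>S. c \<odot>\<^bsub>B\<^esub> f y), adj = (\<lambda>f. \<lambda>y\<in>S. adj B (f y)),
     cnorm = (\<lambda>f. Sup (insert 0 ((\<lambda>y. cnorm B (f y)) ` S)))\<rparr>"

text \<open>\<open>C(Y, B)\<close> for compact \<open>Y\<close>.\<close>

definition cont_algebra :: "'y topology \<Rightarrow> 'b cstar_alg \<Rightarrow> ('y \<Rightarrow> 'b) cstar_alg" where
  "cont_algebra Y B = pointwise_algebra (topspace Y)
     {f \<in> extensional (topspace Y). continuous_map Y (cstar_topology B) f} B"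

definition pullback :: "'y topology \<Rightarrow> ('y \<Rightarrow> 'z) \<Rightarrow> ('z \<Rightarrow> 'b) \<Rightarrow> 'y \<Rightarrow> 'b" where
  "pullback Y \<pi> f = compose (topspace Y) f \<pi>"

definition variation :: "('b \<Rightarrow> 'b \<Rightarrow> real) \<Rightarrow> real \<Rightarrow> ('x::metric_space \<Rightarrow> 'b) \<Rightarrow> 'x \<Rightarrow> ennreal" where
  "variation d R f x = (SUP y\<in>{y. dist x y \<le> R}. ennreal (d (f x) (f y)))"

definition vanishing_variation :: "('b \<Rightarrow> 'b \<Rightarrow> real) \<Rightarrow> ('x::metric_space \<Rightarrow> 'b) \<Rightarrow> bool" where
  "vanishing_variation d f \<longleftrightarrow>
     (\<forall>R>0. \<forall>\<epsilon>>0. bounded {x. ennreal \<epsilon> \<le> variation d R f x})"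

definition vv_algebra :: "'b cstar_alg \<Rightarrow> ('x::metric_space \<Rightarrow> 'b) cstar_alg" where
  "vv_algebra B = pointwise_algebra UNIV
     {f. continuous_map euclidean (cstar_topology B) f \<and> (\<exists>C. \<forall>x. cnorm B (f x) \<le> C) \<and>
         vanishing_variation (cstar_dist B) f} B"

definition C0_functions :: "'b cstar_alg \<Rightarrow> ('x::metric_space \<Rightarrow> 'b) set" where
  "C0_functions B = {f. continuous_map euclidean (cstar_topology B) f \<and>
     (\<forall>\<epsilon>>0. bounded {x. \<epsilon> \<le> cnorm B (f x)})}"

definition stable_higson_corona :: "'b cstar_alg \<Rightarrow> ('x::metric_space \<Rightarrow> 'b) set cstar_alg" where
  "stable_higson_corona B = cstar_quotient (vv_algebra B) (C0_functions B)"


section \<open>Compactifications\<close>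

text \<open>Maximal ideal space of a commutative C*-algebra: its nonzero complex homomorphisms with the
  Gelfand topology, i.e. the topology of pointwise convergence.\<close>

definition characters :: "'a cstar_alg \<Rightarrow> ('a \<Rightarrow> complex) set" where
  "characters A = {\<omega> \<in> extensional (carrier A).
     (\<forall>x\<in>carrier A. \<forall>y\<in>carrier A. \<omega> (x \<oplus>\<^bsub>A\<^esub> y) = \<omega> x + \<omega> y) \<and>
     (\<forall>x\<in>carrier A. \<forall>y\<in>carrier A. \<omega> (x \<otimes>\<^bsub>A\<^esub> y) = \<omega> x * \<omega> y) \<and>
     (\<forall>c. \<forall>x\<in>carrier A. \<omega> (c \<odot>\<^bsub>A\<^esub> x) = c * \<omega> x) \<and>
     (\<exists>x\<in>carrier A. \<omega> x \<noteq> 0)}"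

definition maximal_ideal_space :: "'a cstar_alg \<Rightarrow> ('a \<Rightarrow> complex) topology" where
  "maximal_ideal_space A =
     subtopology (product_topology (\<lambda>_. euclidean) (carrier A)) (characters A)"

definition higson_algebra :: "('x::metric_space \<Rightarrow> complex) cstar_alg" where
  "higson_algebra = vv_algebra complex_cstar"

definition higson_compactification :: "(('x::metric_space \<Rightarrow> complex) \<Rightarrow> complex) topology" where
  "higson_compactification = maximal_ideal_space higson_algebra"

definition higson_embedding :: "'x::metric_space \<Rightarrow> ('x \<Rightarrow> complex) \<Rightarrow> complex" where
  "higson_embedding x = (\<lambda>f\<in>carrier higson_algebra. f x)"

text \<open>The remainder \<open>Z \<setminus> X\<close> of a compactification \<open>i : X \<rightarrow> Z\<close>.\<close>

definition remainder :: "'z topology \<Rightarrow> ('x \<Rightarrow> 'z) \<Rightarrow> 'z topology" where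
  "remainder Z i = subtopology Z (topspace Z - range i)"

definition higson_corona :: "(('x::metric_space \<Rightarrow> complex) \<Rightarrow> complex) topology" where
  "higson_corona = remainder higson_compactification higson_embedding"

definition compactification :: "'z topology \<Rightarrow> ('x::metric_space \<Rightarrow> 'z) \<Rightarrow> bool" where
  "compactification Z i \<longleftrightarrow> compact_space Z \<and> Hausdorff_space Z \<and>
     embedding_map euclidean Z i \<and> Z closure_of (range i) = topspace Z"

definition admissible_compactification :: "'z topology \<Rightarrow> ('x::metric_space \<Rightarrow> 'z) \<Rightarrow> bool" where
  "admissible_compactification Z i \<longleftrightarrow> compactification Z i \<and>
     (\<exists>d. Metric_space (topspace Z) d \<and> Metric_space.mtopology (topspace Z) d = Z \<and>
          vanishing_variation d i)"

text \<open>The canonical map \<open>\<eta>X \<rightarrow> Z\<close> is the continuous extension of \<open>i\<close>.\<close>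

definition is_higson_extension ::
  "'z topology \<Rightarrow> ('x::metric_space \<Rightarrow> 'z) \<Rightarrow> ((('x \<Rightarrow> complex) \<Rightarrow> complex) \<Rightarrow> 'z) \<Rightarrow> bool" where
  "is_higson_extension Z i \<pi> \<longleftrightarrow> \<pi> \<in> extensional (topspace higson_compactification) \<and>
     continuous_map higson_compactification Z \<pi> \<and> (\<forall>x. \<pi> (higson_embedding x) = i x)"

definition higson_extension ::
  "'z topology \<Rightarrow> ('x::metric_space \<Rightarrow> 'z) \<Rightarrow> (('x \<Rightarrow> complex) \<Rightarrow> complex) \<Rightarrow> 'z" where
  "higson_extension Z i = (THE \<pi>. is_higson_extension Z i \<pi>)"

definition restrict_to_space ::
  "((('x::metric_space \<Rightarrow> complex) \<Rightarrow> complex) \<Rightarrow> 'b) \<Rightarrow> 'x \<Rightarrow> 'b" where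
  "restrict_to_space f = f \<circ> higson_embedding"

text \<open>\<open>g\<close> on the corona is sent to the class of \<open>f \<circ> higson_embedding\<close> for any extension \<open>f\<close> of
  \<open>g\<close> to \<open>\<eta>X\<close>. The union is over all extensions; it is a single coset because
  the class does not depend on the extension.\<close>

definition corona_map ::
  "'b cstar_alg \<Rightarrow> ((('x::metric_space \<Rightarrow> complex) \<Rightarrow> complex) \<Rightarrow> 'b) \<Rightarrow> ('x \<Rightarrow> 'b) set" where
  "corona_map B g = (\<Union>f\<in>{f \<in> carrier (cont_algebra higson_compactification B).
       restrict f (topspace higson_corona) = g}.
     C0_functions B +>\<^bsub>vv_algebra B\<^esub> restrict_to_space f)"


section \<open>K-theory\<close>

text \<open>An \<open>m \<times> n\<close> matrix is a function \<open>nat \<Rightarrow> nat \<Rightarrow> _\<close> that vanishes outside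
  \<open>{..<m} \<times> {..<n}\<close>; a square matrix is paired with its size.\<close>

type_synonym 'u sqmat = "nat \<times> (nat \<Rightarrow> nat \<Rightarrow> 'u)"

definition matrices :: "'u cstar_alg \<Rightarrow> nat \<Rightarrow> nat \<Rightarrow> (nat \<Rightarrow> nat \<Rightarrow> 'u) set" where
  "matrices U m n = {a. \<forall>i j. a i j \<in> carrier U \<and> (\<not> (i < m \<and> j < n) \<longrightarrow> a i j = \<zero>\<^bsub>U\<^esub>)}"

text \<open>The argument \<open>k\<close> is the inner dimension.\<close>

definition matrix_mult ::
  "'u cstar_alg \<Rightarrow> nat \<Rightarrow> (nat \<Rightarrow> nat \<Rightarrow> 'u) \<Rightarrow> (nat \<Rightarrow> nat \<Rightarrow> 'u) \<Rightarrow> nat \<Rightarrow> nat \<Rightarrow> 'u" where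
  "matrix_mult U k a b = (\<lambda>i j. \<Oplus>\<^bsub>U\<^esub>l\<in>{..<k}. a i l \<otimes>\<^bsub>U\<^esub> b l j)"

definition matrix_adj :: "'u cstar_alg \<Rightarrow> (nat \<Rightarrow> nat \<Rightarrow> 'u) \<Rightarrow> nat \<Rightarrow> nat \<Rightarrow> 'u" where
  "matrix_adj U a = (\<lambda>i j. adj U (a j i))"

definition matrix_one :: "'u cstar_alg \<Rightarrow> nat \<Rightarrow> nat \<Rightarrow> nat \<Rightarrow> 'u" where
  "matrix_one U n = (\<lambda>i j. if i < n \<and> i = j then \<one>\<^bsub>U\<^esub> else \<zero>\<^bsub>U\<^esub>)"

definition direct_sum :: "'u cstar_alg \<Rightarrow> 'u sqmat \<Rightarrow> 'u sqmat \<Rightarrow> 'u sqmat" where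
  "direct_sum U = (\<lambda>(n, p) (m, q). (n + m, \<lambda>i j.
     if i < n \<and> j < n then p i j
     else if n \<le> i \<and> n \<le> j then q (i - n) (j - n) else \<zero>\<^bsub>U\<^esub>))"

definition sqmat_map :: "('u \<Rightarrow> 'v) \<Rightarrow> 'u sqmat \<Rightarrow> 'v sqmat" where
  "sqmat_map \<phi> = (\<lambda>(n, p). (n, \<lambda>i j. \<phi> (p i j)))"

definition zero_sqmat :: "'u cstar_alg \<Rightarrow> 'u sqmat" where
  "zero_sqmat U = (0, \<lambda>i j. \<zero>\<^bsub>U\<^esub>)"

definition projections :: "'u cstar_alg \<Rightarrow> 'u sqmat set" where
  "projections U = {(n, p). p \<in> matrices U n n \<and> matrix_adj U p = p \<and> matrix_mult U n p p = p}"

definition murray_von_neumann :: "'u cstar_alg \<Rightarrow> 'u sqmat \<Rightarrow> 'u sqmat \<Rightarrow> bool" where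
  "murray_von_neumann U = (\<lambda>(n, p) (m, q). \<exists>v\<in>matrices U m n.
     matrix_mult U m (matrix_adj U v) v = p \<and> matrix_mult U n v (matrix_adj U v) = q)"

text \<open>\<open>K\<^sub>0\<close> of a unital C*-algebra: the Grothendieck group of the semigroup of Murray-von Neumann
  classes of projections; the pair \<open>(p, q)\<close> stands for \<open>[p] - [q]\<close>.\<close>

definition K0_rel :: "'u cstar_alg \<Rightarrow> (('u sqmat \<times> 'u sqmat) \<times> ('u sqmat \<times> 'u sqmat)) set" where
  "K0_rel U = {((p, q), (p', q')). p \<in> projections U \<and> q \<in> projections U \<and>
     p' \<in> projections U \<and> q' \<in> projections U \<and>
     (\<exists>r\<in>projections U. murray_von_neumann U
        (direct_sum U (direct_sum U p q') r) (direct_sum U (direct_sum U p' q) r))}"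

definition K0_unital :: "'u cstar_alg \<Rightarrow> ('u sqmat \<times> 'u sqmat) set monoid" where
  "K0_unital U = \<lparr>carrier = (projections U \<times> projections U) // K0_rel U,
     monoid.mult = (\<lambda>\<kappa> \<kappa>'. \<Union>(p, q)\<in>\<kappa>. \<Union>(p', q')\<in>\<kappa>'.
       K0_rel U `` {(direct_sum U p p', direct_sum U q q')}),
     one = K0_rel U `` {(zero_sqmat U, zero_sqmat U)}\<rparr>"

definition K0_unital_map ::
  "'v cstar_alg \<Rightarrow> ('u \<Rightarrow> 'v) \<Rightarrow> ('u sqmat \<times> 'u sqmat) set \<Rightarrow> ('v sqmat \<times> 'v sqmat) set" where
  "K0_unital_map V \<phi> \<kappa> = (\<Union>(p, q)\<in>\<kappa>. K0_rel V `` {(sqmat_map \<phi> p, sqmat_map \<phi> q)})"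

text \<open>In general, \<open>K\<^sub>0(A)\<close> is the kernel of the map \<open>K\<^sub>0(A\<^sup>+) \<rightarrow> K\<^sub>0(\<complex>)\<close> induced by
  \<^const>\<open>snd\<close>.\<close>

definition K0 :: "'a cstar_alg \<Rightarrow> (('a \<times> complex) sqmat \<times> ('a \<times> complex) sqmat) set monoid" where
  "K0 A = (K0_unital (unitization A))\<lparr>carrier :=
     kernel (K0_unital (unitization A)) (K0_unital complex_cstar) (K0_unital_map complex_cstar snd)\<rparr>"

definition K0_map :: "'b cstar_alg \<Rightarrow> ('a \<Rightarrow> 'b) \<Rightarrow>
    (('a \<times> complex) sqmat \<times> ('a \<times> complex) sqmat) set \<Rightarrow>
    (('b \<times> complex) sqmat \<times> ('b \<times> complex) sqmat) set" where
  "K0_map B \<phi> = K0_unital_map (unitization B) (unitization_map \<phi>)"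

definition unitaries :: "'u cstar_alg \<Rightarrow> 'u sqmat set" where
  "unitaries U = {(n, u). u \<in> matrices U n n \<and>
     matrix_mult U n (matrix_adj U u) u = matrix_one U n \<and>
     matrix_mult U n u (matrix_adj U u) = matrix_one U n}"

text \<open>The C*-norm on matrices induces the topology of entrywise norm convergence.\<close>

definition unitary_homotopic :: "'u cstar_alg \<Rightarrow> 'u sqmat \<Rightarrow> 'u sqmat \<Rightarrow> bool" where
  "unitary_homotopic U = (\<lambda>(n, u) (m, v). n = m \<and>
     (\<exists>\<gamma>. (\<forall>t\<in>{0..1}. (n, \<gamma> t) \<in> unitaries U) \<and>
          (\<forall>i<n. \<forall>j<n. pathin (cstar_topology U) (\<lambda>t. \<gamma> t i j)) \<and> \<gamma> 0 = u \<and> \<gamma> 1 = v))"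

definition K1_rel :: "'u cstar_alg \<Rightarrow> ('u sqmat \<times> 'u sqmat) set" where
  "K1_rel U = {(u, v). u \<in> unitaries U \<and> v \<in> unitaries U \<and>
     (\<exists>k l. unitary_homotopic U (direct_sum U u (k, matrix_one U k))
                                (direct_sum U v (l, matrix_one U l)))}"

definition K1 :: "'a cstar_alg \<Rightarrow> ('a \<times> complex) sqmat set monoid" where
  "K1 A = \<lparr>carrier = unitaries (unitization A) // K1_rel (unitization A),
     monoid.mult = (\<lambda>\<kappa> \<kappa>'. \<Union>u\<in>\<kappa>. \<Union>v\<in>\<kappa>'.
       K1_rel (unitization A) `` {direct_sum (unitization A) u v}),
     one = K1_rel (unitization A) `` {zero_sqmat (unitization A)}\<rparr>"

definition K1_map ::
  "'b cstar_alg \<Rightarrow> ('a \<Rightarrow> 'b) \<Rightarrow> ('a \<times> complex) sqmat set \<Rightarrow> ('b \<times> complex) sqmat set" where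
  "K1_map B \<phi> \<kappa> =
     (\<Union>u\<in>\<kappa>. K1_rel (unitization B) `` {sqmat_map (unitization_map \<phi>) u})"

end

theory Submission
  imports Defs
begin

text \<open>
  Write \<open>B\<close> for the coefficient algebra \<open>D \<otimes> \<K>\<close>. Everything rests on three facts about the Higson
  compactification \<open>\<eta>X\<close>.

  (1) A character \<open>\<omega>\<close> of the algebra of scalar functions of vanishing variation is approximated on
  finitely many functions by evaluation at a point of \<open>X\<close> (\<open>character_approx\<close>): otherwise
  \<open>\<Sum> \<bar>f\<^sub>j - \<omega> f\<^sub>j\<bar>\<^sup>2\<close> would be bounded below, hence invertible, although \<open>\<omega>\<close> annihilates it.
  So \<open>X\<close> is dense in \<open>\<eta>X\<close> and \<open>\<eta>X\<close> is compact. For \<open>i : X \<rightarrow> Z\<close> of vanishing variation into a compact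
  metric space, the same approximation produces the point \<open>\<pi> \<omega>\<close> of \<open>Z\<close> at which \<open>\<omega>\<close> evaluates the
  functions \<open>d (z, i -)\<close>, that is, the extension \<open>\<pi> : \<eta>X \<rightarrow> Z\<close> of \<open>i\<close> (\<open>higson_extension_exists\<close>).

  (2) Conversely, every continuous map from \<open>\<eta>X\<close> to a metric space has vanishing variation on \<open>X\<close>
  (\<open>vanishing_variation_if_continuous\<close>), since by compactness it is controlled by finitely many
  scalar functions. This gives the restriction map to \<open>B\<close>-valued functions of vanishing variation.

  (3) A continuous function on \<open>\<eta>X\<close> vanishes on the corona if and only if it tends to \<open>0\<close> at infinity on
  \<open>X\<close> (\<open>vanishes_on_corona_iff\<close>), because the closed bounded subsets of \<open>X\<close> are compact. Together with
  Tietze's extension theorem for \<open>B\<close>-valued functions (\<open>Tietze_extension_cstar\<close>) this shows that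
  the map on the corona is well defined, everywhere defined and injective. The maps induced by \<open>\<pi>\<close>
  are injective because \<open>\<pi>\<close> is onto and sends exactly the corona to \<open>Z \<setminus> X\<close>.

  For the statement on K-theory, a pair of classes is represented by finitely many matrices over the
  unitization of \<open>C(\<partial>\<^sub>\<eta>X, B)\<close>, hence by finitely many \<open>B\<close>-valued functions on the corona. Extend them to
  \<open>\<eta>X\<close>, and map \<open>\<eta>X\<close> to \<open>\<real>\<^sup>\<nat>\<close> by countably many scalar functions that separate the values of these
  extensions and embed \<open>X\<close>. The image is an admissible compactification, by (2), and the chosen
  functions come from its remainder (\<open>corona_functions_factor\<close>). Since pullback is injective, matrices
  over \<open>C(Z \<setminus> X, B)\<close> that become projections or unitaries already are projections or unitaries, so
  the classes lift (\<open>K0_class_lift\<close>, \<open>K1_class_lift\<close>). That representatives may be chosen freely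
  rests on the relations that define \<open>K\<^sub>0\<close> and \<open>K\<^sub>1\<close> being equivalence relations preserved by
  homomorphisms.
\<close>

section \<open>C*-norms and continuity\<close>

lemma complex_ring_simps [simp]:
  "carrier complex_ring = UNIV" "x \<otimes>\<^bsub>complex_ring\<^esub> y = x * y" "\<one>\<^bsub>complex_ring\<^esub> = 1"
  "\<zero>\<^bsub>complex_ring\<^esub> = 0" "x \<oplus>\<^bsub>complex_ring\<^esub> y = x + y"
  by (simp_all add: complex_ring_def)

lemma cring_complex_ring: "cring complex_ring"
  by (rule cringI; (rule abelian_groupI comm_monoidI)?)
    (auto simp: algebra_simps intro: exI[of _ "- x" for x :: complex])

text \<open>A *-algebra with a C*-norm that need not be complete. Norm estimates, continuity and K-theory depend
  on this structure only; completeness enters through Tietze's theorem alone.\<close>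

locale pre_cstar_algebra = Module.module complex_ring A for A :: "'a cstar_alg" (structure) +
  assumes mult_closed [simp]: "x \<in> carrier A \<Longrightarrow> y \<in> carrier A \<Longrightarrow> x \<otimes> y \<in> carrier A"
    and mult_assoc: "x \<in> carrier A \<Longrightarrow> y \<in> carrier A \<Longrightarrow> z \<in> carrier A \<Longrightarrow>
      (x \<otimes> y) \<otimes> z = x \<otimes> (y \<otimes> z)"
    and distrib_right: "x \<in> carrier A \<Longrightarrow> y \<in> carrier A \<Longrightarrow> z \<in> carrier A \<Longrightarrow>
      (x \<oplus> y) \<otimes> z = x \<otimes> z \<oplus> y \<otimes> z"
    and distrib_left: "x \<in> carrier A \<Longrightarrow> y \<in> carrier A \<Longrightarrow> z \<in> carrier A \<Longrightarrow>
      x \<otimes> (y \<oplus> z) = x \<otimes> y \<oplus> x \<otimes> z"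
    and smult_mult_left: "x \<in> carrier A \<Longrightarrow> y \<in> carrier A \<Longrightarrow>
      (c \<odot> x) \<otimes> y = c \<odot> (x \<otimes> y)"
    and smult_mult_right: "x \<in> carrier A \<Longrightarrow> y \<in> carrier A \<Longrightarrow>
      x \<otimes> (c \<odot> y) = c \<odot> (x \<otimes> y)"
    and adj_closed [simp]: "x \<in> carrier A \<Longrightarrow> adj A x \<in> carrier A"
    and adj_adj: "x \<in> carrier A \<Longrightarrow> adj A (adj A x) = x"
    and adj_add: "x \<in> carrier A \<Longrightarrow> y \<in> carrier A \<Longrightarrow> adj A (x \<oplus> y) = adj A x \<oplus> adj A y"
    and adj_smult: "x \<in> carrier A \<Longrightarrow> adj A (c \<odot> x) = cnj c \<odot> adj A x"
    and adj_mult: "x \<in> carrier A \<Longrightarrow> y \<in> carrier A \<Longrightarrow> adj A (x \<otimes> y) = adj A y \<otimes> adj A x"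
    and cnorm_nonneg [simp]: "x \<in> carrier A \<Longrightarrow> 0 \<le> cnorm A x"
    and cnorm_eq_0: "x \<in> carrier A \<Longrightarrow> cnorm A x = 0 \<longleftrightarrow> x = \<zero>"
    and cnorm_add: "x \<in> carrier A \<Longrightarrow> y \<in> carrier A \<Longrightarrow>
      cnorm A (x \<oplus> y) \<le> cnorm A x + cnorm A y"
    and cnorm_smult: "x \<in> carrier A \<Longrightarrow> cnorm A (c \<odot> x) = cmod c * cnorm A x"
    and cnorm_mult: "x \<in> carrier A \<Longrightarrow> y \<in> carrier A \<Longrightarrow>
      cnorm A (x \<otimes> y) \<le> cnorm A x * cnorm A y"
    and cstar_identity: "x \<in> carrier A \<Longrightarrow> cnorm A (adj A x \<otimes> x) = (cnorm A x)\<^sup>2"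

lemma cstar_algebra_imp_pre_cstar_algebra:
  assumes "cstar_algebra A"
  shows "pre_cstar_algebra A"
proof -
  interpret cstar_algebra A by fact
  show ?thesis
    by unfold_locales (fact mult_closed mult_assoc distrib_right distrib_left smult_mult_left
        smult_mult_right adj_closed adj_adj adj_add adj_smult adj_mult cnorm_nonneg cnorm_eq_0
        cnorm_add cnorm_smult cnorm_mult cstar_identity)+
qed

context pre_cstar_algebra
begin

lemma smult_closed' [simp]: "x \<in> carrier A \<Longrightarrow> c \<odot> x \<in> carrier A"
  using smult_closed by simp

lemma smult_add_scalar: "x \<in> carrier A \<Longrightarrow> (c + d) \<odot> x = c \<odot> x \<oplus> d \<odot> x"
  using smult_l_distr[of c d x] by simp

lemma smult_add: "x \<in> carrier A \<Longrightarrow> y \<in> carrier A \<Longrightarrow> c \<odot> (x \<oplus> y) = c \<odot> x \<oplus> c \<odot> y"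
  using smult_r_distr[of c x y] by simp

lemma smult_smult: "x \<in> carrier A \<Longrightarrow> c \<odot> (d \<odot> x) = (c * d) \<odot> x"
  using smult_assoc1[of c d x] by simp

lemma smult_1 [simp]: "x \<in> carrier A \<Longrightarrow> 1 \<odot> x = x"
  using smult_one[of x] by simp

lemma smult_0 [simp]: "x \<in> carrier A \<Longrightarrow> 0 \<odot> x = \<zero>"
  using smult_l_null[of x] by simp

lemma smult_zero [simp]: "c \<odot> \<zero> = \<zero>"
  using smult_r_null[of c] by simp

lemma uminus_eq_smult: "x \<in> carrier A \<Longrightarrow> \<ominus> x = (-1) \<odot> x"
  using smult_add_scalar[of x "-1" 1] by (simp add: minus_equality)

lemma minus_eq_smult: "x \<in> carrier A \<Longrightarrow> y \<in> carrier A \<Longrightarrow> x \<ominus> y = x \<oplus> (-1) \<odot> y"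
  by (simp add: a_minus_def uminus_eq_smult)

lemma minus_eq_0_iff: "x \<in> carrier A \<Longrightarrow> y \<in> carrier A \<Longrightarrow> x \<ominus> y = \<zero> \<longleftrightarrow> x = y"
proof
  assume xy: "x \<in> carrier A" "y \<in> carrier A" and "x \<ominus> y = \<zero>"
  have "x = x \<oplus> (\<ominus> y \<oplus> y)"
    using xy by (simp add: l_neg)
  also have "\<dots> = (x \<ominus> y) \<oplus> y"
    using xy by (simp add: a_minus_def a_assoc)
  finally show "x = y"
    using xy \<open>x \<ominus> y = \<zero>\<close> by simp
qed (simp add: a_minus_def r_neg)

lemma minus_zero_right [simp]: "x \<in> carrier A \<Longrightarrow> x \<ominus> \<zero> = x"
  by (simp add: minus_eq_smult)

lemma mult_zero_right [simp]: "x \<in> carrier A \<Longrightarrow> x \<otimes> \<zero> = \<zero>"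
  using smult_mult_right[of x \<zero> 0] by simp

lemma mult_zero_left [simp]: "x \<in> carrier A \<Longrightarrow> \<zero> \<otimes> x = \<zero>"
  using smult_mult_left[of \<zero> x 0] by simp

lemma adj_zero [simp]: "adj A \<zero> = \<zero>"
  using adj_smult[of \<zero> 0] by simp

lemma cnorm_zero [simp]: "cnorm A \<zero> = 0"
  using cnorm_eq_0 by simp

lemma cnorm_uminus [simp]: "x \<in> carrier A \<Longrightarrow> cnorm A (\<ominus> x) = cnorm A x"
  by (simp add: uminus_eq_smult cnorm_smult)

lemma cnorm_minus_le: "x \<in> carrier A \<Longrightarrow> y \<in> carrier A \<Longrightarrow> cnorm A (x \<ominus> y) \<le> cnorm A x + cnorm A y"
  using cnorm_add[of x "\<ominus> y"] by (simp add: a_minus_def)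

lemma cnorm_minus_commute: 
  "x \<in> carrier A \<Longrightarrow> y \<in> carrier A \<Longrightarrow> cnorm A (x \<ominus> y) = cnorm A (y \<ominus> x)"
  using cnorm_uminus[of "x \<ominus> y"] by (simp add: a_minus_def minus_add a_comm)

lemma minus_add_minus:
  "x \<in> carrier A \<Longrightarrow> y \<in> carrier A \<Longrightarrow> z \<in> carrier A \<Longrightarrow> (x \<ominus> y) \<oplus> (y \<ominus> z) = x \<ominus> z"
  by (simp add: a_minus_def a_assoc r_neg1)

lemma cnorm_triangle:
  "x \<in> carrier A \<Longrightarrow> y \<in> carrier A \<Longrightarrow> z \<in> carrier A \<Longrightarrow>
    cnorm A (x \<ominus> z) \<le> cnorm A (x \<ominus> y) + cnorm A (y \<ominus> z)"
  using cnorm_add[of "x \<ominus> y" "y \<ominus> z"] by (simp add: minus_add_minus)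

lemma cnorm_le_cnorm_minus:
  "x \<in> carrier A \<Longrightarrow> y \<in> carrier A \<Longrightarrow> cnorm A x \<le> cnorm A y + cnorm A (x \<ominus> y)"
  using cnorm_triangle[of x y \<zero>] by simp

text \<open>The C*-identity gives \<open>\<parallel>y\<parallel>\<^sup>2 = \<parallel>y* y\<parallel> \<le> \<parallel>y*\<parallel> \<parallel>y\<parallel>\<close>, for \<open>y = x\<close> and for \<open>y = x*\<close>.\<close>

lemma cnorm_adj [simp]:
  assumes "x \<in> carrier A"
  shows "cnorm A (adj A x) = cnorm A x"
proof -
  have le: "cnorm A y \<le> cnorm A (adj A y)" if y: "y \<in> carrier A" for y
  proof (cases "cnorm A y = 0")
    case False
    have "cnorm A y * cnorm A y \<le> cnorm A (adj A y) * cnorm A y"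
      using cstar_identity[OF y] cnorm_mult[of "adj A y" y] y by (simp add: power2_eq_square)
    then show ?thesis
      using False cnorm_nonneg[OF y] by simp
  qed (use y in simp)
  show ?thesis
    using le[OF assms] le[of "adj A x"] assms by (simp add: adj_adj)
qed

lemma add_minus_add:
  assumes "x \<in> carrier A" "y \<in> carrier A" "x' \<in> carrier A" "y' \<in> carrier A"
  shows "(x \<oplus> y) \<ominus> (x' \<oplus> y') = (x \<ominus> x') \<oplus> (y \<ominus> y')"
  using assms by (simp add: a_minus_def minus_add a_assoc a_lcomm)

lemma smult_minus:
  assumes "x \<in> carrier A" "y \<in> carrier A"
  shows "c \<odot> x \<ominus> c \<odot> y = c \<odot> (x \<ominus> y)"
  using assms by (simp add: minus_eq_smult smult_add smult_smult mult.commute)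

lemma adj_minus:
  assumes "x \<in> carrier A" "y \<in> carrier A"
  shows "adj A x \<ominus> adj A y = adj A (x \<ominus> y)"
  using assms by (simp add: minus_eq_smult adj_add adj_smult)

lemma mult_minus_mult:
  assumes "x \<in> carrier A" "y \<in> carrier A" "x' \<in> carrier A" "y' \<in> carrier A"
  shows "x \<otimes> y \<ominus> x' \<otimes> y' = (x \<ominus> x') \<otimes> y \<oplus> x' \<otimes> (y \<ominus> y')"
proof -
  have "(x \<ominus> x') \<otimes> y = x \<otimes> y \<ominus> x' \<otimes> y" "x' \<otimes> (y \<ominus> y') = x' \<otimes> y \<ominus> x' \<otimes> y'"
    using assms by (simp_all add: minus_eq_smult distrib_left distrib_right smult_mult_left smult_mult_right)
  then show ?thesis
    using assms by (simp add: minus_add_minus)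
qed

lemma smult_minus_smult:
  assumes "x \<in> carrier A" "x' \<in> carrier A"
  shows "c \<odot> x \<ominus> c' \<odot> x' = (c - c') \<odot> x \<oplus> c' \<odot> (x \<ominus> x')"
proof -
  have "(c - c') \<odot> x = c \<odot> x \<ominus> c' \<odot> x" 
    using smult_add_scalar[of x c "- c'"] assms by (simp add: minus_eq_smult smult_smult)
  then show ?thesis
    using assms by (simp add: minus_add_minus smult_minus[symmetric])
qed

lemma Metric_space_cstar_dist: "Metric_space (carrier A) (cstar_dist A)"
proof
  fix x y z
  show "0 \<le> cstar_dist A x y"
    by (simp add: cstar_dist_def)
  show "cstar_dist A x y = cstar_dist A y x"
    by (simp add: cstar_dist_def cnorm_minus_commute)
  assume xy: "x \<in> carrier A" "y \<in> carrier A"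
  show "cstar_dist A x y = 0 \<longleftrightarrow> x = y"
    using xy by (simp add: cstar_dist_def cnorm_eq_0 minus_eq_0_iff)
  assume "z \<in> carrier A"
  with xy show "cstar_dist A x z \<le> cstar_dist A x y + cstar_dist A y z"
    by (simp add: cstar_dist_def cnorm_triangle)
qed

lemma topspace_cstar_topology [simp]: "topspace (cstar_topology A) = carrier A"
  by (simp add: cstar_topology_def Metric_space.topspace_mtopology[OF Metric_space_cstar_dist])

lemma Hausdorff_cstar_topology: "Hausdorff_space (cstar_topology A)"
  by (simp add: cstar_topology_def Metric_space.Hausdorff_space_mtopology[OF Metric_space_cstar_dist])

lemma continuous_map_cstar_topology:
  "continuous_map Y (cstar_topology A) f \<longleftrightarrow> f \<in> topspace Y \<rightarrow> carrier A \<and>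
    (\<forall>x\<in>topspace Y. \<forall>\<epsilon>>0. \<exists>U. openin Y U \<and> x \<in> U \<and> (\<forall>y\<in>U. cnorm A (f y \<ominus> f x) < \<epsilon>))"
    (is "?lhs \<longleftrightarrow> ?rhs")
proof -
  interpret M: Metric_space "carrier A" "cstar_dist A"
    by (rule Metric_space_cstar_dist)
  show ?thesis
  proof
    assume L: ?lhs
    have f: "f \<in> topspace Y \<rightarrow> carrier A"
      using L by (simp add: continuous_map_def)
    moreover have "\<exists>U. openin Y U \<and> x \<in> U \<and> (\<forall>y\<in>U. cnorm A (f y \<ominus> f x) < \<epsilon>)" 
      if x: "x \<in> topspace Y" "\<epsilon> > 0" for x \<epsilon>
    proof -
      obtain U where U: "openin Y U" "x \<in> U" "\<forall>y\<in>U. f y \<in> M.mball (f x) \<epsilon>"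
        using L[unfolded cstar_topology_def M.continuous_map_to_metric, rule_format, OF x] by blast
      then show ?thesis
        by (intro exI[of _ U]) (auto simp: M.in_mball M.commute cstar_dist_def cnorm_minus_commute)
    qed
    ultimately show ?rhs by blast
  next
    assume R: ?rhs
    show ?lhs
      unfolding cstar_topology_def M.continuous_map_to_metric
    proof (intro ballI allI impI)
      fix x \<epsilon> assume x: "x \<in> topspace Y" and "\<epsilon> > (0::real)"
      then obtain U where U: "openin Y U" "x \<in> U" "\<forall>y\<in>U. cnorm A (f y \<ominus> f x) < \<epsilon>"
        using R by blast
      moreover have "f y \<in> M.mball (f x) \<epsilon>" if "y \<in> U" for y
      proof -
        have "y \<in> topspace Y" using that U openin_subset by blast
        then have "f y \<in> carrier A" "f x \<in> carrier A" using R x by auto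
        then show ?thesis 
          using U that cnorm_minus_commute[of "f x" "f y"] by (simp add: M.in_mball cstar_dist_def)
      qed
      ultimately show "\<exists>U. openin Y U \<and> x \<in> U \<and> (\<forall>y\<in>U. f y \<in> M.mball (f x) \<epsilon>)"
        by blast
    qed
  qed
qed

text \<open>The algebraic operations are continuous because they are locally Lipschitz. For products the
  constant depends on the size of a factor near the point; the restriction to increments of norm
  at most \<open>1\<close> makes it uniform.\<close>

lemma continuous_map_by_domination:
  assumes h: "h \<in> topspace Y \<rightarrow> carrier A"
    and f: "continuous_map Y (cstar_topology A) f" and g: "continuous_map Y (cstar_topology A) g"
    and C: "\<And>x. x \<in> topspace Y \<Longrightarrow> \<exists>C\<ge>0. \<forall>y\<in>topspace Y. 
      cnorm A (g y \<ominus> g x) \<le> 1 \<longrightarrow> cnorm A (h y \<ominus> h x) \<le> C * (cnorm A (f y \<ominus> f x) + cnorm A (g y \<ominus> g x))"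
  shows "continuous_map Y (cstar_topology A) h"
  unfolding continuous_map_cstar_topology
proof (intro conjI ballI allI impI)
  fix x \<epsilon> assume x: "x \<in> topspace Y" and \<epsilon>: "\<epsilon> > (0::real)"
  obtain C where "C \<ge> 0" and C: "\<And>y. y \<in> topspace Y \<Longrightarrow> cnorm A (g y \<ominus> g x) \<le> 1 \<Longrightarrow> 
      cnorm A (h y \<ominus> h x) \<le> C * (cnorm A (f y \<ominus> f x) + cnorm A (g y \<ominus> g x))"
    using C[OF x] by blast
  define \<delta> where "\<delta> = min 1 (\<epsilon> / (2 * C + 1))"
  have \<delta>: "\<delta> > 0" "\<delta> \<le> 1" "C * (2 * \<delta>) < \<epsilon>"
  proof -
    show "\<delta> > 0" "\<delta> \<le> 1" using \<epsilon> \<open>C \<ge> 0\<close> by (simp_all add: \<delta>_def)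
    have "\<delta> * (2 * C + 1) \<le> \<epsilon>" 
      using \<open>C \<ge> 0\<close> mult_right_mono[OF min.cobounded2[of 1 "\<epsilon> / (2 * C + 1)"], of "2 * C + 1"] by (simp add: \<delta>_def)
    then show "C * (2 * \<delta>) < \<epsilon>" using \<open>\<delta> > 0\<close> by (simp add: algebra_simps)
  qed
  obtain U where U: "openin Y U" "x \<in> U" "\<forall>y\<in>U. cnorm A (f y \<ominus> f x) < \<delta>"
    using f x \<delta> unfolding continuous_map_cstar_topology by blast
  obtain V where V: "openin Y V" "x \<in> V" "\<forall>y\<in>V. cnorm A (g y \<ominus> g x) < \<delta>"
    using g x \<delta> unfolding continuous_map_cstar_topology by blast
  have "cnorm A (h y \<ominus> h x) < \<epsilon>" if "y \<in> U \<inter> V" for y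
  proof -
    have "y \<in> topspace Y" using that U openin_subset by blast
    then have "cnorm A (h y \<ominus> h x) \<le> C * (cnorm A (f y \<ominus> f x) + cnorm A (g y \<ominus> g x))"
      using C V that \<delta> by force
    also have "\<dots> \<le> C * (2 * \<delta>)"
      using U V that \<open>C \<ge> 0\<close> by (intro mult_left_mono) force+
    finally show ?thesis using \<delta> by simp
  qed
  then show "\<exists>U. openin Y U \<and> x \<in> U \<and> (\<forall>y\<in>U. cnorm A (h y \<ominus> h x) < \<epsilon>)"
    using U V by (intro exI[of _ "U \<inter> V"]) auto
qed (use h in simp)

lemma continuous_map_in_carrier:
  "continuous_map Y (cstar_topology A) f \<Longrightarrow> y \<in> topspace Y \<Longrightarrow> f y \<in> carrier A"
  by (auto simp: continuous_map_cstar_topology)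

lemma continuous_map_const_cstar: 
  "a \<in> carrier A \<Longrightarrow> continuous_map Y (cstar_topology A) (\<lambda>_. a)"
  by simp

lemma continuous_map_add_cstar:
  assumes f: "continuous_map Y (cstar_topology A) f" and g: "continuous_map Y (cstar_topology A) g"
  shows "continuous_map Y (cstar_topology A) (\<lambda>y. f y \<oplus> g y)"
proof (rule continuous_map_by_domination[OF _ f g])
  show "\<exists>C\<ge>0. \<forall>y\<in>topspace Y. cnorm A (g y \<ominus> g x) \<le> 1 \<longrightarrow> 
    cnorm A (f y \<oplus> g y \<ominus> (f x \<oplus> g x)) \<le> C * (cnorm A (f y \<ominus> f x) + cnorm A (g y \<ominus> g x))"
    if "x \<in> topspace Y" for x
    using continuous_map_in_carrier[OF f] continuous_map_in_carrier[OF g] that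
    by (intro exI[of _ 1]) (auto simp: add_minus_add cnorm_add)
qed (use continuous_map_in_carrier[OF f] continuous_map_in_carrier[OF g] in auto)

lemma continuous_map_mult_cstar:
  assumes f: "continuous_map Y (cstar_topology A) f" and g: "continuous_map Y (cstar_topology A) g"
  shows "continuous_map Y (cstar_topology A) (\<lambda>y. f y \<otimes> g y)"
proof (rule continuous_map_by_domination[OF _ f g])
  fix x assume x: "x \<in> topspace Y"
  define C where "C = max (cnorm A (f x)) (cnorm A (g x) + 1)"
  have "cnorm A (f y \<otimes> g y \<ominus> f x \<otimes> g x) \<le> C * (cnorm A (f y \<ominus> f x) + cnorm A (g y \<ominus> g x))"
    if y: "y \<in> topspace Y" and 1: "cnorm A (g y \<ominus> g x) \<le> 1" for y
  proof -
    have c: "f x \<in> carrier A" "f y \<in> carrier A" "g x \<in> carrier A" "g y \<in> carrier A"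
      using continuous_map_in_carrier[OF f] continuous_map_in_carrier[OF g] x y by auto
    have "cnorm A (g y) \<le> cnorm A (g x) + 1"
      using cnorm_le_cnorm_minus[of "g y" "g x"] c 1 by linarith
    then have C: "cnorm A (g y) \<le> C" "cnorm A (f x) \<le> C" 
      by (auto simp: C_def)
    have "cnorm A (f y \<otimes> g y \<ominus> f x \<otimes> g x) \<le> cnorm A (f y \<ominus> f x) * cnorm A (g y) + cnorm A (f x) * cnorm A (g y \<ominus> g x)"
      unfolding mult_minus_mult[OF c(2,4,1,3)]
      using c by (intro order.trans[OF cnorm_add] add_mono cnorm_mult) auto
    also have "\<dots> \<le> cnorm A (f y \<ominus> f x) * C + C * cnorm A (g y \<ominus> g x)"
      using c C by (intro add_mono mult_left_mono mult_right_mono) auto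
    finally show ?thesis by (simp add: algebra_simps)
  qed
  moreover have "C \<ge> 0" using continuous_map_in_carrier[OF f x] by (auto simp: C_def le_max_iff_disj)
  ultimately show "\<exists>C\<ge>0. \<forall>y\<in>topspace Y. cnorm A (g y \<ominus> g x) \<le> 1 \<longrightarrow> 
    cnorm A (f y \<otimes> g y \<ominus> (f x \<otimes> g x)) \<le> C * (cnorm A (f y \<ominus> f x) + cnorm A (g y \<ominus> g x))"
    by blast
qed (use continuous_map_in_carrier[OF f] continuous_map_in_carrier[OF g] in auto)

lemma continuous_map_adj_cstar:
  assumes f: "continuous_map Y (cstar_topology A) f"
  shows "continuous_map Y (cstar_topology A) (\<lambda>y. adj A (f y))"
proof (rule continuous_map_by_domination[OF _ f f])
  show "\<exists>C\<ge>0. \<forall>y\<in>topspace Y. cnorm A (f y \<ominus> f x) \<le> 1 \<longrightarrow> 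
    cnorm A (adj A (f y) \<ominus> adj A (f x)) \<le> C * (cnorm A (f y \<ominus> f x) + cnorm A (f y \<ominus> f x))"
    if "x \<in> topspace Y" for x
    using continuous_map_in_carrier[OF f] that
    by (intro exI[of _ 1]) (auto simp: adj_minus)
qed (use continuous_map_in_carrier[OF f] in auto)

lemma continuous_map_smult_cstar:
  assumes l: "continuous_map Y euclidean l" and f: "continuous_map Y (cstar_topology A) f"
  shows "continuous_map Y (cstar_topology A) (\<lambda>y. l y \<odot> f y)"
  unfolding continuous_map_cstar_topology
proof (intro conjI ballI allI impI)
  fix x \<epsilon> assume x: "x \<in> topspace Y" and \<epsilon>: "\<epsilon> > (0::real)"
  have fx: "f x \<in> carrier A" by (rule continuous_map_in_carrier[OF f x])
  define C where "C = cnorm A (f x) + 1 + cmod (l x)"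
  have "C \<ge> 1" using fx by (simp add: C_def)
  define \<delta> where "\<delta> = min 1 (\<epsilon> / (2 * C))"
  have \<delta>: "\<delta> > 0" "\<delta> \<le> 1" "C * \<delta> < \<epsilon>"
  proof -
    show "\<delta> > 0" "\<delta> \<le> 1" using \<epsilon> \<open>C \<ge> 1\<close> by (simp_all add: \<delta>_def)
    have "\<delta> * (2 * C) \<le> \<epsilon>" 
      using \<open>C \<ge> 1\<close> mult_right_mono[OF min.cobounded2[of 1 "\<epsilon> / (2 * C)"], of "2 * C"] by (simp add: \<delta>_def)
    moreover have "C * \<delta> > 0" using \<open>\<delta> > 0\<close> \<open>C \<ge> 1\<close> by simp
    ultimately show "C * \<delta> < \<epsilon>" by (simp add: algebra_simps)
  qed
  obtain U where U: "openin Y U" "x \<in> U" "\<forall>y\<in>U. cnorm A (f y \<ominus> f x) < \<delta>"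
    using f x \<delta> unfolding continuous_map_cstar_topology by blast
  define V where "V = {y \<in> topspace Y. l y \<in> ball (l x) \<delta>}"
  have V: "openin Y V" "x \<in> V" "\<forall>y\<in>V. cmod (l y - l x) < \<delta>"
    using x \<delta> openin_continuous_map_preimage[OF l, of "ball (l x) \<delta>"]
    by (auto simp: V_def dist_norm norm_minus_commute)
  have "cnorm A (l y \<odot> f y \<ominus> l x \<odot> f x) < \<epsilon>" if y: "y \<in> U \<inter> V" for y
  proof -
    have "y \<in> topspace Y" using that U openin_subset by blast
    then have fy: "f y \<in> carrier A" by (rule continuous_map_in_carrier[OF f])
    have "cnorm A (f y \<ominus> f x) < \<delta>" using U y by auto
    then have "cnorm A (f y) \<le> cnorm A (f x) + 1"
      using cnorm_le_cnorm_minus[OF fy fx] \<delta> by linarith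
    have "cnorm A (l y \<odot> f y \<ominus> l x \<odot> f x) \<le> cmod (l y - l x) * cnorm A (f y) + cmod (l x) * cnorm A (f y \<ominus> f x)"
      unfolding smult_minus_smult[OF fy fx]
      using fx fy cnorm_add[of "(l y - l x) \<odot> f y" "l x \<odot> (f y \<ominus> f x)"] by (simp add: cnorm_smult)
    also have "\<dots> \<le> \<delta> * (cnorm A (f x) + 1) + cmod (l x) * \<delta>"
      using V U y fx fy \<open>cnorm A (f y) \<le> _\<close> by (intro add_mono mult_mono) (auto intro: less_imp_le)
    finally show ?thesis using \<delta> by (simp add: C_def algebra_simps)
  qed
  then show "\<exists>U. openin Y U \<and> x \<in> U \<and> (\<forall>y\<in>U. cnorm A (l y \<odot> f y \<ominus> l x \<odot> f x) < \<epsilon>)"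
    using U V by (intro exI[of _ "U \<inter> V"]) auto
qed (use continuous_map_in_carrier[OF f] in auto)

lemma continuous_map_cnorm:
  assumes f: "continuous_map Y (cstar_topology A) f"
  shows "continuous_map Y euclideanreal (\<lambda>y. cnorm A (f y))"
proof -
  have "continuous_map Y (Metric_space.mtopology UNIV dist) (\<lambda>y. cnorm A (f y))"
    unfolding Met_TC.continuous_map_to_metric
  proof (intro ballI allI impI)
    fix x \<epsilon> assume x: "x \<in> topspace Y" and \<epsilon>: "\<epsilon> > (0::real)"
    then obtain U where U: "openin Y U" "x \<in> U" "\<forall>y\<in>U. cnorm A (f y \<ominus> f x) < \<epsilon>"
      using f unfolding continuous_map_cstar_topology by blast
    have "dist (cnorm A (f x)) (cnorm A (f y)) < \<epsilon>" if y: "y \<in> U" for y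
    proof -
      have "y \<in> topspace Y" using y U openin_subset by blast
      then have "f x \<in> carrier A" "f y \<in> carrier A"
        using x continuous_map_in_carrier[OF f] by auto
      then show ?thesis
        using cnorm_le_cnorm_minus[of "f x" "f y"] cnorm_le_cnorm_minus[of "f y" "f x"] U(3) y
        by (fastforce simp: dist_real_def cnorm_minus_commute[of "f x" "f y"])
    qed
    then show "\<exists>U. openin Y U \<and> x \<in> U \<and> (\<forall>y\<in>U. cnorm A (f y) \<in> Met_TC.mball (cnorm A (f x)) \<epsilon>)"
      using U by (intro exI[of _ U]) auto
  qed
  then show ?thesis by simp
qed

end


section \<open>Algebras of functions\<close>

lemma pointwise_algebra_simps [simp]:
  "carrier (pointwise_algebra S F B) = F"
  "f \<otimes>\<^bsub>pointwise_algebra S F B\<^esub> g = (\<lambda>y\<in>S. f y \<otimes>\<^bsub>B\<^esub> g y)"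
  "f \<oplus>\<^bsub>pointwise_algebra S F B\<^esub> g = (\<lambda>y\<in>S. f y \<oplus>\<^bsub>B\<^esub> g y)"
  "\<zero>\<^bsub>pointwise_algebra S F B\<^esub> = (\<lambda>y\<in>S. \<zero>\<^bsub>B\<^esub>)"
  "c \<odot>\<^bsub>pointwise_algebra S F B\<^esub> f = (\<lambda>y\<in>S. c \<odot>\<^bsub>B\<^esub> f y)"
  "adj (pointwise_algebra S F B) f = (\<lambda>y\<in>S. adj B (f y))"
  by (simp_all add: pointwise_algebra_def)

lemma cnorm_pointwise_le:
  assumes "\<And>y. y \<in> S \<Longrightarrow> cnorm B (f y) \<le> C" "0 \<le> C"
  shows "cnorm (pointwise_algebra S F B) f \<le> C"
  using assms by (auto simp: pointwise_algebra_def intro!: cSup_least)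

lemma cnorm_le_cnorm_pointwise:
  assumes "\<And>y. y \<in> S \<Longrightarrow> cnorm B (f y) \<le> C"
  shows "0 \<le> cnorm (pointwise_algebra S F B) f"
    and "y \<in> S \<Longrightarrow> cnorm B (f y) \<le> cnorm (pointwise_algebra S F B) f"
proof -
  have "bdd_above (insert 0 ((\<lambda>y. cnorm B (f y)) ` S))"
    using assms by (auto intro!: bdd_aboveI[of _ C])
  then show "0 \<le> cnorm (pointwise_algebra S F B) f" 
    and "y \<in> S \<Longrightarrow> cnorm B (f y) \<le> cnorm (pointwise_algebra S F B) f"
    by (auto simp: pointwise_algebra_def intro!: cSup_upper)
qed

text \<open>The common pattern of \<open>C(Y, B)\<close> and of the algebra of functions of vanishing variation: a space of
  bounded functions closed under the pointwise operations inherits the C*-norm as a supremum.\<close>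

lemma pre_cstar_algebra_pointwise:
  assumes B: "pre_cstar_algebra B"
    and F: "\<And>f. f \<in> F \<Longrightarrow> f \<in> S \<rightarrow>\<^sub>E carrier B"
    and bound: "\<And>f. f \<in> F \<Longrightarrow> \<exists>C. \<forall>y\<in>S. cnorm B (f y) \<le> C"
    and zero: "(\<lambda>y\<in>S. \<zero>\<^bsub>B\<^esub>) \<in> F"
    and add: "\<And>f g. f \<in> F \<Longrightarrow> g \<in> F \<Longrightarrow> (\<lambda>y\<in>S. f y \<oplus>\<^bsub>B\<^esub> g y) \<in> F"
    and mult: "\<And>f g. f \<in> F \<Longrightarrow> g \<in> F \<Longrightarrow> (\<lambda>y\<in>S. f y \<otimes>\<^bsub>B\<^esub> g y) \<in> F"
    and smult: "\<And>c f. f \<in> F \<Longrightarrow> (\<lambda>y\<in>S. c \<odot>\<^bsub>B\<^esub> f y) \<in> F"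
    and adj: "\<And>f. f \<in> F \<Longrightarrow> (\<lambda>y\<in>S. adj B (f y)) \<in> F"
  shows "pre_cstar_algebra (pointwise_algebra S F B)" (is "pre_cstar_algebra ?P")
proof -
  interpret B: pre_cstar_algebra B by fact
  have c [simp]: "f y \<in> carrier B" if "f \<in> F" "y \<in> S" for f y
    using F[OF that(1)] that(2) by (auto simp: PiE_iff)
  have [simp]: "(\<lambda>y\<in>S. f y) = f" if "f \<in> F" for f
    using F[OF that] by (simp add: PiE_iff extensional_restrict)
  have [simp]: "f \<in> extensional S" if "f \<in> F" for f
    using F[OF that] by (simp add: PiE_iff)
  note eqI = extensionalityI[of _ S]
  have nn: "0 \<le> cnorm ?P f" if "f \<in> F" for f
    using bound[OF that] cnorm_le_cnorm_pointwise(1) by metis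
  have ub: "cnorm B (f y) \<le> cnorm ?P f" if "f \<in> F" "y \<in> S" for f y
    using bound[OF that(1)] cnorm_le_cnorm_pointwise(2) that(2) by metis
  have smult_le: "cnorm ?P (c \<odot>\<^bsub>?P\<^esub> f) \<le> cmod c * cnorm ?P f" if f: "f \<in> F" for c f
    using f ub nn by (intro cnorm_pointwise_le) (auto simp: B.cnorm_smult intro!: mult_left_mono)
  have "abelian_group ?P"
  proof (rule abelian_groupI)
    fix f assume f: "f \<in> carrier ?P"
    then show "\<exists>g\<in>carrier ?P. g \<oplus>\<^bsub>?P\<^esub> f = \<zero>\<^bsub>?P\<^esub>"
      using smult[of f "-1"]
      by (intro bexI[of _ "\<lambda>y\<in>S. (-1) \<odot>\<^bsub>B\<^esub> f y"]) (auto intro!: restrict_ext simp flip: B.uminus_eq_smult simp: B.l_neg)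
  qed (auto simp: add zero intro!: eqI B.a_assoc B.a_comm)
  then have "Module.module complex_ring ?P"
    by (intro moduleI cring_complex_ring)
      (auto simp: smult add intro!: eqI B.smult_add_scalar B.smult_add B.smult_smult[symmetric])
  moreover have "pre_cstar_algebra_axioms ?P"
  proof 
    fix f assume f: "f \<in> carrier ?P"
    show "cnorm ?P f = 0 \<longleftrightarrow> f = \<zero>\<^bsub>?P\<^esub>"
    proof
      assume "cnorm ?P f = 0"
      then have "f y = \<zero>\<^bsub>B\<^esub>" if "y \<in> S" for y
        using ub[of f y] that f by (intro B.cnorm_eq_0[THEN iffD1] antisym) auto
      then show "f = \<zero>\<^bsub>?P\<^esub>"
        using f zero by (intro eqI) auto
    next
      assume "f = \<zero>\<^bsub>?P\<^esub>"
      then have "cnorm ?P f \<le> 0"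
        by (intro cnorm_pointwise_le) auto
      then show "cnorm ?P f = 0" using nn f by force
    qed
    show "cnorm ?P (c \<odot>\<^bsub>?P\<^esub> f) = cmod c * cnorm ?P f" for c
    proof (cases "c = 0")
      case False
      have "f = (1/c) \<odot>\<^bsub>?P\<^esub> (c \<odot>\<^bsub>?P\<^esub> f)"
        using f False by (intro eqI) (auto simp: smult B.smult_smult)
      then have "cnorm ?P f \<le> cmod (1/c) * cnorm ?P (c \<odot>\<^bsub>?P\<^esub> f)"
        using smult_le[of "c \<odot>\<^bsub>?P\<^esub> f" "1/c"] f smult by simp
      then show ?thesis
        using smult_le[of f c] f False by (simp add: norm_divide field_simps)
    qed (use smult_le[of f c] nn[of "c \<odot>\<^bsub>?P\<^esub> f"] smult[of f c] f in simp)
    show "cnorm ?P (adj ?P f \<otimes>\<^bsub>?P\<^esub> f) = (cnorm ?P f)\<^sup>2"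
    proof (rule antisym)
      show "cnorm ?P (adj ?P f \<otimes>\<^bsub>?P\<^esub> f) \<le> (cnorm ?P f)\<^sup>2"
        using f ub nn by (intro cnorm_pointwise_le) (auto simp: B.cstar_identity intro!: power_mono)
      have "cnorm ?P f \<le> sqrt (cnorm ?P (adj ?P f \<otimes>\<^bsub>?P\<^esub> f))"
      proof (intro cnorm_pointwise_le real_le_rsqrt)
        fix y assume y: "y \<in> S"
        then show "(cnorm B (f y))\<^sup>2 \<le> cnorm ?P (adj ?P f \<otimes>\<^bsub>?P\<^esub> f)"
          using ub[of "adj ?P f \<otimes>\<^bsub>?P\<^esub> f" y] f mult[OF adj[of f], of f] by (simp add: B.cstar_identity)
      qed (use nn[OF mult[OF adj]] f in simp)
      then have "(cnorm ?P f)\<^sup>2 \<le> (sqrt (cnorm ?P (adj ?P f \<otimes>\<^bsub>?P\<^esub> f)))\<^sup>2"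
        using nn[of f] f by (intro power_mono) auto
      then show "(cnorm ?P f)\<^sup>2 \<le> cnorm ?P (adj ?P f \<otimes>\<^bsub>?P\<^esub> f)"
        using nn[OF mult[OF adj[of f], of f]] f by simp
    qed
    fix g assume g: "g \<in> carrier ?P"
    show "cnorm ?P (f \<oplus>\<^bsub>?P\<^esub> g) \<le> cnorm ?P f + cnorm ?P g"
      using f g ub nn by (intro cnorm_pointwise_le) (auto intro!: order.trans[OF B.cnorm_add] add_mono)
    show "cnorm ?P (f \<otimes>\<^bsub>?P\<^esub> g) \<le> cnorm ?P f * cnorm ?P g"
      using f g ub nn by (intro cnorm_pointwise_le) (auto intro!: order.trans[OF B.cnorm_mult] mult_mono)
  qed (auto simp: nn add mult smult adj B.mult_assoc B.distrib_left B.distrib_right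
      B.smult_mult_left B.smult_mult_right B.adj_adj B.adj_add B.adj_smult B.adj_mult
      intro!: eqI)
  ultimately show ?thesis
    by (rule pre_cstar_algebra.intro)
qed

lemma carrier_cont_algebra:
  "f \<in> carrier (cont_algebra Y B) \<longleftrightarrow> f \<in> extensional (topspace Y) \<and> continuous_map Y (cstar_topology B) f"
  by (simp add: cont_algebra_def)

lemma restrict_in_cont_algebra:
  "continuous_map Y (cstar_topology B) f \<Longrightarrow> restrict f (topspace Y) \<in> carrier (cont_algebra Y B)"
  by (auto simp: carrier_cont_algebra elim!: continuous_map_eq)

lemma bounded_cont_algebra:
  assumes B: "pre_cstar_algebra B" and Y: "compact_space Y" and f: "continuous_map Y (cstar_topology B) f"
  shows "\<exists>C. \<forall>y\<in>topspace Y. cnorm B (f y) \<le> C"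
proof -
  have "compactin euclideanreal ((\<lambda>y. cnorm B (f y)) ` topspace Y)"
    using Y f pre_cstar_algebra.continuous_map_cnorm[OF B]
    by (intro image_compactin[of Y]) (auto simp: compact_space_def)
  then have "bounded ((\<lambda>y. cnorm B (f y)) ` topspace Y)"
    by (simp add: compact_imp_bounded)
  then obtain C where "\<And>y. y \<in> topspace Y \<Longrightarrow> \<bar>cnorm B (f y)\<bar> \<le> C"
    by (auto simp: bounded_iff)
  then show ?thesis
    by (intro exI[of _ C]) force
qed

lemma pre_cstar_algebra_cont_algebra:
  assumes B: "pre_cstar_algebra B" and Y: "compact_space Y"
  shows "pre_cstar_algebra (cont_algebra Y B)"
proof -
  interpret B: pre_cstar_algebra B by fact
  show ?thesis
    unfolding cont_algebra_def
  proof (rule pre_cstar_algebra_pointwise[OF B]; (elim CollectE conjE)?)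
    fix f assume f: "f \<in> extensional (topspace Y)" "continuous_map Y (cstar_topology B) f"
    show "f \<in> topspace Y \<rightarrow>\<^sub>E carrier B"
      using f B.continuous_map_in_carrier[OF f(2)] by (auto simp: PiE_iff)
  qed (auto simp flip: carrier_cont_algebra simp: bounded_cont_algebra[OF B Y] intro!: restrict_in_cont_algebra
      B.continuous_map_add_cstar B.continuous_map_mult_cstar B.continuous_map_adj_cstar B.continuous_map_smult_cstar)
qed

lemma bounded_norm_cont_algebra:
  assumes B: "pre_cstar_algebra B" and Y: "compact_space Y" and f: "f \<in> carrier (cont_algebra Y B)"
    and y: "y \<in> topspace Y"
  shows "cnorm B (f y) \<le> cnorm (cont_algebra Y B) f"
  using bounded_cont_algebra[OF B Y, of f] f y cnorm_le_cnorm_pointwise(2)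
  unfolding cont_algebra_def by (metis (no_types, lifting) mem_Collect_eq pointwise_algebra_simps(1))


section \<open>Vanishing variation\<close>

text \<open>The form in which vanishing variation is used: no suprema in the extended reals, and the
  exceptional set may be any bounded set.\<close>

lemma vanishing_variation_iff:
  "vanishing_variation d f \<longleftrightarrow> (\<forall>R>0. \<forall>\<epsilon>>0. \<exists>K. bounded K \<and> 
     (\<forall>x y. x \<notin> K \<longrightarrow> dist x y \<le> R \<longrightarrow> d (f x) (f y) < \<epsilon>))" (is "_ \<longleftrightarrow> ?rhs")
proof
  assume vv: "vanishing_variation d f"
  show ?rhs
  proof (intro allI impI)
    fix R \<epsilon> :: real assume "R > 0" "\<epsilon> > 0"
    show "\<exists>K. bounded K \<and> (\<forall>x y. x \<notin> K \<longrightarrow> dist x y \<le> R \<longrightarrow> d (f x) (f y) < \<epsilon>)"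
    proof (intro exI[of _ "{x. ennreal \<epsilon> \<le> variation d R f x}"] conjI allI impI)
      from \<open>R > 0\<close> \<open>\<epsilon> > 0\<close> show "bounded {x. ennreal \<epsilon> \<le> variation d R f x}"
      using vv by (simp add: vanishing_variation_def)
    fix x y assume "x \<notin> {x. ennreal \<epsilon> \<le> variation d R f x}" and "dist x y \<le> R"
    moreover have "ennreal (d (f x) (f y)) \<le> variation d R f x"
      unfolding variation_def by (rule SUP_upper) (use \<open>dist x y \<le> R\<close> in simp)
    ultimately have "ennreal (d (f x) (f y)) < ennreal \<epsilon>"
      by (simp add: not_le)
    then show "d (f x) (f y) < \<epsilon>"
      using ennreal_leI[of \<epsilon> "d (f x) (f y)"] by (auto intro: ccontr simp: not_less)
    qed
  qed
next
  assume R: ?rhs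
  show "vanishing_variation d f"
    unfolding vanishing_variation_def
  proof (intro allI impI)
    fix R \<epsilon> :: real assume "R > 0" "\<epsilon> > 0"
    then obtain K where K: "bounded K" "\<And>x y. x \<notin> K \<Longrightarrow> dist x y \<le> R \<Longrightarrow> d (f x) (f y) < \<epsilon> / 2"
      using R[rule_format, OF \<open>R > 0\<close> half_gt_zero[OF \<open>\<epsilon> > 0\<close>]] by blast
    have "x \<in> K" if "ennreal \<epsilon> \<le> variation d R f x" for x
    proof (rule ccontr)
      assume "x \<notin> K"
      then have "variation d R f x \<le> ennreal (\<epsilon> / 2)"
        unfolding variation_def using K(2) by (intro SUP_least ennreal_leI) (auto intro: less_imp_le)
      then have "ennreal \<epsilon> \<le> ennreal (\<epsilon> / 2)" using that by (rule order.trans[rotated])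
      then show False using \<open>\<epsilon> > 0\<close> by (simp add: ennreal_le_iff)
    qed
    then show "bounded {x. ennreal \<epsilon> \<le> variation d R f x}"
      by (intro bounded_subset[OF K(1)]) auto
  qed
qed

lemma vanishing_variationD:
  assumes "vanishing_variation d f" "R > 0" "\<epsilon> > 0"
  shows "\<exists>K. bounded K \<and> (\<forall>x y. x \<notin> K \<longrightarrow> dist x y \<le> R \<longrightarrow> d (f x) (f y) < \<epsilon>)"
  using assms(1)[unfolded vanishing_variation_iff, rule_format, OF assms(2,3)] .

text \<open>Closure of the functions of vanishing variation under an operation follows from a Lipschitz
  estimate for that operation, here for two arguments \<open>f\<close> and \<open>g\<close>.\<close>

lemma vanishing_variation_by_domination:
  assumes f: "vanishing_variation d f" and g: "vanishing_variation d' g"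
    and nonneg: "\<And>x y. 0 \<le> d (f x) (f y)" "\<And>x y. 0 \<le> d' (g x) (g y)"
    and h: "\<And>x y. e (h x) (h y) \<le> C * (d (f x) (f y) + d' (g x) (g y))"
  shows "vanishing_variation e h"
  unfolding vanishing_variation_iff
proof (intro allI impI)
  fix R \<epsilon> :: real assume "R > 0" "\<epsilon> > 0"
  define C' where "C' = \<bar>C\<bar> + 1"
  have C': "C' > 0" "C \<le> C'" by (auto simp: C'_def)
  define \<delta> where "\<delta> = \<epsilon> / (2 * C')"
  have "\<delta> > 0" using \<open>\<epsilon> > 0\<close> C' by (simp add: \<delta>_def)
  obtain K where K: "bounded K" "\<And>x y. x \<notin> K \<Longrightarrow> dist x y \<le> R \<Longrightarrow> d (f x) (f y) < \<delta>"
    using vanishing_variationD[OF f \<open>R > 0\<close> \<open>\<delta> > 0\<close>] by blast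
  obtain L where L: "bounded L" "\<And>x y. x \<notin> L \<Longrightarrow> dist x y \<le> R \<Longrightarrow> d' (g x) (g y) < \<delta>"
    using vanishing_variationD[OF g \<open>R > 0\<close> \<open>\<delta> > 0\<close>] by blast
  show "\<exists>K. bounded K \<and> (\<forall>x y. x \<notin> K \<longrightarrow> dist x y \<le> R \<longrightarrow> e (h x) (h y) < \<epsilon>)"
  proof (intro exI[of _ "K \<union> L"] conjI allI impI)
    fix x y assume x: "x \<notin> K \<union> L" "dist x y \<le> R"
    show "e (h x) (h y) < \<epsilon>"
    proof -
      have "e (h x) (h y) \<le> C' * (d (f x) (f y) + d' (g x) (g y))"
        using h[of x y] mult_right_mono[OF C'(2), of "d (f x) (f y) + d' (g x) (g y)"] nonneg[of x y] by linarith
      also have "\<dots> < C' * (2 * \<delta>)"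
        using x K(2)[of x y] L(2)[of x y] C'(1) by (intro mult_strict_left_mono) auto
      finally show ?thesis using C' by (simp add: \<delta>_def)
    qed
  qed (use K L in auto)
qed

lemma carrier_vv_algebra:
  "f \<in> carrier (vv_algebra B) \<longleftrightarrow> continuous_map euclidean (cstar_topology B) f \<and>
     (\<exists>C. \<forall>x. cnorm B (f x) \<le> C) \<and> vanishing_variation (cstar_dist B) f"
  by (simp add: vv_algebra_def)

lemma vv_algebra_simps [simp]:
  "f \<otimes>\<^bsub>vv_algebra B\<^esub> g = (\<lambda>y. f y \<otimes>\<^bsub>B\<^esub> g y)"
  "f \<oplus>\<^bsub>vv_algebra B\<^esub> g = (\<lambda>y. f y \<oplus>\<^bsub>B\<^esub> g y)"
  "\<zero>\<^bsub>vv_algebra B\<^esub> = (\<lambda>y. \<zero>\<^bsub>B\<^esub>)"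
  "c \<odot>\<^bsub>vv_algebra B\<^esub> f = (\<lambda>y. c \<odot>\<^bsub>B\<^esub> f y)"
  "adj (vv_algebra B) f = (\<lambda>y. adj B (f y))"
  by (simp_all add: vv_algebra_def restrict_def)

context pre_cstar_algebra
begin

lemma in_carrier_if_continuous: 
  "continuous_map euclidean (cstar_topology A) f \<Longrightarrow> f x \<in> carrier A"
  using continuous_map_in_carrier[of euclidean f x] by simp

lemma zero_in_vv: "(\<lambda>_. \<zero>) \<in> carrier (vv_algebra A)"
  by (auto simp: carrier_vv_algebra vanishing_variation_iff cstar_dist_def intro: exI[of _ 0])

lemma add_in_vv:
  fixes f g :: "'x::metric_space \<Rightarrow> 'a"
  assumes f: "f \<in> carrier (vv_algebra A)" and g: "g \<in> carrier (vv_algebra A)"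
  shows "(\<lambda>x. f x \<oplus> g x) \<in> carrier (vv_algebra A)"
proof -
  obtain C D where CD: "\<And>x. cnorm A (f x) \<le> C" "\<And>x. cnorm A (g x) \<le> D"
    using f g by (auto simp: carrier_vv_algebra)
  have [simp]: "f x \<in> carrier A" "g x \<in> carrier A" for x
    using f g in_carrier_if_continuous by (auto simp: carrier_vv_algebra)
  have "cnorm A (f x \<oplus> g x) \<le> C + D" for x
    using cnorm_add[of "f x" "g x"] CD[of x] by simp
  moreover have "vanishing_variation (cstar_dist A) (\<lambda>x. f x \<oplus> g x)"
    by (rule vanishing_variation_by_domination[of "cstar_dist A" f "cstar_dist A" g _ _ 1])
      (use f g in \<open>auto simp: carrier_vv_algebra cstar_dist_def add_minus_add cnorm_add\<close>)
  ultimately show ?thesis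
    using f g by (auto simp: carrier_vv_algebra intro: continuous_map_add_cstar)
qed

lemma mult_in_vv:
  fixes f g :: "'x::metric_space \<Rightarrow> 'a"
  assumes f: "f \<in> carrier (vv_algebra A)" and g: "g \<in> carrier (vv_algebra A)"
  shows "(\<lambda>x. f x \<otimes> g x) \<in> carrier (vv_algebra A)"
proof -
  obtain C D where CD: "\<And>x. cnorm A (f x) \<le> C" "\<And>x. cnorm A (g x) \<le> D"
    using f g by (auto simp: carrier_vv_algebra)
  have [simp]: "f x \<in> carrier A" "g x \<in> carrier A" for x
    using f g in_carrier_if_continuous by (auto simp: carrier_vv_algebra)
  have nn: "C \<ge> 0" "D \<ge> 0"
    by (rule order.trans[OF cnorm_nonneg CD(1)], simp) (rule order.trans[OF cnorm_nonneg CD(2)], simp)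
  have "cnorm A (f x \<otimes> g x) \<le> C * D" for x
    using CD[of x] nn by (intro order.trans[OF cnorm_mult] mult_mono) auto
  moreover have "vanishing_variation (cstar_dist A) (\<lambda>x. f x \<otimes> g x)"
  proof (rule vanishing_variation_by_domination[of "cstar_dist A" f "cstar_dist A" g _ _ "C + D"])
    fix x y
    have "cnorm A (f x \<otimes> g x \<ominus> f y \<otimes> g y) \<le> cnorm A (f x \<ominus> f y) * cnorm A (g x) + cnorm A (f y) * cnorm A (g x \<ominus> g y)"
      by (subst mult_minus_mult) (auto intro!: order.trans[OF cnorm_add] add_mono cnorm_mult)
    also have "\<dots> \<le> cnorm A (f x \<ominus> f y) * (C + D) + (C + D) * cnorm A (g x \<ominus> g y)"
      using CD[of x] CD[of y] nn by (intro add_mono mult_left_mono mult_right_mono) auto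
    finally show "cstar_dist A (f x \<otimes> g x) (f y \<otimes> g y) \<le> (C + D) * (cstar_dist A (f x) (f y) + cstar_dist A (g x) (g y))"
      by (simp add: cstar_dist_def algebra_simps)
  qed (use f g in \<open>auto simp: carrier_vv_algebra cstar_dist_def\<close>)
  ultimately show ?thesis
    using f g by (auto simp: carrier_vv_algebra intro: continuous_map_mult_cstar)
qed

lemma smult_in_vv:
  fixes f :: "'x::metric_space \<Rightarrow> 'a"
  assumes f: "f \<in> carrier (vv_algebra A)"
  shows "(\<lambda>x. c \<odot> f x) \<in> carrier (vv_algebra A)"
proof -
  obtain C where C: "\<And>x. cnorm A (f x) \<le> C"
    using f by (auto simp: carrier_vv_algebra)
  have [simp]: "f x \<in> carrier A" for x
    using f in_carrier_if_continuous by (auto simp: carrier_vv_algebra)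
  have "cnorm A (c \<odot> f x) \<le> cmod c * C" for x
    using C[of x] by (simp add: cnorm_smult mult_left_mono)
  moreover have "vanishing_variation (cstar_dist A) (\<lambda>x. c \<odot> f x)"
    by (rule vanishing_variation_by_domination[of "cstar_dist A" f "cstar_dist A" f _ _ "cmod c"])
      (use f in \<open>auto simp: carrier_vv_algebra cstar_dist_def smult_minus cnorm_smult mult_left_mono\<close>)
  ultimately show ?thesis
    using f by (auto simp: carrier_vv_algebra intro: continuous_map_smult_cstar)
qed

lemma adj_in_vv:
  fixes f :: "'x::metric_space \<Rightarrow> 'a"
  assumes f: "f \<in> carrier (vv_algebra A)"
  shows "(\<lambda>x. adj A (f x)) \<in> carrier (vv_algebra A)"
proof -
  have [simp]: "f x \<in> carrier A" for x
    using f in_carrier_if_continuous by (auto simp: carrier_vv_algebra)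
  have "vanishing_variation (cstar_dist A) (\<lambda>x. adj A (f x))"
    by (rule vanishing_variation_by_domination[of "cstar_dist A" f "cstar_dist A" f _ _ 1])
      (use f in \<open>auto simp: carrier_vv_algebra cstar_dist_def adj_minus\<close>)
  then show ?thesis
    using f by (auto simp: carrier_vv_algebra intro: continuous_map_adj_cstar)
qed

lemma pre_cstar_algebra_vv: "pre_cstar_algebra (vv_algebra A :: ('x::metric_space \<Rightarrow> 'a) cstar_alg)"
proof -
  let ?F = "{f :: 'x \<Rightarrow> 'a. continuous_map euclidean (cstar_topology A) f \<and>
     (\<exists>C. \<forall>x. cnorm A (f x) \<le> C) \<and> vanishing_variation (cstar_dist A) f}"
  have F: "?F = carrier (vv_algebra A)"
    by (simp add: vv_algebra_def)
  show ?thesis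
    unfolding vv_algebra_def
  proof (rule pre_cstar_algebra_pointwise[OF pre_cstar_algebra_axioms]; unfold F)
    fix f :: "'x \<Rightarrow> 'a" assume "f \<in> carrier (vv_algebra A)"
    then show "f \<in> UNIV \<rightarrow>\<^sub>E carrier A" "\<exists>C. \<forall>y\<in>UNIV. cnorm A (f y) \<le> C"
      using in_carrier_if_continuous by (auto simp: carrier_vv_algebra)
  qed (auto intro!: zero_in_vv add_in_vv mult_in_vv smult_in_vv adj_in_vv simp: restrict_def)
qed

end

text \<open>Where the norm is at least \<open>1\<close>, it is bounded by compactness.\<close>

lemma bounded_C0:
  fixes f :: "'x::metric_space \<Rightarrow> 'b"
  assumes coarse: "\<And>S :: 'x set. bounded S \<Longrightarrow> compact (closure S)"
    and B: "pre_cstar_algebra B" and f: "f \<in> C0_functions B"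
  obtains C where "\<And>x. cnorm B (f x) \<le> C"
proof -
  let ?S = "closure {x. 1 \<le> cnorm B (f x)}"
  have f': "continuous_map euclidean (cstar_topology B) f" "bounded {x. 1 \<le> cnorm B (f x)}"
    using f by (auto simp: C0_functions_def)
  have "continuous_on UNIV (\<lambda>x. cnorm B (f x))"
    using pre_cstar_algebra.continuous_map_cnorm[OF B f'(1)] by simp
  then have "compact ((\<lambda>x. cnorm B (f x)) ` ?S)"
    by (intro compact_continuous_image coarse f'(2)) (auto intro: continuous_on_subset)
  then obtain C where C: "\<forall>x\<in>?S. \<bar>cnorm B (f x)\<bar> \<le> C"
    by (auto dest!: compact_imp_bounded simp: bounded_iff)
  show thesis
  proof
    fix x show "cnorm B (f x) \<le> max 1 C"
    proof (cases "1 \<le> cnorm B (f x)")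
      case True
      then have "x \<in> ?S" using closure_subset[of "{x. 1 \<le> cnorm B (f x)}"] by auto
      then show ?thesis using C by fastforce
    qed simp
  qed
qed

text \<open>The \<open>R\<close>-neighbourhood of the bounded set where \<open>f\<close> is large is bounded, and away from it two
  points at distance at most \<open>R\<close> both have small values.\<close>

lemma C0_subset_vv:
  fixes f :: "'x::metric_space \<Rightarrow> 'b"
  assumes coarse: "\<And>S :: 'x set. bounded S \<Longrightarrow> compact (closure S)"
    and B: "pre_cstar_algebra B" and f: "f \<in> C0_functions B"
  shows "f \<in> carrier (vv_algebra B)"
proof -
  interpret B: pre_cstar_algebra B by fact
  have cont: "continuous_map euclidean (cstar_topology B) f"
    using f by (auto simp: C0_functions_def)
  obtain C where C: "\<And>x. cnorm B (f x) \<le> C"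
    using bounded_C0[OF coarse B f] by blast
  have "vanishing_variation (cstar_dist B) f"
    unfolding vanishing_variation_iff
  proof (intro allI impI)
    fix R \<epsilon> :: real assume "R > 0" "\<epsilon> > 0"
    define S where "S = {x. \<epsilon> / 2 \<le> cnorm B (f x)}"
    have "bounded S" using f half_gt_zero[OF \<open>\<epsilon> > 0\<close>] unfolding C0_functions_def S_def by blast
    define K where "K = (\<Union>x\<in>S. cball x R)"
    show "\<exists>K. bounded K \<and> (\<forall>x y. x \<notin> K \<longrightarrow> dist x y \<le> R \<longrightarrow> cstar_dist B (f x) (f y) < \<epsilon>)"
    proof (intro exI conjI allI impI)
      obtain a e where a: "\<And>x. x \<in> S \<Longrightarrow> dist a x \<le> e"
        using \<open>bounded S\<close> by (auto simp: bounded_def)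
      have "dist a y \<le> e + R" if y: "y \<in> K" for y
      proof -
        obtain x where "x \<in> S" "dist x y \<le> R" using y by (auto simp: K_def)
        then show ?thesis using a[of x] dist_triangle[of a y x] by simp
      qed
      then show "bounded K" by (auto simp: bounded_def)
      fix x y assume xy: "x \<notin> K" "dist x y \<le> R"
      have c: "f x \<in> carrier B" "f y \<in> carrier B" using B.in_carrier_if_continuous[OF cont] by auto
      have "x \<notin> S" using xy \<open>R > 0\<close> by (auto simp: K_def)
      moreover have "y \<notin> S" using xy by (auto simp: K_def dist_commute)
      ultimately show "cstar_dist B (f x) (f y) < \<epsilon>"
        using c B.cnorm_minus_le[of "f x" "f y"] by (simp add: cstar_dist_def S_def)
    qed
  qed
  then show ?thesis
    using C cont by (auto simp: carrier_vv_algebra)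
qed

lemma C0_by_domination:
  assumes h: "continuous_map euclidean (cstar_topology B) h" 
    and f: "f \<in> C0_functions B" and g: "g \<in> C0_functions B" and "C > 0"
    and dom: "\<And>x. cnorm B (h x) \<le> C * (cnorm B (f x) + cnorm B (g x))"
  shows "h \<in> C0_functions B"
  unfolding C0_functions_def
proof (intro CollectI conjI h allI impI)
  fix \<epsilon> :: real assume "\<epsilon> > 0"
  then have "bounded ({x. \<epsilon> / (2 * C) \<le> cnorm B (f x)} \<union> {x. \<epsilon> / (2 * C) \<le> cnorm B (g x)})"
    using f g \<open>C > 0\<close> by (auto simp: C0_functions_def)
  moreover have "\<epsilon> / (2 * C) \<le> cnorm B (f x) \<or> \<epsilon> / (2 * C) \<le> cnorm B (g x)" if "\<epsilon> \<le> cnorm B (h x)" for x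
  proof (rule ccontr)
    assume "\<not> ?thesis"
    then have "C * (cnorm B (f x) + cnorm B (g x)) < C * (2 * (\<epsilon> / (2 * C)))"
      using \<open>C > 0\<close> by (intro mult_strict_left_mono) auto
    then show False using dom[of x] that \<open>C > 0\<close> by simp
  qed
  ultimately show "bounded {x. \<epsilon> \<le> cnorm B (h x)}"
    by (elim bounded_subset) auto
qed


section \<open>The Higson compactification\<close>

lemma complex_cstar_simps [simp]:
  "carrier complex_cstar = UNIV" "x \<otimes>\<^bsub>complex_cstar\<^esub> y = x * y" "\<one>\<^bsub>complex_cstar\<^esub> = 1"
  "\<zero>\<^bsub>complex_cstar\<^esub> = 0" "x \<oplus>\<^bsub>complex_cstar\<^esub> y = x + y" "c \<odot>\<^bsub>complex_cstar\<^esub> x = c * x"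
  "adj complex_cstar x = cnj x" "cnorm complex_cstar x = cmod x"
  by (simp_all add: complex_cstar_def)

lemma pre_cstar_algebra_complex: "pre_cstar_algebra complex_cstar"
proof -
  have "abelian_group complex_cstar"
    by (rule abelian_groupI) (auto simp: algebra_simps intro: exI[of _ "- x" for x :: complex])
  then have "Module.module complex_ring complex_cstar"
    by (intro moduleI cring_complex_ring) (auto simp: algebra_simps)
  moreover have "pre_cstar_algebra_axioms complex_cstar"
    by unfold_locales (auto simp: algebra_simps norm_mult norm_triangle_ineq power2_eq_square)
  ultimately show ?thesis
    by (rule pre_cstar_algebra.intro)
qed

interpretation complex: pre_cstar_algebra complex_cstar
  by (rule pre_cstar_algebra_complex)

lemma minus_complex_cstar [simp]: "x \<ominus>\<^bsub>complex_cstar\<^esub> y = x - y"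
  by (simp add: complex.minus_eq_smult)

lemma cstar_dist_complex [simp]: "cstar_dist complex_cstar = dist"
  by (intro ext) (simp add: cstar_dist_def dist_norm)

lemma cstar_topology_complex [simp]: "cstar_topology complex_cstar = euclidean"
  by (simp add: cstar_topology_def)

lemma carrier_higson_algebra:
  "f \<in> carrier higson_algebra \<longleftrightarrow>
     continuous_on UNIV f \<and> (\<exists>C. \<forall>x. cmod (f x) \<le> C) \<and> vanishing_variation dist f"
  by (simp add: higson_algebra_def carrier_vv_algebra)

lemma higson_algebra_simps [simp]:
  "f \<otimes>\<^bsub>higson_algebra\<^esub> g = (\<lambda>x. f x * g x)" "f \<oplus>\<^bsub>higson_algebra\<^esub> g = (\<lambda>x. f x + g x)"
  "c \<odot>\<^bsub>higson_algebra\<^esub> f = (\<lambda>x. c * f x)"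
  by (simp_all add: higson_algebra_def)

lemma const_in_higson_algebra: "(\<lambda>_. c) \<in> carrier higson_algebra"
  by (auto simp: carrier_higson_algebra vanishing_variation_iff)

lemma add_in_higson_algebra:
  "f \<in> carrier higson_algebra \<Longrightarrow> g \<in> carrier higson_algebra \<Longrightarrow> (\<lambda>x. f x + g x) \<in> carrier higson_algebra"
  using complex.add_in_vv[of f g] by (simp add: higson_algebra_def)

lemma mult_in_higson_algebra:
  "f \<in> carrier higson_algebra \<Longrightarrow> g \<in> carrier higson_algebra \<Longrightarrow> (\<lambda>x. f x * g x) \<in> carrier higson_algebra"
  using complex.mult_in_vv[of f g] by (simp add: higson_algebra_def)

lemma cnj_in_higson_algebra:
  "f \<in> carrier higson_algebra \<Longrightarrow> (\<lambda>x. cnj (f x)) \<in> carrier higson_algebra"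
  using complex.adj_in_vv[of f] by (simp add: higson_algebra_def)

lemma inverse_in_higson_algebra:
  assumes f: "f \<in> carrier higson_algebra" and "\<delta> > 0" and \<delta>: "\<And>x. \<delta> \<le> cmod (f x)"
  shows "(\<lambda>x. 1 / f x) \<in> carrier higson_algebra"
proof -
  have nz: "f x \<noteq> 0" for x
    using \<delta>[of x] \<open>\<delta> > 0\<close> by auto
  have "continuous_on UNIV (\<lambda>x. 1 / f x)"
    using f nz by (auto simp: carrier_higson_algebra intro!: continuous_intros)
  moreover have "cmod (1 / f x) \<le> 1 / \<delta>" for x
    using \<delta>[of x] \<open>\<delta> > 0\<close> nz[of x] by (simp add: norm_divide frac_le)
  moreover have "vanishing_variation dist (\<lambda>x. 1 / f x)"
  proof (rule vanishing_variation_by_domination[of dist f dist f _ _ "1 / \<delta>\<^sup>2"])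
    fix x y
    have "\<delta>\<^sup>2 \<le> cmod (f x) * cmod (f y)"
      using \<delta>[of x] \<delta>[of y] \<open>\<delta> > 0\<close> by (simp add: power2_eq_square mult_mono)
    moreover have "1 / f x - 1 / f y = (f y - f x) / (f x * f y)"
      using nz[of x] nz[of y] by (simp add: field_simps)
    ultimately have "dist (1 / f x) (1 / f y) \<le> dist (f x) (f y) / \<delta>\<^sup>2"
      using \<open>\<delta> > 0\<close> nz[of x] nz[of y]
      by (simp add: dist_norm norm_divide norm_mult norm_minus_commute frac_le)
    also have "\<dots> \<le> (dist (f x) (f y) + dist (f x) (f y)) / \<delta>\<^sup>2"
      using \<open>\<delta> > 0\<close> by (intro divide_right_mono) auto
    finally show "dist (1 / f x) (1 / f y) \<le> 1 / \<delta>\<^sup>2 * (dist (f x) (f y) + dist (f x) (f y))"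
      by simp
  qed (use f in \<open>auto simp: carrier_higson_algebra\<close>)
  ultimately show ?thesis
    unfolding carrier_higson_algebra by blast
qed

lemma topspace_higson_compactification:
  "topspace higson_compactification = characters higson_algebra"
  by (auto simp: higson_compactification_def maximal_ideal_space_def characters_def PiE_iff extensional_def)

lemma
  assumes "\<omega> \<in> topspace higson_compactification"
    and "f \<in> carrier higson_algebra" and "g \<in> carrier higson_algebra"
  shows character_add: "\<omega> (\<lambda>x. f x + g x) = \<omega> f + \<omega> g"
    and character_mult: "\<omega> (\<lambda>x. f x * g x) = \<omega> f * \<omega> g"
  using assms by (auto simp: topspace_higson_compactification characters_def)

lemma character_const:
  assumes \<omega>: "\<omega> \<in> topspace higson_compactification"
  shows "\<omega> (\<lambda>_. c) = c"
proof -
  obtain f where f: "f \<in> carrier higson_algebra" "\<omega> f \<noteq> 0"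
    using \<omega> by (auto simp: topspace_higson_compactification characters_def)
  have "\<omega> (\<lambda>x. c * f x) = c * \<omega> f"
    using \<omega> f by (auto simp: topspace_higson_compactification characters_def)
  then show ?thesis
    using character_mult[OF \<omega> const_in_higson_algebra f(1), of c] f(2) by simp
qed

text \<open>The function \<open>\<Sum> (f - \<omega> f) (f - \<omega> f)*\<close> lies in the ideal on which \<open>\<omega>\<close> vanishes, as each first factor
  does.\<close>

lemma character_square_sum:
  assumes \<omega>: "\<omega> \<in> topspace higson_compactification" and "finite F" "F \<subseteq> carrier higson_algebra"
  shows "\<exists>h\<in>carrier higson_algebra. \<omega> h = 0 \<and>
    (\<forall>x. h x = complex_of_real (\<Sum>f\<in>F. (cmod (f x - \<omega> f))\<^sup>2))"
  using assms(2,3)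
proof (induction F rule: finite_induct)
  case empty
  show ?case
    by (rule bexI[of _ "\<lambda>_. 0"]) (auto simp: const_in_higson_algebra character_const[OF \<omega>])
next
  case (insert f F)
  then obtain h where h: "h \<in> carrier higson_algebra" "\<omega> h = 0"
      "\<And>x. h x = complex_of_real (\<Sum>f\<in>F. (cmod (f x - \<omega> f))\<^sup>2)"
    by auto
  define g where "g = (\<lambda>x. f x + - \<omega> f)"
  have f: "f \<in> carrier higson_algebra" using insert by simp
  have g: "g \<in> carrier higson_algebra"
    unfolding g_def by (intro add_in_higson_algebra f const_in_higson_algebra)
  have "\<omega> g = 0"
    unfolding g_def
    by (subst character_add[OF \<omega> f const_in_higson_algebra]) (simp add: character_const[OF \<omega>])
  have k: "(\<lambda>x. g x * cnj (g x)) \<in> carrier higson_algebra" 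
    by (intro mult_in_higson_algebra cnj_in_higson_algebra g)
  show ?case
  proof (intro bexI[of _ "\<lambda>x. g x * cnj (g x) + h x"] conjI allI)
    show "\<omega> (\<lambda>x. g x * cnj (g x) + h x) = 0"
      using character_add[OF \<omega> k h(1)] character_mult[OF \<omega> g cnj_in_higson_algebra[OF g]]
        h(2) \<open>\<omega> g = 0\<close> by simp
    show "g x * cnj (g x) + h x = complex_of_real (\<Sum>f\<in>insert f F. (cmod (f x - \<omega> f))\<^sup>2)" for x
      using insert.hyps complex_norm_square[of "f x - \<omega> f"] by (simp add: h(3) g_def)
  qed (intro add_in_higson_algebra k h)
qed

text \<open>If no point did it, the sum of squares would be bounded below by \<open>\<epsilon>\<^sup>2\<close>, and its inverse would again
  have vanishing variation, so that \<open>\<omega> 1 = 0\<close>.\<close>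

lemma character_approx:
  assumes \<omega>: "\<omega> \<in> topspace higson_compactification" 
    and F: "finite F" "F \<subseteq> carrier higson_algebra" and "\<epsilon> > 0"
  shows "\<exists>x. \<forall>f\<in>F. cmod (f x - \<omega> f) < \<epsilon>"
proof (rule ccontr)
  assume "\<not> ?thesis"
  then have far: "\<exists>f\<in>F. \<epsilon> \<le> cmod (f x - \<omega> f)" for x
    by (meson not_less)
  obtain h where h: "h \<in> carrier higson_algebra" "\<omega> h = 0"
      "\<And>x. h x = complex_of_real (\<Sum>f\<in>F. (cmod (f x - \<omega> f))\<^sup>2)"
    using character_square_sum[OF \<omega> F] by blast
  have big: "\<epsilon>\<^sup>2 \<le> cmod (h x)" for x
  proof -
    obtain f where f: "f \<in> F" "\<epsilon> \<le> cmod (f x - \<omega> f)"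
      using far by blast
    have "\<epsilon>\<^sup>2 \<le> (cmod (f x - \<omega> f))\<^sup>2"
      using f \<open>\<epsilon> > 0\<close> by (intro power_mono) auto
    also have "\<dots> \<le> (\<Sum>f\<in>F. (cmod (f x - \<omega> f))\<^sup>2)"
      by (rule member_le_sum[OF f(1) _ F(1)]) auto
    finally show ?thesis
      unfolding h(3) norm_of_real by linarith
  qed
  then have inv: "(\<lambda>x. 1 / h x) \<in> carrier higson_algebra"
    using inverse_in_higson_algebra[OF h(1), of "\<epsilon>\<^sup>2"] \<open>\<epsilon> > 0\<close> by simp
  have "h x \<noteq> 0" for x
    using big[of x] \<open>\<epsilon> > 0\<close> by auto
  then have "(\<lambda>x. h x * (1 / h x)) = (\<lambda>_. 1)"
    by simp
  then show False
    using character_mult[OF \<omega> h(1) inv] h(2) character_const[OF \<omega>, of 1] by simp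
qed

lemma higson_neighbourhood:
  assumes W: "openin higson_compactification W" and \<omega>: "\<omega> \<in> W"
  obtains F \<epsilon> where "finite F" "F \<subseteq> carrier higson_algebra" "\<epsilon> > 0"
    "\<And>\<omega>'. \<omega>' \<in> topspace higson_compactification \<Longrightarrow> (\<forall>f\<in>F. cmod (\<omega>' f - \<omega> f) < \<epsilon>) \<Longrightarrow> \<omega>' \<in> W"
proof -
  let ?H = "carrier (higson_algebra :: ('a \<Rightarrow> complex) cstar_alg)"
  obtain T where T: "openin (product_topology (\<lambda>_. euclidean) ?H) T" "W = T \<inter> characters higson_algebra"
    using W by (auto simp: higson_compactification_def maximal_ideal_space_def openin_subtopology)
  then obtain U where U: "finite {f \<in> ?H. U f \<noteq> UNIV}" "\<And>f. f \<in> ?H \<Longrightarrow> open (U f)"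
      "\<omega> \<in> Pi\<^sub>E ?H U" "Pi\<^sub>E ?H U \<subseteq> T"
    using \<omega> unfolding openin_product_topology_alt by auto
  define F where "F = {f \<in> ?H. U f \<noteq> UNIV}"
  have "\<exists>e>0. ball (\<omega> f) e \<subseteq> U f" if "f \<in> ?H" for f
    using U(2)[OF that] U(3) that by (auto simp: open_contains_ball PiE_iff)
  then obtain e where e: "\<And>f. f \<in> ?H \<Longrightarrow> e f > 0" "\<And>f. f \<in> ?H \<Longrightarrow> ball (\<omega> f) (e f) \<subseteq> U f"
    by metis
  define \<epsilon> where "\<epsilon> = Min (insert 1 (e ` F))"
  have "finite F" "F \<subseteq> ?H" using U(1) by (auto simp: F_def)
  show thesis
  proof
    show "finite F" "F \<subseteq> ?H" by fact+
    show "\<epsilon> > 0"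
      using \<open>finite F\<close> \<open>F \<subseteq> ?H\<close> e(1) by (auto simp: \<epsilon>_def)
    fix \<omega>' assume \<omega>': "\<omega>' \<in> topspace higson_compactification" "\<forall>f\<in>F. cmod (\<omega>' f - \<omega> f) < \<epsilon>"
    have "\<omega>' f \<in> U f" if "f \<in> ?H" for f
    proof (cases "f \<in> F")
      case True
      then have "\<epsilon> \<le> e f" using \<open>finite F\<close> by (auto simp: \<epsilon>_def)
      moreover have "cmod (\<omega>' f - \<omega> f) < \<epsilon>" using \<omega>' True by blast
      ultimately have "\<omega>' f \<in> ball (\<omega> f) (e f)" by (simp add: dist_norm norm_minus_commute)
      then show ?thesis using e(2)[OF that] by blast
    qed (use that in \<open>auto simp: F_def\<close>)
    then have "\<omega>' \<in> Pi\<^sub>E ?H U"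
      using \<omega>'(1) by (auto simp: topspace_higson_compactification characters_def PiE_iff)
    then show "\<omega>' \<in> W"
      using U(4) T(2) \<omega>'(1) by (auto simp: topspace_higson_compactification)
  qed
qed

lemma continuous_map_evaluation:
  "f \<in> carrier higson_algebra \<Longrightarrow> continuous_map higson_compactification euclidean (\<lambda>\<omega>. \<omega> f)"
  unfolding higson_compactification_def maximal_ideal_space_def
  by (intro continuous_map_from_subtopology continuous_map_product_projection)

lemma Hausdorff_higson_compactification: "Hausdorff_space higson_compactification"
  unfolding higson_compactification_def maximal_ideal_space_def
  by (intro Hausdorff_space_subtopology) (simp add: Hausdorff_space_product_topology)

text \<open>The characters form a closed subset of the product of the discs whose radii are bounds of the
  functions: the value \<open>\<omega> f\<close> is a limit of values of \<open>f\<close>.\<close>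

lemma compact_higson_compactification: 
  "compact_space (higson_compactification :: (('x::metric_space \<Rightarrow> complex) \<Rightarrow> complex) topology)"
proof -
  let ?H = "carrier (higson_algebra :: ('x \<Rightarrow> complex) cstar_alg)"
  let ?P = "product_topology (\<lambda>_. euclidean :: complex topology) ?H"
  let ?X = "characters (higson_algebra :: ('x \<Rightarrow> complex) cstar_alg)"
  let ?one = "(\<lambda>_. 1) :: 'x \<Rightarrow> complex"
  have cont: "continuous_map ?P euclidean (\<lambda>\<omega>. \<omega> f)" if "f \<in> ?H" for f
    using that by (rule continuous_map_product_projection)
  have "\<forall>f\<in>?H. \<exists>C. \<forall>x. cmod (f x) \<le> C"
    by (simp add: carrier_higson_algebra)
  then obtain C where C: "\<And>f x. f \<in> ?H \<Longrightarrow> cmod (f x) \<le> C f"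
    by metis
  define A where "A f g = {\<omega> \<in> topspace ?P. \<omega> (\<lambda>x. f x + g x) = \<omega> f + \<omega> g}" for f g
  define M where "M f g = {\<omega> \<in> topspace ?P. \<omega> (\<lambda>x. f x * g x) = \<omega> f * \<omega> g}" for f g
  define L where "L c f = {\<omega> \<in> topspace ?P. \<omega> (\<lambda>x. c * f x) = c * \<omega> f}" for c f
  define O1 where "O1 = {\<omega> \<in> topspace ?P. \<omega> ?one = 1}"
  have one: "?one \<in> ?H" by (rule const_in_higson_algebra)
  have "\<omega> ?one = 1" if "\<omega> \<in> ?X" for \<omega>
    using character_const[of \<omega> 1] that by (simp add: topspace_higson_compactification)
  then have "?X \<subseteq> O1"
    by (auto simp: O1_def characters_def PiE_iff)
  then have X: "?X = O1 \<inter> (\<Inter>f\<in>?H. \<Inter>g\<in>?H. A f g \<inter> M f g) \<inter> (\<Inter>f\<in>?H. \<Inter>c. L c f)"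
  proof (intro equalityI Int_greatest subsetI)
    fix \<omega> assume "\<omega> \<in> O1 \<inter> (\<Inter>f\<in>?H. \<Inter>g\<in>?H. A f g \<inter> M f g) \<inter> (\<Inter>f\<in>?H. \<Inter>c. L c f)"
    moreover from this have "\<exists>f\<in>?H. \<omega> f \<noteq> 0"
      by (intro bexI[OF _ one]) (simp add: O1_def)
    ultimately show "\<omega> \<in> ?X"
      unfolding characters_def by (simp add: A_def M_def L_def O1_def PiE_iff)
  qed (auto simp: A_def M_def L_def characters_def PiE_iff)
  have "closedin ?P O1"
    unfolding O1_def
    by (rule closedin_continuous_maps_eq[of euclidean _ "\<lambda>\<omega>. \<omega> ?one" "\<lambda>_. 1"]) (simp_all add: cont one)
  moreover have "closedin ?P (A f g)" if "f \<in> ?H" "g \<in> ?H" for f g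
  proof -
    have "continuous_map ?P euclidean (\<lambda>\<omega>. \<omega> f + \<omega> g)"
      using that by (intro continuous_map_add cont)
    with that show ?thesis
      unfolding A_def 
      by (intro closedin_continuous_maps_eq[of euclidean _ "\<lambda>\<omega>. \<omega> (\<lambda>x. f x + g x)"] cont add_in_higson_algebra) simp_all
  qed
  moreover have "closedin ?P (M f g)" if "f \<in> ?H" "g \<in> ?H" for f g
  proof -
    have "continuous_map ?P euclidean (\<lambda>\<omega>. \<omega> f * \<omega> g)"
      using continuous_map_compose[OF continuous_map_paired[THEN iffD2, OF conjI[OF cont cont]], of f g euclidean "\<lambda>(a,b). a * b"] that
      by (simp add: o_def case_prod_unfold euclidean_product_topology continuous_intros)
    with that show ?thesis
      unfolding M_def 
      by (intro closedin_continuous_maps_eq[of euclidean _ "\<lambda>\<omega>. \<omega> (\<lambda>x. f x * g x)"] cont mult_in_higson_algebra) simp_all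
  qed
  moreover have "closedin ?P (L c f)" if "f \<in> ?H" for c f
  proof -
    have "continuous_map ?P euclidean (\<lambda>\<omega>. c * \<omega> f)"
      using continuous_map_compose[OF cont, of f euclidean "\<lambda>a. c * a"] that
      by (simp add: o_def continuous_intros)
    with that show ?thesis
      unfolding L_def 
      by (intro closedin_continuous_maps_eq[of euclidean _ "\<lambda>\<omega>. \<omega> (\<lambda>x. c * f x)"] cont
        mult_in_higson_algebra const_in_higson_algebra) simp_all
  qed
  moreover have "?H \<noteq> {}"
    using one by blast
  ultimately have closed: "closedin ?P ?X"
    unfolding X by (intro closedin_Int closedin_INT) auto
  have "?X \<subseteq> (\<Pi>\<^sub>E f\<in>?H. cball 0 (C f))"
  proof
    fix \<omega> assume \<omega>: "\<omega> \<in> ?X"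
    have "cmod (\<omega> f) \<le> C f" if f: "f \<in> ?H" for f
    proof (rule field_le_epsilon)
      fix e :: real assume "e > 0"
      then obtain x where "cmod (f x - \<omega> f) < e"
        using character_approx[of \<omega> "{f}" e] \<omega> f by (auto simp: topspace_higson_compactification)
      then show "cmod (\<omega> f) \<le> C f + e"
        using C[OF f, of x] norm_triangle_sub[of "\<omega> f" "f x"] by (simp add: norm_minus_commute)
    qed
    then show "\<omega> \<in> (\<Pi>\<^sub>E f\<in>?H. cball 0 (C f))"
      using \<omega> by (auto simp: characters_def PiE_iff)
  qed
  moreover have "compactin ?P (\<Pi>\<^sub>E f\<in>?H. cball 0 (C f))"
    by (simp add: compactin_PiE)
  ultimately have "compactin ?P ?X"
    using closed by (auto intro: closed_compactin)
  then show ?thesis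
    unfolding higson_compactification_def maximal_ideal_space_def by (rule compact_space_subtopology)
qed

lemma higson_embedding_apply [simp]: "f \<in> carrier higson_algebra \<Longrightarrow> higson_embedding x f = f x"
  by (simp add: higson_embedding_def)

lemma higson_embedding_in_topspace [simp]: "higson_embedding x \<in> topspace higson_compactification"
proof -
  have "\<exists>f\<in>carrier higson_algebra. f x \<noteq> 0"
    by (rule bexI[OF _ const_in_higson_algebra[of 1]]) simp
  moreover have "(\<lambda>x. c * f x) \<in> carrier higson_algebra" if "f \<in> carrier higson_algebra" for c f
    by (intro mult_in_higson_algebra const_in_higson_algebra that)
  ultimately show ?thesis
    by (auto simp: topspace_higson_compactification characters_def higson_embedding_def
      add_in_higson_algebra mult_in_higson_algebra const_in_higson_algebra)
qed

lemma continuous_map_higson_embedding: "continuous_map euclidean higson_compactification higson_embedding"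
  unfolding higson_compactification_def maximal_ideal_space_def continuous_map_in_subtopology
    continuous_map_componentwise
proof (intro conjI ballI)
  show "higson_embedding ` topspace euclidean \<subseteq> extensional (carrier higson_algebra)"
    by (auto simp: higson_embedding_def)
  fix f :: "'a \<Rightarrow> complex" assume "f \<in> carrier higson_algebra"
  then show "continuous_map euclidean euclidean (\<lambda>x. higson_embedding x f)"
    by (simp add: carrier_higson_algebra higson_embedding_def)
qed (use higson_embedding_in_topspace in \<open>auto simp: topspace_higson_compactification\<close>)

lemma dense_higson_embedding: 
  "higson_compactification closure_of (range (higson_embedding :: 'x::metric_space \<Rightarrow> _)) = topspace higson_compactification"
proof
  show "topspace higson_compactification \<subseteq> higson_compactification closure_of (range (higson_embedding :: 'x \<Rightarrow> _))"
  proof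
    fix \<omega> :: "('x \<Rightarrow> complex) \<Rightarrow> complex" assume \<omega>: "\<omega> \<in> topspace higson_compactification"
    have "\<exists>y. y \<in> range (higson_embedding :: 'x \<Rightarrow> _) \<and> y \<in> W" if W: "\<omega> \<in> W" "openin higson_compactification W" for W
    proof -
      obtain F \<epsilon> where F: "finite F" "F \<subseteq> carrier higson_algebra" "\<epsilon> > 0"
        "\<And>\<omega>'. \<omega>' \<in> topspace higson_compactification \<Longrightarrow> (\<forall>f\<in>F. cmod (\<omega>' f - \<omega> f) < \<epsilon>) \<Longrightarrow> \<omega>' \<in> W"
        using higson_neighbourhood[OF W(2,1)] by metis
      obtain x where x: "\<forall>f\<in>F. cmod (f x - \<omega> f) < \<epsilon>"
        using character_approx[OF \<omega> F(1-3)] by blast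
      have "higson_embedding x \<in> W"
        using x F(2) by (intro F(4)) auto
      then show ?thesis by blast
    qed
    then show "\<omega> \<in> higson_compactification closure_of (range (higson_embedding :: 'x \<Rightarrow> _))"
      using \<omega> by (auto simp: in_closure_of)
  qed
qed (rule closure_of_subset_topspace)

lemma dense_higson_embeddingE:
  assumes "openin higson_compactification W" "\<omega> \<in> W"
  obtains x where "higson_embedding x \<in> W"
proof -
  have "\<omega> \<in> higson_compactification closure_of (range higson_embedding)"
    using openin_subset[OF assms(1)] assms(2) by (auto simp: dense_higson_embedding)
  then have "\<exists>y. y \<in> range higson_embedding \<and> y \<in> W"
    using assms by (simp add: in_closure_of)
  then show thesis
    using that by blast
qed

lemma eq_on_higson_compactification:
  assumes "Hausdorff_space Y" "continuous_map higson_compactification Y f"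
    "continuous_map higson_compactification Y g" 
    and "\<And>x. f (higson_embedding x) = g (higson_embedding x)"
    and "\<omega> \<in> topspace higson_compactification"
  shows "f \<omega> = g \<omega>"
  using assms by (intro forall_in_closure_of_eq[of \<omega> higson_compactification "range higson_embedding" Y f g])
    (auto simp: dense_higson_embedding)

text \<open>A continuous map is controlled, up to a given error, by finitely many functions of vanishing
  variation: around each point the topology is that of finitely many coordinates, and finitely
  many such neighbourhoods of half the size cover the space.\<close>

lemma vanishing_variation_if_continuous:
  fixes F :: "(('x::metric_space \<Rightarrow> complex) \<Rightarrow> complex) \<Rightarrow> 'm"
  assumes M: "Metric_space M d"
    and F: "continuous_map higson_compactification (Metric_space.mtopology M d) F"
  shows "vanishing_variation d (\<lambda>x. F (higson_embedding x))"
  unfolding vanishing_variation_iff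
proof (intro allI impI)
  interpret Metric_space M d by fact
  let ?Y = "higson_compactification :: (('x \<Rightarrow> complex) \<Rightarrow> complex) topology"
  let ?H = "carrier (higson_algebra :: ('x \<Rightarrow> complex) cstar_alg)"
  fix R \<epsilon> :: real assume "R > 0" "\<epsilon> > 0"
  have "\<exists>G \<delta>. finite G \<and> G \<subseteq> ?H \<and> \<delta> > 0 \<and>
      (\<forall>\<omega>'\<in>topspace ?Y. (\<forall>f\<in>G. cmod (\<omega>' f - \<omega> f) < \<delta>) \<longrightarrow> F \<omega>' \<in> mball (F \<omega>) (\<epsilon> / 2))"
    if \<omega>: "\<omega> \<in> topspace ?Y" for \<omega>
  proof -
    obtain U where U: "openin ?Y U" "\<omega> \<in> U" "\<forall>y\<in>U. F y \<in> mball (F \<omega>) (\<epsilon> / 2)"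
      using F[unfolded continuous_map_to_metric, rule_format, OF \<omega> half_gt_zero[OF \<open>\<epsilon> > 0\<close>]] by blast
    obtain G \<delta> where "finite G" "G \<subseteq> ?H" "\<delta> > 0"
      "\<And>\<omega>'. \<omega>' \<in> topspace ?Y \<Longrightarrow> (\<forall>f\<in>G. cmod (\<omega>' f - \<omega> f) < \<delta>) \<Longrightarrow> \<omega>' \<in> U"
      using higson_neighbourhood[OF U(1,2)] by metis
    then show ?thesis
      using U(3) by (intro exI[of _ G] exI[of _ \<delta>]) auto
  qed
  then obtain G \<delta> where G: "\<And>\<omega>. \<omega> \<in> topspace ?Y \<Longrightarrow> finite (G \<omega>)"
      "\<And>\<omega>. \<omega> \<in> topspace ?Y \<Longrightarrow> G \<omega> \<subseteq> ?H" "\<And>\<omega>. \<omega> \<in> topspace ?Y \<Longrightarrow> \<delta> \<omega> > (0::real)"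
      "\<And>\<omega> \<omega>'. \<omega> \<in> topspace ?Y \<Longrightarrow> \<omega>' \<in> topspace ?Y \<Longrightarrow> (\<forall>f\<in>G \<omega>. cmod (\<omega>' f - \<omega> f) < \<delta> \<omega>) \<Longrightarrow>
        F \<omega>' \<in> mball (F \<omega>) (\<epsilon> / 2)"
    by metis
  define V where "V \<omega> = {\<omega>' \<in> topspace ?Y. \<forall>f\<in>G \<omega>. cmod (\<omega>' f - \<omega> f) < \<delta> \<omega> / 2}" for \<omega>
  have V: "openin ?Y (V \<omega>)" if \<omega>: "\<omega> \<in> topspace ?Y" for \<omega>
  proof -
    have "openin ?Y {\<omega>' \<in> topspace ?Y. \<omega>' f \<in> ball (\<omega> f) (\<delta> \<omega> / 2)}" if f: "f \<in> G \<omega>" for f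
      using G(2)[OF \<omega>] f by (intro openin_continuous_map_preimage[of _ euclidean] continuous_map_evaluation) auto
    then have "openin ?Y (topspace ?Y \<inter> (\<Inter>f\<in>G \<omega>. {\<omega>' \<in> topspace ?Y. \<omega>' f \<in> ball (\<omega> f) (\<delta> \<omega> / 2)}))"
      using G(1)[OF \<omega>] by (intro openin_Int_Inter) auto
    also have "topspace ?Y \<inter> (\<Inter>f\<in>G \<omega>. {\<omega>' \<in> topspace ?Y. \<omega>' f \<in> ball (\<omega> f) (\<delta> \<omega> / 2)}) = V \<omega>"
      by (auto simp: V_def dist_norm norm_minus_commute)
    finally show ?thesis .
  qed
  have "\<omega> \<in> V \<omega>" if "\<omega> \<in> topspace ?Y" for \<omega>
    using that G(3) by (simp add: V_def)
  then have "topspace ?Y \<subseteq> \<Union>(V ` topspace ?Y)" by blast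
  then obtain \<V> where "finite \<V>" "\<V> \<subseteq> V ` topspace ?Y" "topspace ?Y \<subseteq> \<Union>\<V>"
    using compact_higson_compactification[where 'x='x] V
    unfolding compact_space_alt by (metis (no_types, lifting) imageE)
  then obtain P where P: "finite P" "P \<subseteq> topspace ?Y" "topspace ?Y \<subseteq> \<Union>(V ` P)"
    using finite_subset_image[of \<V> V] by metis
  have "\<exists>K. bounded K \<and> (\<forall>x y. x \<notin> K \<longrightarrow> dist x y \<le> R \<longrightarrow> dist (f x) (f y) < \<delta> \<omega> / 2)"
    if "\<omega> \<in> P" "f \<in> G \<omega>" for \<omega> f
  proof (rule vanishing_variationD[OF _ \<open>R > 0\<close>])
    have \<omega>: "\<omega> \<in> topspace ?Y" using P that by blast
    show "vanishing_variation dist f"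
      using G(2)[OF \<omega>] that by (auto simp: carrier_higson_algebra)
    show "\<delta> \<omega> / 2 > 0" using G(3)[OF \<omega>] by simp
  qed
  then obtain K where K: "\<And>\<omega> f. \<omega> \<in> P \<Longrightarrow> f \<in> G \<omega> \<Longrightarrow> bounded (K \<omega> f)"
      "\<And>\<omega> f x y. \<omega> \<in> P \<Longrightarrow> f \<in> G \<omega> \<Longrightarrow> x \<notin> K \<omega> f \<Longrightarrow> dist x y \<le> R \<Longrightarrow> dist (f x) (f y) < \<delta> \<omega> / 2"
    by metis
  show "\<exists>K. bounded K \<and> (\<forall>x y. x \<notin> K \<longrightarrow> dist x y \<le> R \<longrightarrow>
      d (F (higson_embedding x)) (F (higson_embedding y)) < \<epsilon>)"
  proof (intro exI conjI allI impI)
    show "bounded (\<Union>\<omega>\<in>P. \<Union>f\<in>G \<omega>. K \<omega> f)"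
      using K(1) P(1,2) G(1) by (intro bounded_UN ballI) auto
    fix x y assume x: "x \<notin> (\<Union>\<omega>\<in>P. \<Union>f\<in>G \<omega>. K \<omega> f)" and xy: "dist x y \<le> R"
    have "higson_embedding x \<in> topspace ?Y" by simp
    then obtain \<omega> where \<omega>: "\<omega> \<in> P" "higson_embedding x \<in> V \<omega>"
      using P(3) by blast
    have \<omega>Y: "\<omega> \<in> topspace ?Y" using \<omega>(1) P(2) by blast
    have near_x: "cmod (f x - \<omega> f) < \<delta> \<omega> / 2" if "f \<in> G \<omega>" for f
    proof -
      have "f \<in> ?H" using G(2)[OF \<omega>Y] that by blast
      moreover have "cmod (higson_embedding x f - \<omega> f) < \<delta> \<omega> / 2"
        using \<omega>(2) that by (simp add: V_def)
      ultimately show ?thesis by simp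
    qed
    have near_y: "cmod (f y - \<omega> f) < \<delta> \<omega>" if f: "f \<in> G \<omega>" for f
    proof -
      have "dist (f x) (f y) < \<delta> \<omega> / 2"
        using K(2)[OF \<omega>(1) f _ xy] x \<omega>(1) f by blast
      then show ?thesis
        using near_x[OF f] norm_triangle_ineq[of "f y - f x" "f x - \<omega> f"]
        by (simp add: dist_norm norm_minus_commute)
    qed
    have "F (higson_embedding x) \<in> mball (F \<omega>) (\<epsilon> / 2)"
      using near_x G(2,3)[OF \<omega>Y] by (intro G(4)[OF \<omega>Y]) force+
    moreover have "F (higson_embedding y) \<in> mball (F \<omega>) (\<epsilon> / 2)"
      using near_y G(2)[OF \<omega>Y] by (intro G(4)[OF \<omega>Y]) force+
    ultimately show "d (F (higson_embedding x)) (F (higson_embedding y)) < \<epsilon>"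
      using triangle'[of "F (higson_embedding x)" "F \<omega>" "F (higson_embedding y)"] by (auto simp: commute)
  qed
qed


section \<open>The Higson corona\<close>

lemma topspace_remainder: "topspace (remainder Z i) = topspace Z - range i"
  by (auto simp: remainder_def)

lemma topspace_higson_corona:
  "topspace higson_corona = topspace higson_compactification - range higson_embedding"
  by (simp add: higson_corona_def topspace_remainder)

text \<open>The closure of a bounded set is compact, so its image in \<open>\<eta>X\<close> is closed.\<close>

lemma bounded_misses_corona_neighbourhood:
  fixes S :: "'x::metric_space set"
  assumes coarse: "\<And>S :: 'x set. bounded S \<Longrightarrow> compact (closure S)"
    and "bounded S" and \<omega>: "\<omega> \<in> topspace higson_corona"
  obtains W where "openin higson_compactification W" "\<omega> \<in> W" "\<And>x. x \<in> S \<Longrightarrow> higson_embedding x \<notin> W"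
proof
  let ?K = "higson_embedding ` closure S"
  have "compactin higson_compactification ?K"
    using coarse[OF \<open>bounded S\<close>] by (intro image_compactin[OF _ continuous_map_higson_embedding]) simp
  then have "closedin higson_compactification ?K"
    by (simp add: compactin_imp_closedin Hausdorff_higson_compactification)
  then show "openin higson_compactification (topspace higson_compactification - ?K)"
    by blast
  show "\<omega> \<in> topspace higson_compactification - ?K"
    using \<omega> by (auto simp: topspace_higson_corona)
  show "higson_embedding x \<notin> topspace higson_compactification - ?K" if "x \<in> S" for x
    using subsetD[OF closure_subset that] by simp
qed

lemma bump_in_higson_algebra:
  fixes a :: "'x::metric_space"
  assumes coarse: "\<And>S :: 'x set. bounded S \<Longrightarrow> compact (closure S)"
  shows "(\<lambda>x. complex_of_real (max 0 (r - dist a x))) \<in> carrier higson_algebra"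
proof -
  let ?f = "\<lambda>x. complex_of_real (max 0 (r - dist a x))"
  have "bounded {x. \<epsilon> \<le> cmod (?f x)}" if "\<epsilon> > 0" for \<epsilon>
    using that by (intro bounded_subset[OF bounded_cball[of a r]]) auto
  moreover have "continuous_on UNIV ?f"
    by (intro continuous_intros)
  ultimately have "?f \<in> C0_functions complex_cstar"
    by (simp add: C0_functions_def)
  from C0_subset_vv[OF coarse pre_cstar_algebra_complex this] show ?thesis
    by (simp add: higson_algebra_def)
qed

lemma bump_vanishes_on_corona:
  fixes a :: "'x::metric_space"
  assumes coarse: "\<And>S :: 'x set. bounded S \<Longrightarrow> compact (closure S)"
    and \<omega>: "\<omega> \<in> topspace higson_corona"
  shows "\<omega> (\<lambda>x. complex_of_real (max 0 (r - dist a x))) = 0" (is "\<omega> ?f = 0")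
proof (rule ccontr)
  assume nz: "\<omega> ?f \<noteq> 0"
  obtain W where W: "openin higson_compactification W" "\<omega> \<in> W" "\<And>x. x \<in> cball a r \<Longrightarrow> higson_embedding x \<notin> W"
    using bounded_misses_corona_neighbourhood[OF coarse bounded_cball \<omega>] by metis
  have f: "?f \<in> carrier higson_algebra"
    by (rule bump_in_higson_algebra[OF coarse])
  let ?V = "{\<omega> \<in> topspace higson_compactification. \<omega> ?f \<in> - {0}}"
  have "openin higson_compactification ?V"
    by (rule openin_continuous_map_preimage[OF continuous_map_evaluation[OF f]]) (simp add: open_Compl)
  then have "openin higson_compactification (W \<inter> ?V)"
    using W by blast
  moreover have "\<omega> \<in> W \<inter> ?V"
    using W nz \<omega> by (simp add: topspace_higson_corona)
  ultimately obtain x where x: "higson_embedding x \<in> W \<inter> ?V"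
      by (rule dense_higson_embeddingE)
  then have "x \<in> cball a r"
    using f by (auto simp: max_def split: if_splits)
  then show False
    using W(3) x by blast
qed

text \<open>Bump functions vanish on the corona, and the bump function at a point of \<open>X\<close> does not vanish there.
  So the corona is the common zero set of the bump functions.\<close>

lemma closedin_corona:
  assumes coarse: "\<And>S :: 'x::metric_space set. bounded S \<Longrightarrow> compact (closure S)"
  shows "closedin higson_compactification 
    (topspace (higson_corona :: (('x \<Rightarrow> complex) \<Rightarrow> complex) topology))"
proof -
  let ?f = "\<lambda>a x :: 'x. complex_of_real (max 0 (1 - dist a x))"
  have f: "?f a \<in> carrier higson_algebra" for a
    by (rule bump_in_higson_algebra[OF coarse])
  have "topspace higson_corona = topspace higson_compactification \<inter> 
      (\<Inter>a. {\<omega> \<in> topspace higson_compactification. \<omega> (?f a) \<in> {0}})" (is "_ = ?R")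
  proof (intro equalityI subsetI)
    fix \<omega> :: "('x \<Rightarrow> complex) \<Rightarrow> complex" assume "\<omega> \<in> topspace higson_corona"
    then show "\<omega> \<in> ?R"
      using bump_vanishes_on_corona[OF coarse, of \<omega>] by (auto simp: topspace_higson_corona)
  next
    fix \<omega> :: "('x \<Rightarrow> complex) \<Rightarrow> complex" assume \<omega>: "\<omega> \<in> ?R"
    have "\<omega> \<noteq> higson_embedding a" for a
    proof
      assume "\<omega> = higson_embedding a"
      then have "\<omega> (?f a) = 1" using f by simp
      moreover have "\<omega> (?f a) = 0" using \<omega> by blast
      ultimately show False by simp
    qed
    then show "\<omega> \<in> topspace higson_corona"
      using \<omega> by (auto simp: topspace_higson_corona)
  qed
  also have "closedin higson_compactification ?R"
    by (intro closedin_Int closedin_INT closedin_topspace closedin_continuous_map_preimage[of _ euclidean]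
      continuous_map_evaluation f) auto
  finally show ?thesis .
qed

lemma compact_higson_corona:
  assumes coarse: "\<And>S :: 'x::metric_space set. bounded S \<Longrightarrow> compact (closure S)"
  shows "compact_space (higson_corona :: (('x \<Rightarrow> complex) \<Rightarrow> complex) topology)"
  using compact_space_subtopology[OF closedin_compact_space[OF compact_higson_compactification closedin_corona[OF coarse]]]
  by (simp add: topspace_higson_corona) (simp add: higson_corona_def remainder_def)

text \<open>If \<open>F\<close> vanishes on the corona, the compact set where its norm is at least \<open>\<epsilon>\<close> consists of points of
  \<open>X\<close>, and it is covered by the increasing open sets where the bump function of radius \<open>n\<close> is nonzero;
  so it lies in a ball. If \<open>F\<close> does not vanish at \<open>\<omega>\<close>, the set where it is large is a neighbourhood of
  \<open>\<omega>\<close>, but a bounded set cannot accumulate at \<open>\<omega>\<close>.\<close>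

lemma vanishes_on_corona_iff:
  fixes F :: "(('x::metric_space \<Rightarrow> complex) \<Rightarrow> complex) \<Rightarrow> 'b"
  assumes coarse: "\<And>S :: 'x set. bounded S \<Longrightarrow> compact (closure S)"
    and B: "pre_cstar_algebra B" and F: "continuous_map higson_compactification (cstar_topology B) F"
  shows "(\<forall>\<omega>\<in>topspace higson_corona. F \<omega> = \<zero>\<^bsub>B\<^esub>) \<longleftrightarrow> (\<lambda>x. F (higson_embedding x)) \<in> C0_functions B"
    (is "?lhs \<longleftrightarrow> ?rhs")
proof
  interpret B: pre_cstar_algebra B by fact
  let ?Y = "higson_compactification :: (('x \<Rightarrow> complex) \<Rightarrow> complex) topology"
  have cont: "continuous_map euclidean (cstar_topology B) (\<lambda>x. F (higson_embedding x))"
    using continuous_map_compose[OF continuous_map_higson_embedding F] by (simp add: o_def)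
  assume L: ?lhs
  have "bounded {x. \<epsilon> \<le> cnorm B (F (higson_embedding x))}" if "\<epsilon> > 0" for \<epsilon>
  proof -
    define K where "K = {\<omega> \<in> topspace ?Y. cnorm B (F \<omega>) \<in> {\<epsilon>..}}"
    have "closedin ?Y K"
      unfolding K_def by (rule closedin_continuous_map_preimage[OF B.continuous_map_cnorm[OF F]]) simp
    then have K: "compactin ?Y K"
      by (rule closedin_compact_space[OF compact_higson_compactification])
    define a :: 'x where "a = undefined"
    define f where "f n = (\<lambda>x. complex_of_real (max 0 (real n - dist a x)))" for n
    have f: "f n \<in> carrier higson_algebra" for n
      unfolding f_def by (rule bump_in_higson_algebra[OF coarse])
    define U where "U n = {\<omega> \<in> topspace ?Y. \<omega> (f n) \<in> - {0}}" for n
    have "openin ?Y (U n)" for n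
      unfolding U_def by (rule openin_continuous_map_preimage[OF continuous_map_evaluation[OF f]]) (simp add: open_Compl)
    moreover have "K \<subseteq> (\<Union>n. U n)"
    proof
      fix \<omega> assume \<omega>: "\<omega> \<in> K"
      then have "\<omega> \<notin> topspace higson_corona"
        using L \<open>\<epsilon> > 0\<close> by (auto simp: K_def)
      then obtain x where x: "\<omega> = higson_embedding x"
        using \<omega> by (auto simp: K_def topspace_higson_corona)
      obtain n where "dist a x < real n"
        using reals_Archimedean2 by blast
      then have "f n x \<noteq> 0"
        unfolding f_def of_real_eq_0_iff by simp
      then have "\<omega> (f n) \<noteq> 0"
        using f[of n] by (simp add: x)
      then show "\<omega> \<in> (\<Union>n. U n)"
        using \<omega> by (auto simp: U_def K_def)
    qed
    ultimately obtain \<N> where \<N>: "finite \<N>" "\<N> \<subseteq> range U" "K \<subseteq> \<Union>\<N>"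
      using K[unfolded compactin_def, THEN conjunct2, rule_format, of "range U"] by blast
    then obtain N where N: "finite N" "K \<subseteq> (\<Union>n\<in>N. U n)"
      using finite_subset_image[of \<N> U UNIV] by metis
    have "bounded (\<Union>n\<in>N. cball a (real n))"
      using N by (intro bounded_UN) auto
    moreover have "{x. \<epsilon> \<le> cnorm B (F (higson_embedding x))} \<subseteq> (\<Union>n\<in>N. cball a (real n))"
    proof
      fix x assume "x \<in> {x. \<epsilon> \<le> cnorm B (F (higson_embedding x))}"
      then have "higson_embedding x \<in> K" by (simp add: K_def)
      then obtain n where n: "n \<in> N" "higson_embedding x \<in> U n" using N by blast
      then have "f n x \<noteq> 0" using f[of n] by (simp add: U_def)
      then have "dist a x \<le> real n" by (auto simp: f_def max_def split: if_splits)
      then show "x \<in> (\<Union>n\<in>N. cball a (real n))" using n by auto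
    qed
    ultimately show ?thesis by (rule bounded_subset)
  qed
  then show ?rhs
    using cont by (simp add: C0_functions_def)
next
  interpret B: pre_cstar_algebra B by fact
  let ?Y = "higson_compactification :: (('x \<Rightarrow> complex) \<Rightarrow> complex) topology"
  assume R: ?rhs
  show ?lhs
  proof (rule ballI, rule ccontr)
    fix \<omega> :: "('x \<Rightarrow> complex) \<Rightarrow> complex" assume \<omega>: "\<omega> \<in> topspace higson_corona" "F \<omega> \<noteq> \<zero>\<^bsub>B\<^esub>"
    have \<omega>Y: "\<omega> \<in> topspace ?Y" using \<omega> by (simp add: topspace_higson_corona)
    have c: "F \<omega> \<in> carrier B" by (rule B.continuous_map_in_carrier[OF F \<omega>Y])
    define \<epsilon> where "\<epsilon> = cnorm B (F \<omega>) / 2"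
    have "cnorm B (F \<omega>) \<noteq> 0"
      using \<omega>(2) B.cnorm_eq_0[OF c] by simp
    then have \<epsilon>: "\<epsilon> > 0" "\<epsilon> < cnorm B (F \<omega>)"
      using B.cnorm_nonneg[OF c] by (simp_all add: \<epsilon>_def)
    have "bounded {x. \<epsilon> \<le> cnorm B (F (higson_embedding x))}"
      using R \<epsilon> by (simp add: C0_functions_def)
    then obtain W where W: "openin ?Y W" "\<omega> \<in> W"
        "\<And>x. \<epsilon> \<le> cnorm B (F (higson_embedding x)) \<Longrightarrow> higson_embedding x \<notin> W"
      using bounded_misses_corona_neighbourhood[OF coarse _ \<omega>(1)] by (metis (lifting) mem_Collect_eq)
    let ?V = "{\<omega> \<in> topspace ?Y. cnorm B (F \<omega>) \<in> {\<epsilon><..}}"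
    have "openin ?Y ?V"
      by (rule openin_continuous_map_preimage[OF B.continuous_map_cnorm[OF F]]) simp
    then have "openin ?Y (W \<inter> ?V)" using W by blast
    moreover have "\<omega> \<in> W \<inter> ?V" using W \<epsilon> \<omega>Y by simp
    ultimately obtain x where "higson_embedding x \<in> W \<inter> ?V"
      by (rule dense_higson_embeddingE)
    then show False using W(3)[of x] by auto
  qed
qed


section \<open>Extension to the Higson compactification\<close>

text \<open>The value at \<open>\<omega>\<close> is the point \<open>z\<close> for which \<open>\<omega>\<close> annihilates the distance to \<open>z\<close>. If no such point
  existed, the distances to finitely many points would be simultaneously bounded below along \<open>X\<close>
  by radii for which the balls cover \<open>Z\<close>.\<close>

lemma higson_extension_exists:
  fixes i :: "'x::metric_space \<Rightarrow> 'z"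
  assumes M: "Metric_space M d" and compact: "compact_space (Metric_space.mtopology M d)"
    and i: "continuous_map euclidean (Metric_space.mtopology M d) i" and vv: "vanishing_variation d i"
  shows "\<exists>\<pi>. is_higson_extension (Metric_space.mtopology M d) i \<pi>"
proof -
  interpret Metric_space M d by fact
  let ?Y = "higson_compactification :: (('x \<Rightarrow> complex) \<Rightarrow> complex) topology"
  have iM: "i x \<in> M" for x
    using i by (auto simp: continuous_map_def)
  define D where "D z = (\<lambda>x. complex_of_real (d z (i x)))" for z
  have D: "D z \<in> carrier higson_algebra" if z: "z \<in> M" for z
  proof -
    have lip: "\<bar>d z (i x) - d z (i y)\<bar> \<le> d (i x) (i y)" for x y
      using mdist_reverse_triangle[of "i x" z "i y"] z iM by (simp add: commute)
    have "compactin mtopology M"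
      using compact by (simp add: compact_space_def)
    then obtain e where e: "\<forall>a\<in>M. \<forall>b\<in>M. d a b \<le> e"
      using compactin_imp_mbounded[of M] unfolding mbounded_alt by blast
    have "continuous_map euclidean euclideanreal (\<lambda>x. d z (i x))"
      using continuous_map_mdist[of euclidean "metric (M, d)" "\<lambda>_. z" i] i z by simp
    then have "continuous_on UNIV (D z)"
      by (auto simp: D_def intro!: continuous_intros)
    moreover have "vanishing_variation dist (D z)"
      by (rule vanishing_variation_by_domination[OF vv vv, of _ _ 1])
        (auto simp: D_def dist_real_def dist_of_real intro!: order.trans[OF lip])
    moreover have "cmod (D z x) \<le> e" for x
      using e z iM[of x] by (simp add: D_def)
    ultimately show ?thesis
      unfolding carrier_higson_algebra by blast
  qed
  \<comment> \<open>the restriction of \<open>\<omega>\<close> to finitely many distance functions is nearly evaluation at a point\<close>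
  have approx: "\<exists>x. \<forall>z\<in>P. cmod (D z x - \<omega> (D z)) < \<epsilon>"
    if "\<omega> \<in> topspace ?Y" "finite P" "P \<subseteq> M" "\<epsilon> > 0" for \<omega> P \<epsilon>
    using character_approx[OF that(1), of "D ` P" \<epsilon>] that D by auto
  have ex: "\<exists>z\<in>M. \<omega> (D z) = 0" if \<omega>: "\<omega> \<in> topspace ?Y" for \<omega>
  proof (rule ccontr)
    assume "\<not> ?thesis"
    then have c: "cmod (\<omega> (D z)) > 0" if "z \<in> M" for z using that by auto
    let ?U = "\<lambda>z. mball z (cmod (\<omega> (D z)) / 2)"
    have cover: "topspace mtopology \<subseteq> \<Union>(?U ` M)"
    proof
      fix z assume "z \<in> topspace mtopology"
      then have "z \<in> M" "z \<in> ?U z" using c by auto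
      then show "z \<in> \<Union>(?U ` M)" by blast
    qed
    have "\<forall>U\<in>?U ` M. openin mtopology U"
      by auto
    then obtain \<U> where \<U>: "finite \<U>" "\<U> \<subseteq> ?U ` M" "topspace mtopology \<subseteq> \<Union>\<U>"
      using compact[unfolded compact_space_alt, THEN spec, of "?U ` M", THEN mp, OF conjI[OF _ cover]] by blast
    then obtain P where P: "finite P" "P \<subseteq> M" "M \<subseteq> \<Union>(?U ` P)"
      using finite_subset_image[of \<U> ?U M] by auto
    have "P \<noteq> {}" using P iM by blast
    define \<epsilon> where "\<epsilon> = Min ((\<lambda>z. cmod (\<omega> (D z)) / 2) ` P)"
    have "\<epsilon> > 0" using c P \<open>P \<noteq> {}\<close> by (auto simp: \<epsilon>_def)
    then obtain x where x: "\<forall>z\<in>P. cmod (D z x - \<omega> (D z)) < \<epsilon>"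
      using approx[OF \<omega> P(1,2)] by blast
    obtain z where z: "z \<in> P" "i x \<in> ?U z" using P(3) iM[of x] by blast
    have "\<epsilon> \<le> cmod (\<omega> (D z)) / 2"
      unfolding \<epsilon>_def using P(1) z(1) by (intro Min_le) auto
    moreover have "cmod (\<omega> (D z)) \<le> cmod (D z x) + cmod (D z x - \<omega> (D z))"
      using norm_triangle_sub[of "\<omega> (D z)" "D z x"] by (simp add: norm_minus_commute)
    moreover have "cmod (D z x) < cmod (\<omega> (D z)) / 2"
      using z(2) by (simp add: D_def)
    ultimately show False using x z(1) by fastforce
  qed
  define \<pi> where "\<pi> = (\<lambda>\<omega>\<in>topspace ?Y. SOME z. z \<in> M \<and> \<omega> (D z) = 0)"
  have \<pi>: "\<pi> \<omega> \<in> M" "\<omega> (D (\<pi> \<omega>)) = 0" if \<omega>: "\<omega> \<in> topspace ?Y" for \<omega>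
    using someI_ex[of "\<lambda>z. z \<in> M \<and> \<omega> (D z) = 0"] ex[OF \<omega>] \<omega> by (auto simp: \<pi>_def)
  \<comment> \<open>\<open>\<omega> (D z)\<close> is the distance of \<open>z\<close> from \<open>\<pi> \<omega>\<close>; the upper bound suffices for continuity\<close>
  have dist_le: "d z (\<pi> \<omega>) \<le> cmod (\<omega> (D z))" if \<omega>: "\<omega> \<in> topspace ?Y" and z: "z \<in> M" for \<omega> z
  proof (rule field_le_epsilon)
    fix e :: real assume "e > 0"
    then obtain x where x: "\<forall>w\<in>{z, \<pi> \<omega>}. cmod (D w x - \<omega> (D w)) < e / 2"
      using approx[OF \<omega>, of "{z, \<pi> \<omega>}" "e / 2"] z \<pi>(1)[OF \<omega>] by auto
    have "d z (\<pi> \<omega>) \<le> cmod (D z x) + cmod (D (\<pi> \<omega>) x)"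
      using triangle[OF z iM[of x] \<pi>(1)[OF \<omega>]] by (simp add: D_def commute)
    moreover have "cmod (D z x) \<le> cmod (\<omega> (D z)) + cmod (D z x - \<omega> (D z))"
      by (rule norm_triangle_sub)
    moreover have "cmod (D (\<pi> \<omega>) x) < e / 2"
      using x \<pi>(2)[OF \<omega>] by simp
    ultimately show "d z (\<pi> \<omega>) \<le> cmod (\<omega> (D z)) + e"
      using x by fastforce
  qed
  have "continuous_map ?Y mtopology \<pi>"
    unfolding continuous_map_to_metric
  proof (intro ballI allI impI)
    fix \<omega> \<epsilon> assume \<omega>: "\<omega> \<in> topspace ?Y" and "\<epsilon> > (0::real)"
    let ?U = "{\<omega>' \<in> topspace ?Y. \<omega>' (D (\<pi> \<omega>)) \<in> ball 0 \<epsilon>}"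
    have "openin ?Y ?U"
      by (rule openin_continuous_map_preimage[OF continuous_map_evaluation[OF D[OF \<pi>(1)[OF \<omega>]]]]) simp
    moreover have "\<pi> \<omega>' \<in> mball (\<pi> \<omega>) \<epsilon>" if "\<omega>' \<in> ?U" for \<omega>'
      using dist_le[of \<omega>' "\<pi> \<omega>"] \<pi>(1)[OF \<omega>] \<pi>(1)[of \<omega>'] that by auto
    ultimately show "\<exists>U. openin ?Y U \<and> \<omega> \<in> U \<and> (\<forall>y\<in>U. \<pi> y \<in> mball (\<pi> \<omega>) \<epsilon>)"
      using \<omega> \<pi>(2)[OF \<omega>] \<open>\<epsilon> > 0\<close> by (intro exI[of _ ?U]) auto
  qed
  moreover have "\<pi> (higson_embedding x) = i x" for x
  proof -
    have "higson_embedding x (D (i x)) = 0"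
      using iM[of x] by (subst higson_embedding_apply[OF D[OF iM]]) (simp add: D_def)
    then have "d (i x) (\<pi> (higson_embedding x)) \<le> 0"
      using dist_le[of "higson_embedding x" "i x"] iM by simp
    then show ?thesis
      using iM[of x] \<pi>(1)[of "higson_embedding x"] nonneg[of "i x" "\<pi> (higson_embedding x)"]
        zero[of "i x" "\<pi> (higson_embedding x)"] by simp
  qed
  ultimately show ?thesis
    unfolding is_higson_extension_def by (intro exI[of _ \<pi>]) (simp add: \<pi>_def)
qed

lemma is_higson_extension_unique:
  assumes "Hausdorff_space Z" "is_higson_extension Z i \<pi>" "is_higson_extension Z i \<pi>'"
  shows "\<pi> = \<pi>'"
  using assms eq_on_higson_compactification[of Z \<pi> \<pi>']
  by (intro extensionalityI[of \<pi> "topspace higson_compactification" \<pi>']) (auto simp: is_higson_extension_def)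

lemma higson_extension_eqI:
  "Hausdorff_space Z \<Longrightarrow> is_higson_extension Z i \<pi> \<Longrightarrow> higson_extension Z i = \<pi>"
  unfolding higson_extension_def using is_higson_extension_unique by blast

lemma ex1_higson_extension:
  assumes "admissible_compactification Z i"
  shows "\<exists>!\<pi>. is_higson_extension Z i \<pi>"
proof -
  obtain d where Z: "compactification Z i" and d: "Metric_space (topspace Z) d" 
      "Metric_space.mtopology (topspace Z) d = Z" "vanishing_variation d i"
    using assms by (auto simp: admissible_compactification_def)
  have "continuous_map euclidean Z i"
    using Z by (simp add: compactification_def embedding_map_def homeomorphic_imp_continuous_map 
      continuous_map_in_subtopology) (metis continuous_map_in_subtopology homeomorphic_imp_continuous_map)
  then have "\<exists>\<pi>. is_higson_extension Z i \<pi>"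
    using higson_extension_exists[OF d(1) _ _ d(3)] Z by (simp add: d(2) compactification_def)
  then show ?thesis
    using is_higson_extension_unique Z unfolding compactification_def by blast
qed

text \<open>A corona point cannot be sent to \<open>i x\<close>: the part of \<open>X\<close> that \<open>i\<close> maps near \<open>i x\<close> is bounded.\<close>

lemma higson_extension_preserves_remainder:
  fixes i :: "'x::metric_space \<Rightarrow> 'z"
  assumes coarse: "\<And>S :: 'x set. bounded S \<Longrightarrow> compact (closure S)"
    and Z: "compactification Z i" and \<pi>: "is_higson_extension Z i \<pi>" and \<omega>: "\<omega> \<in> topspace higson_corona"
  shows "\<pi> \<omega> \<in> topspace (remainder Z i)"
proof -
  let ?Y = "higson_compactification :: (('x \<Rightarrow> complex) \<Rightarrow> complex) topology"
  have cont: "continuous_map ?Y Z \<pi>" and \<pi>i: "\<And>x. \<pi> (higson_embedding x) = i x"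
    using \<pi> by (auto simp: is_higson_extension_def)
  have \<omega>Y: "\<omega> \<in> topspace ?Y" using \<omega> by (simp add: topspace_higson_corona)
  have "\<pi> \<omega> \<noteq> i x" for x
  proof
    assume eq: "\<pi> \<omega> = i x"
    have emb: "homeomorphic_map euclidean (subtopology Z (range i)) i"
      using Z by (simp add: compactification_def embedding_map_def)
    then have "openin (subtopology Z (range i)) (i ` ball x 1)"
      by (meson homeomorphic_map_openness_eq open_ball open_openin)
    then obtain V where V: "openin Z V" "i ` ball x 1 = V \<inter> range i"
      by (auto simp: openin_subtopology)
    obtain W where W: "openin ?Y W" "\<omega> \<in> W" "\<And>y. y \<in> ball x 1 \<Longrightarrow> higson_embedding y \<notin> W"
      using bounded_misses_corona_neighbourhood[OF coarse bounded_ball \<omega>] by metis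
    let ?U = "{\<omega> \<in> topspace ?Y. \<pi> \<omega> \<in> V}"
    have "openin ?Y (W \<inter> ?U)"
      using W openin_continuous_map_preimage[OF cont V(1)] by blast
    moreover have "i x \<in> V" using V(2) by auto
    then have "\<omega> \<in> W \<inter> ?U" using W \<omega>Y eq by simp
    ultimately obtain y where y: "higson_embedding y \<in> W \<inter> ?U"
      by (rule dense_higson_embeddingE)
    then have "i y \<in> i ` ball x 1" using V(2) \<pi>i by auto
    moreover have "inj i"
      using emb by (simp add: homeomorphic_eq_everything_map)
    ultimately have "y \<in> ball x 1" by (auto dest: injD)
    then show False using W(3) y by blast
  qed
  moreover have "\<pi> \<omega> \<in> topspace Z"
    using cont \<omega>Y by (auto simp: continuous_map_def)
  ultimately show ?thesis
    by (auto simp: topspace_remainder)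
qed

lemma higson_extension_onto:
  fixes i :: "'x::metric_space \<Rightarrow> 'z"
  assumes Z: "compactification Z i" and \<pi>: "is_higson_extension Z i \<pi>"
  shows "\<pi> ` topspace higson_compactification = topspace Z"
proof
  let ?Y = "higson_compactification :: (('x \<Rightarrow> complex) \<Rightarrow> complex) topology"
  have cont: "continuous_map ?Y Z \<pi>" and \<pi>i: "\<And>x. \<pi> (higson_embedding x) = i x"
    using \<pi> by (auto simp: is_higson_extension_def)
  show "\<pi> ` topspace ?Y \<subseteq> topspace Z"
    using cont by (auto simp: continuous_map_def)
  have "compactin Z (\<pi> ` topspace ?Y)"
    by (rule image_compactin[OF _ cont]) (metis compact_higson_compactification compact_space_def)
  then have "closedin Z (\<pi> ` topspace ?Y)"
    using Z by (simp add: compactin_imp_closedin compactification_def)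
  moreover have "range i \<subseteq> \<pi> ` topspace ?Y"
    using \<pi>i by (metis higson_embedding_in_topspace image_eqI image_subsetI)
  ultimately have "Z closure_of (range i) \<subseteq> \<pi> ` topspace ?Y"
    by (simp add: closure_of_minimal)
  then show "topspace Z \<subseteq> \<pi> ` topspace ?Y"
    using Z by (simp add: compactification_def)
qed

lemma higson_extension_onto_remainder:
  fixes i :: "'x::metric_space \<Rightarrow> 'z"
  assumes coarse: "\<And>S :: 'x set. bounded S \<Longrightarrow> compact (closure S)"
    and Z: "compactification Z i" and \<pi>: "is_higson_extension Z i \<pi>"
  shows "\<pi> ` topspace higson_corona = topspace (remainder Z i)"
proof
  show "\<pi> ` topspace higson_corona \<subseteq> topspace (remainder Z i)"
    using higson_extension_preserves_remainder[OF coarse Z \<pi>] by blast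
  show "topspace (remainder Z i) \<subseteq> \<pi> ` topspace higson_corona"
  proof
    fix z assume z: "z \<in> topspace (remainder Z i)"
    then obtain \<omega> where "\<omega> \<in> topspace higson_compactification" "z = \<pi> \<omega>"
      using higson_extension_onto[OF Z \<pi>] by (auto simp: topspace_remainder)
    moreover from this have "\<omega> \<notin> range higson_embedding"
      using z \<pi> by (auto simp: topspace_remainder is_higson_extension_def)
    ultimately show "z \<in> \<pi> ` topspace higson_corona"
      by (auto simp: topspace_higson_corona)
  qed
qed


section \<open>Tietze extension for functions with values in a C*-algebra\<close>

context pre_cstar_algebra
begin

text \<open>The sum \<open>h = \<Sum> w\<^sub>j b\<^sub>j\<close>. Comparing it with an arbitrary \<open>c\<close> serves two purposes: \<open>c = 0\<close> bounds the
  norm of \<open>h\<close>, and for a partition of unity \<open>c = g y\<close> bounds the distance from \<open>g\<close>.\<close>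

lemma weighted_combination:
  assumes "finite J" and "\<And>j. j \<in> J \<Longrightarrow> continuous_map Y euclideanreal (w j)"
    and "\<And>j y. j \<in> J \<Longrightarrow> y \<in> topspace Y \<Longrightarrow> 0 \<le> w j y" and "\<And>j. j \<in> J \<Longrightarrow> b j \<in> carrier A"
  shows "\<exists>h. continuous_map Y (cstar_topology A) h \<and> (\<forall>y\<in>topspace Y. \<forall>c\<in>carrier A.
    cnorm A (h y \<ominus> complex_of_real (\<Sum>j\<in>J. w j y) \<odot> c) \<le> (\<Sum>j\<in>J. w j y * cnorm A (b j \<ominus> c)))"
  using assms
proof (induction J rule: finite_induct)
  case empty
  show ?case
    by (rule exI[of _ "\<lambda>_. \<zero>"]) simp
next
  case (insert j J)
  then obtain h where h: "continuous_map Y (cstar_topology A) h"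
    "\<And>y c. y \<in> topspace Y \<Longrightarrow> c \<in> carrier A \<Longrightarrow>
       cnorm A (h y \<ominus> complex_of_real (\<Sum>j\<in>J. w j y) \<odot> c) \<le> (\<Sum>j\<in>J. w j y * cnorm A (b j \<ominus> c))"
    by auto
  have "continuous_map Y euclidean (complex_of_real \<circ> w j)"
    using insert.prems(1)[of j] by (intro continuous_map_compose[of Y euclideanreal]) (auto intro!: continuous_intros)
  then have w: "continuous_map Y euclidean (\<lambda>y. complex_of_real (w j y))"
    by (simp add: o_def)
  have bj: "b j \<in> carrier A" using insert by simp
  show ?case
  proof (intro exI[of _ "\<lambda>y. complex_of_real (w j y) \<odot> b j \<oplus> h y"] conjI ballI)
    show "continuous_map Y (cstar_topology A) (\<lambda>y. complex_of_real (w j y) \<odot> b j \<oplus> h y)"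
      by (intro continuous_map_add_cstar continuous_map_smult_cstar continuous_map_const_cstar w h bj)
    fix y c assume y: "y \<in> topspace Y" and c: "c \<in> carrier A"
    have hy: "h y \<in> carrier A" by (rule continuous_map_in_carrier[OF h(1) y])
    have "complex_of_real (w j y) \<odot> b j \<oplus> h y \<ominus> complex_of_real (\<Sum>j\<in>insert j J. w j y) \<odot> c =
        complex_of_real (w j y) \<odot> (b j \<ominus> c) \<oplus> (h y \<ominus> complex_of_real (\<Sum>j\<in>J. w j y) \<odot> c)"
      using insert.hyps bj c hy by (simp add: smult_add_scalar add_minus_add smult_minus)
    also have "cnorm A \<dots> \<le> cnorm A (complex_of_real (w j y) \<odot> (b j \<ominus> c)) 
        + cnorm A (h y \<ominus> complex_of_real (\<Sum>j\<in>J. w j y) \<odot> c)"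
      using bj c hy by (intro cnorm_add) auto
    also have "\<dots> \<le> w j y * cnorm A (b j \<ominus> c) + (\<Sum>j\<in>J. w j y * cnorm A (b j \<ominus> c))"
      using insert.prems(2)[of j y] y bj c h(2)[OF y c] by (simp add: cnorm_smult)
    finally show "cnorm A (complex_of_real (w j y) \<odot> b j \<oplus> h y \<ominus> complex_of_real (\<Sum>j\<in>insert j J. w j y) \<odot> c)
        \<le> (\<Sum>j\<in>insert j J. w j y * cnorm A (b j \<ominus> c))"
      using insert.hyps by simp
  qed
qed

text \<open>A partition of unity subordinate to the sets on which \<open>g\<close> is nearly constant approximates \<open>g\<close> by
  a combination of finitely many values. Its members are extended by the scalar theorem and
  rescaled so that they sum to at most one everywhere, which preserves the norm bound.\<close>

lemma approximate_extension:
  assumes Y: "compact_space Y" "Hausdorff_space Y" and K: "closedin Y K"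
    and g: "continuous_map (subtopology Y K) (cstar_topology A) g"
    and "M > 0" and M: "\<And>y. y \<in> K \<Longrightarrow> cnorm A (g y) \<le> M"
  shows "\<exists>h. continuous_map Y (cstar_topology A) h \<and> (\<forall>y\<in>topspace Y. cnorm A (h y) \<le> M) \<and>
    (\<forall>y\<in>K. cnorm A (h y \<ominus> g y) \<le> M / 2)"
proof -
  let ?S = "subtopology Y K"
  have KY: "K \<subseteq> topspace Y" by (rule closedin_subset[OF K])
  have topS: "topspace ?S = K" using KY by auto
  have gc: "g y \<in> carrier A" if "y \<in> K" for y
    using continuous_map_in_carrier[OF g, of y] that KY by auto
  have dg: "continuous_map ?S euclideanreal (\<lambda>y. cnorm A (g y \<ominus> g j))" if "j \<in> K" for j
  proof -
    have "continuous_map ?S (cstar_topology A) (\<lambda>y. g y \<oplus> \<ominus> g j)"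
      using gc[OF that] by (intro continuous_map_add_cstar g continuous_map_const_cstar) auto
    then show ?thesis
      unfolding a_minus_def by (rule continuous_map_cnorm)
  qed
  define U where "U j = {y \<in> topspace ?S. cnorm A (g y \<ominus> g j) \<in> {..<M/2}}" for j
  have "openin ?S (U j)" if "j \<in> K" for j
    unfolding U_def by (rule openin_continuous_map_preimage[OF dg[OF that]]) simp
  then have "\<forall>V\<in>U ` K. openin ?S V"
    by blast
  moreover have "topspace ?S \<subseteq> \<Union>(U ` K)"
  proof
    fix y assume "y \<in> topspace ?S"
    then have "y \<in> K" "y \<in> U y"
      using gc \<open>M > 0\<close> topS by (auto simp: U_def minus_eq_0_iff cnorm_eq_0[THEN iffD2])
    then show "y \<in> \<Union>(U ` K)" by blast
  qed
  moreover have "compact_space ?S"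
    by (rule compact_space_subtopology[OF closedin_compact_space[OF Y(1) K]])
  ultimately obtain \<U> where \<U>: "finite \<U>" "\<U> \<subseteq> U ` K" "topspace ?S \<subseteq> \<Union>\<U>"
    unfolding compact_space_alt by meson
  then obtain P where P: "finite P" "P \<subseteq> K" "K \<subseteq> \<Union>(U ` P)"
    using finite_subset_image[of \<U> U K] topS by auto
  define \<phi> where "\<phi> j y = max 0 (M / 2 - cnorm A (g y \<ominus> g j))" for j y
  have \<phi>: "continuous_map ?S euclideanreal (\<phi> j)" "\<phi> j y \<ge> 0" if "j \<in> P" for j y
    unfolding \<phi>_def using that P(2)
    by (auto intro!: continuous_map_real_max continuous_map_diff dg)
  define s where "s y = (\<Sum>j\<in>P. \<phi> j y)" for y
  have s: "s y > 0" if "y \<in> K" for y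
  proof -
    obtain j where j: "j \<in> P" "y \<in> U j" using P(3) \<open>y \<in> K\<close> by blast
    then have "0 < \<phi> j y" by (simp add: U_def \<phi>_def)
    also have "\<dots> \<le> s y" 
      unfolding s_def using P(1) j(1) \<phi>(2) by (intro member_le_sum) auto
    finally show ?thesis .
  qed
  have conts: "continuous_map ?S euclideanreal s"
    unfolding s_def using P(1) \<phi> by (intro continuous_map_sum) auto
  have ex: "\<exists>l. continuous_map Y euclideanreal l \<and> (\<forall>y\<in>K. l y = \<phi> j y / s y) \<and> l ` topspace Y \<subseteq> {0..1}" 
    if j: "j \<in> P" for j
  proof -
    have "continuous_map ?S euclideanreal (\<lambda>y. \<phi> j y / s y)"
      using s topS by (intro continuous_map_real_divide \<phi>(1)[OF j] conts) force
    moreover have "(\<lambda>y. \<phi> j y / s y) ` K \<subseteq> {0..1}"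
    proof -
      have "\<phi> j y \<le> s y" for y
        unfolding s_def using P(1) j \<phi>(2) by (intro member_le_sum) auto
      then show ?thesis using s \<phi>(2)[OF j] by (auto simp: divide_le_eq less_imp_le)
    qed
    moreover have "normal_space Y"
      using Y by (simp add: compact_Hausdorff_or_regular_imp_normal_space)
    ultimately obtain l where "continuous_map Y euclideanreal l"
        "\<And>y. y \<in> K \<Longrightarrow> l y = \<phi> j y / s y" "l ` topspace Y \<subseteq> {0..1}"
      using Tietze_extension_closed_real_interval[of Y K "\<lambda>y. \<phi> j y / s y" 0 1] K by auto
    then show ?thesis by blast
  qed
  obtain l where l: "\<And>j. j \<in> P \<Longrightarrow> continuous_map Y euclideanreal (l j)"
      "\<And>j y. j \<in> P \<Longrightarrow> y \<in> K \<Longrightarrow> l j y = \<phi> j y / s y"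
      "\<And>j y. j \<in> P \<Longrightarrow> y \<in> topspace Y \<Longrightarrow> 0 \<le> l j y"
    using ex by (simp add: image_subset_iff Pi_iff) metis
  \<comment> \<open>off \<open>K\<close> the extended weights may sum to more than \<open>1\<close>; on \<open>K\<close> the factor \<open>N\<close> is \<open>1\<close>\<close>
  define N where "N y = max 1 (\<Sum>j\<in>P. l j y)" for y
  define w where "w j y = l j y / N y" for j y
  have N1: "N y \<ge> 1" for y by (simp add: N_def)
  have w: "continuous_map Y euclideanreal (w j)" "\<And>y. y \<in> topspace Y \<Longrightarrow> 0 \<le> w j y" if j: "j \<in> P" for j
  proof -
    have "continuous_map Y euclideanreal N"
      unfolding N_def using P(1) l(1) by (intro continuous_map_real_max continuous_map_sum) auto
    then show "continuous_map Y euclideanreal (w j)"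
      unfolding w_def using less_le_trans[OF zero_less_one N1] 
      by (intro continuous_map_real_divide l(1)[OF j]) (auto simp: less_le)
    show "0 \<le> w j y" if "y \<in> topspace Y" for y
      using l(3)[OF j that] N1[of y] by (simp add: w_def)
  qed
  have sumw: "(\<Sum>j\<in>P. w j y) \<le> 1" for y
    using N1[of y] by (simp add: w_def sum_divide_distrib[symmetric] N_def)
  have wK: "(\<Sum>j\<in>P. w j y) = 1" "\<And>j. j \<in> P \<Longrightarrow> w j y = \<phi> j y / s y" if y: "y \<in> K" for y
  proof -
    have "(\<Sum>j\<in>P. l j y) = (\<Sum>j\<in>P. \<phi> j y) / s y"
      using l(2) y by (simp add: sum_divide_distrib)
    then have 1: "(\<Sum>j\<in>P. l j y) = 1"
      using s[OF y] by (simp add: s_def)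
    then have "N y = 1" by (simp add: N_def)
    then show "(\<Sum>j\<in>P. w j y) = 1" "\<And>j. j \<in> P \<Longrightarrow> w j y = \<phi> j y / s y"
      using 1 l(2) y by (simp_all add: w_def)
  qed
  have "\<exists>h. continuous_map Y (cstar_topology A) h \<and> (\<forall>y\<in>topspace Y. \<forall>c\<in>carrier A.
      cnorm A (h y \<ominus> complex_of_real (\<Sum>j\<in>P. w j y) \<odot> c) \<le> (\<Sum>j\<in>P. w j y * cnorm A (g j \<ominus> c)))"
    by (rule weighted_combination) (use P(1,2) w gc in auto)
  then obtain h where h: "continuous_map Y (cstar_topology A) h"
    "\<And>y c. y \<in> topspace Y \<Longrightarrow> c \<in> carrier A \<Longrightarrow>
      cnorm A (h y \<ominus> complex_of_real (\<Sum>j\<in>P. w j y) \<odot> c) \<le> (\<Sum>j\<in>P. w j y * cnorm A (g j \<ominus> c))"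
    by blast
  have "cnorm A (h y) \<le> M" if y: "y \<in> topspace Y" for y
  proof -
    have "cnorm A (h y) \<le> (\<Sum>j\<in>P. w j y * cnorm A (g j))"
      using h(2)[OF y, of \<zero>] continuous_map_in_carrier[OF h(1) y] gc P(2) by (simp add: subset_iff)
    also have "\<dots> \<le> (\<Sum>j\<in>P. w j y * M)"
      using M P(2) w(2)[OF _ y] by (intro sum_mono mult_left_mono) auto
    also have "\<dots> \<le> M"
      using sumw[of y] \<open>M > 0\<close> by (simp add: sum_distrib_right[symmetric])
    finally show ?thesis .
  qed
  moreover have "cnorm A (h y \<ominus> g y) \<le> M / 2" if y: "y \<in> K" for y
  proof -
    have yY: "y \<in> topspace Y" using y KY by blast
    have "cnorm A (h y \<ominus> g y) \<le> (\<Sum>j\<in>P. w j y * cnorm A (g j \<ominus> g y))"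
      using h(2)[OF yY gc[OF y]] wK(1)[OF y] gc[OF y] by simp
    also have "\<dots> \<le> (\<Sum>j\<in>P. w j y * (M / 2))"
    proof (rule sum_mono)
      fix j assume j: "j \<in> P"
      then have jK: "j \<in> K" using P(2) by blast
      show "w j y * cnorm A (g j \<ominus> g y) \<le> w j y * (M / 2)"
      proof (cases "cnorm A (g y \<ominus> g j) \<le> M / 2")
        case True
        then show ?thesis
          using w(2)[OF j yY] cnorm_minus_commute[OF gc[OF y] gc[OF jK]] by (intro mult_left_mono) auto
      next
        case False
        then have "w j y = 0" by (simp add: wK(2)[OF y j] \<phi>_def)
        then show ?thesis by simp
      qed
    qed
    also have "\<dots> = M / 2"
      using wK(1)[OF y] by (simp add: sum_distrib_right[symmetric] sum_divide_distrib[symmetric])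
    finally show ?thesis .
  qed
  ultimately show ?thesis using h(1) by blast
qed

end

text \<open>Correcting the error of the approximation repeatedly, with half the bound each time, gives a
  uniform Cauchy sequence whose limit restricts to \<open>g\<close>.\<close>

theorem (in cstar_algebra) Tietze_extension_cstar:
  assumes Y: "compact_space Y" "Hausdorff_space Y" and K: "closedin Y K"
    and g: "continuous_map (subtopology Y K) (cstar_topology A) g"
  obtains h where "continuous_map Y (cstar_topology A) h" "\<And>y. y \<in> K \<Longrightarrow> h y = g y"
proof -
  interpret pre: pre_cstar_algebra A
    by (rule cstar_algebra_imp_pre_cstar_algebra) unfold_locales
  interpret M: Metric_space "carrier A" "cstar_dist A"
    by (rule pre.Metric_space_cstar_dist)
  let ?S = "subtopology Y K"
  have KY: "K \<subseteq> topspace Y" by (rule closedin_subset[OF K])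
  have topS: "topspace ?S = K" using KY by auto
  have gc: "g y \<in> carrier A" if "y \<in> K" for y
    using pre.continuous_map_in_carrier[OF g, of y] that KY by auto
  have "compact_space ?S"
    by (rule compact_space_subtopology[OF closedin_compact_space[OF Y(1) K]])
  then obtain C where C: "\<forall>y\<in>K. cnorm A (g y) \<le> C"
    using bounded_cont_algebra[OF pre.pre_cstar_algebra_axioms _ g] topS by auto
  define B where "B = max 1 C"
  have B: "B > 0" "\<And>y. y \<in> K \<Longrightarrow> cnorm A (g y) \<le> B"
    using C by (auto simp: B_def le_max_iff_disj)
  let ?P = "\<lambda>n f. continuous_map Y (cstar_topology A) f \<and> (\<forall>y\<in>K. cnorm A (g y \<ominus> f y) \<le> B / 2 ^ n)"
  let ?Q = "\<lambda>n f f'. \<forall>y\<in>topspace Y. cnorm A (f' y \<ominus> f y) \<le> B / 2 ^ n"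
  have base: "\<exists>f. ?P 0 f"
    using B gc by (intro exI[of _ "\<lambda>_. \<zero>"]) auto
  have step: "\<exists>f'. ?P (Suc n) f' \<and> ?Q n f f'" if f: "?P n f" for n f
  proof -
    have fK: "continuous_map ?S (cstar_topology A) f"
      using f by (simp add: continuous_map_from_subtopology)
    have fc: "f y \<in> carrier A" if "y \<in> topspace Y" for y
      using pre.continuous_map_in_carrier[of Y f] f that by blast
    have "continuous_map ?S (cstar_topology A) (\<lambda>y. g y \<oplus> (-1) \<odot> f y)"
      by (intro pre.continuous_map_add_cstar g pre.continuous_map_smult_cstar fK) simp
    then have "continuous_map ?S (cstar_topology A) (\<lambda>y. g y \<ominus> f y)"
      by (rule continuous_map_eq) (use gc fc KY topS in \<open>auto simp: pre.minus_eq_smult subset_iff\<close>)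
    then obtain h where h: "continuous_map Y (cstar_topology A) h" 
        "\<And>y. y \<in> topspace Y \<Longrightarrow> cnorm A (h y) \<le> B / 2 ^ n"
        "\<And>y. y \<in> K \<Longrightarrow> cnorm A (h y \<ominus> (g y \<ominus> f y)) \<le> B / 2 ^ n / 2"
      using pre.approximate_extension[OF Y K, of "\<lambda>y. g y \<ominus> f y" "B / 2 ^ n"] f B(1) by auto
    have hc: "h y \<in> carrier A" if "y \<in> topspace Y" for y
      using pre.continuous_map_in_carrier[OF h(1) that] .
    show ?thesis
    proof (intro exI[of _ "\<lambda>y. f y \<oplus> h y"] conjI ballI)
      show "continuous_map Y (cstar_topology A) (\<lambda>y. f y \<oplus> h y)"
        using f h(1) by (intro pre.continuous_map_add_cstar) auto
      show "cnorm A (f y \<oplus> h y \<ominus> f y) \<le> B / 2 ^ n" if y: "y \<in> topspace Y" for y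
      proof -
        have "f y \<oplus> h y \<ominus> f y = h y"
          using fc[OF y] hc[OF y] by (simp add: a_minus_def a_comm[of "f y" "h y"] a_assoc r_neg)
        then show ?thesis using h(2)[OF y] by simp
      qed
      fix y assume y: "y \<in> K"
      then have yY: "y \<in> topspace Y" using KY by blast
      have "g y \<ominus> (f y \<oplus> h y) = (g y \<ominus> f y) \<ominus> h y"
        using gc[OF y] fc[OF yY] hc[OF yY] by (simp add: pre.minus_eq_smult pre.smult_add a_assoc)
      then have "cnorm A (g y \<ominus> (f y \<oplus> h y)) = cnorm A (h y \<ominus> (g y \<ominus> f y))"
        using pre.cnorm_minus_commute[OF minus_closed[OF gc[OF y] fc[OF yY]] hc[OF yY]] by (rule trans[OF arg_cong])
      also have "\<dots> \<le> B / 2 ^ n / 2"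
        by (rule h(3)[OF y])
      also have "\<dots> = B / 2 ^ Suc n"
        by (simp only: power_Suc divide_divide_eq_left mult.commute[of 2])
      finally show "cnorm A (g y \<ominus> (f y \<oplus> h y)) \<le> B / 2 ^ Suc n" .
    qed
  qed
  have "\<exists>f. \<forall>n. ?P n (f n) \<and> ?Q n (f n) (f (Suc n))"
    by (rule dependent_nat_choice[of ?P ?Q, OF base step])
  then obtain f where f: "\<And>n. ?P n (f n)" "\<And>n. ?Q n (f n) (f (Suc n))"
    by blast
  have fc: "f n y \<in> carrier A" if "y \<in> topspace Y" for n y
    using pre.continuous_map_in_carrier[of Y "f n"] f(1) that by blast
  \<comment> \<open>the bound telescopes: the steps of size \<open>B / 2\<^sup>n\<close> are the differences of \<open>2 B / 2\<^sup>n\<close>\<close>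
  have telescope: "cnorm A (f n y \<ominus> f m y) \<le> 2 * B / 2 ^ m - 2 * B / 2 ^ n" if "m \<le> n" and y: "y \<in> topspace Y" for m n y
    using \<open>m \<le> n\<close>
  proof (induction n rule: dec_induct)
    case base
    then show ?case using fc[OF y] by (simp add: pre.minus_eq_0_iff pre.cnorm_eq_0[THEN iffD2])
  next
    case (step n)
    have "cnorm A (f (Suc n) y \<ominus> f m y) \<le> cnorm A (f (Suc n) y \<ominus> f n y) + cnorm A (f n y \<ominus> f m y)"
      by (intro pre.cnorm_triangle fc y)
    also have "\<dots> \<le> B / 2 ^ n + (2 * B / 2 ^ m - 2 * B / 2 ^ n)"
      using f(2)[of n] y step.IH by (intro add_mono) auto
    finally show ?case by simp
  qed
  have small: "\<exists>N. \<forall>n\<ge>N. 2 * B / 2 ^ n < \<epsilon>" if "\<epsilon> > 0" for \<epsilon>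
  proof -
    have "(\<lambda>n. 2 * B * (1 / 2) ^ n) \<longlonglongrightarrow> 2 * B * 0"
      by (intro tendsto_intros LIMSEQ_power_zero) simp
    then have "\<forall>\<^sub>F n in sequentially. 2 * B * (1 / 2) ^ n < \<epsilon>"
      using that by (intro order_tendstoD(2)) auto
    then show ?thesis by (simp add: eventually_sequentially power_one_over)
  qed
  have Cauchy: "\<exists>N. \<forall>m n y. N \<le> m \<longrightarrow> N \<le> n \<longrightarrow> y \<in> topspace Y \<longrightarrow> cstar_dist A (f m y) (f n y) < \<epsilon>" if \<epsilon>: "\<epsilon> > 0" for \<epsilon>
  proof -
    obtain N where N: "\<forall>n\<ge>N. 2 * B / 2 ^ n < \<epsilon>" using small[OF \<epsilon>] by blast
    have le: "cstar_dist A (f m y) (f n y) < \<epsilon>" if "N \<le> m" "m \<le> n" "y \<in> topspace Y" for m n y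
    proof -
      have "cstar_dist A (f m y) (f n y) \<le> 2 * B / 2 ^ m - 2 * B / 2 ^ n"
        using telescope[OF that(2,3)] fc[OF that(3)] pre.cnorm_minus_commute[of "f m y" "f n y"]
        by (simp add: cstar_dist_def)
      also have "\<dots> \<le> 2 * B / 2 ^ m" using B by simp
      also have "\<dots> < \<epsilon>" using N that by blast
      finally show ?thesis .
    qed
    show ?thesis
      using le M.commute by (intro exI[of _ N] allI impI) (metis nat_le_linear)
  qed
  have "\<forall>\<^sub>F n in sequentially. continuous_map Y M.mtopology (f n)"
    using f(1) by (simp add: cstar_topology_def)
  then have "\<exists>h. continuous_map Y M.mtopology h \<and>
      (\<forall>\<epsilon>>0. \<forall>\<^sub>F n in sequentially. \<forall>y\<in>topspace Y. cstar_dist A (f n y) (h y) < \<epsilon>)"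
    by (rule M.continuous_map_uniformly_Cauchy_limit[OF complete _ Cauchy]) blast+
  then obtain h where h: "continuous_map Y M.mtopology h"
      "\<And>\<epsilon>. 0 < \<epsilon> \<Longrightarrow> \<forall>\<^sub>F n in sequentially. \<forall>y\<in>topspace Y. cstar_dist A (f n y) (h y) < \<epsilon>"
    by blast
  have hc: "h y \<in> carrier A" if "y \<in> topspace Y" for y
    using h(1) that by (auto simp: continuous_map_def)
  have "h y = g y" if y: "y \<in> K" for y
  proof -
    have yY: "y \<in> topspace Y" using y KY by blast
    have "cnorm A (h y \<ominus> g y) \<le> \<epsilon>" if \<epsilon>: "\<epsilon> > 0" for \<epsilon>
    proof -
      obtain N where N: "\<forall>n\<ge>N. 2 * B / 2 ^ n < \<epsilon> / 2" using small[of "\<epsilon> / 2"] \<epsilon> by auto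
      obtain N' where N': "\<forall>n\<ge>N'. cstar_dist A (f n y) (h y) < \<epsilon> / 2"
        using h(2)[OF half_gt_zero[OF \<epsilon>]] yY unfolding eventually_sequentially by blast
      define n where "n = max N N'"
      have fn: "cstar_dist A (f n y) (h y) < \<epsilon> / 2"
        using N' by (simp add: n_def)
      have "cnorm A (h y \<ominus> g y) \<le> cnorm A (h y \<ominus> f n y) + cnorm A (f n y \<ominus> g y)"
        by (intro pre.cnorm_triangle fc hc gc y yY)
      moreover have "cnorm A (h y \<ominus> f n y) < \<epsilon> / 2"
        using fn fc[OF yY, of n] hc[OF yY] pre.cnorm_minus_commute[of "h y" "f n y"]
        by (simp add: cstar_dist_def)
      moreover have "cnorm A (f n y \<ominus> g y) \<le> B / 2 ^ n"
        using f(1)[of n] y by (simp add: pre.cnorm_minus_commute[OF fc[OF yY] gc[OF y]])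
      moreover have "B / 2 ^ n \<le> 2 * B / 2 ^ n" using B(1) by (simp add: divide_right_mono)
      moreover have "2 * B / 2 ^ n < \<epsilon> / 2" using N by (simp add: n_def)
      ultimately show ?thesis by linarith
    qed
    then have "cnorm A (h y \<ominus> g y) \<le> 0"
      by (rule field_le_epsilon) simp
    then have "cnorm A (h y \<ominus> g y) = 0"
      using hc[OF yY] gc[OF y] by (intro antisym) auto
    then show ?thesis
      using hc[OF yY] gc[OF y] by (simp add: pre.cnorm_eq_0 pre.minus_eq_0_iff)
  qed
  then show thesis
    using that[of h] h(1) by (simp add: cstar_topology_def)
qed


section \<open>Quotients by ideals\<close>

text \<open>A *-ideal of an algebra that may lack a unit.\<close>

locale star_ideal = pre_cstar_algebra +
  fixes I
  assumes subset_carrier: "I \<subseteq> carrier A"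
    and zero_in: "\<zero> \<in> I"
    and add_in: "x \<in> I \<Longrightarrow> y \<in> I \<Longrightarrow> x \<oplus> y \<in> I"
    and smult_in: "x \<in> I \<Longrightarrow> c \<odot> x \<in> I"
    and mult_left_in: "x \<in> carrier A \<Longrightarrow> y \<in> I \<Longrightarrow> x \<otimes> y \<in> I"
    and mult_right_in: "x \<in> I \<Longrightarrow> y \<in> carrier A \<Longrightarrow> x \<otimes> y \<in> I"
    and adj_in: "x \<in> I \<Longrightarrow> adj A x \<in> I"
begin

lemma abelian_subgroup_ideal: "abelian_subgroup I A"
proof (rule abelian_subgroupI3)
  have "\<ominus> x \<in> I" if "x \<in> I" for x
    using that subset_carrier smult_in[of x "-1"] by (auto simp: uminus_eq_smult subset_iff)
  then show "additive_subgroup I A"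
    using subset_carrier zero_in add_in
    by (intro additive_subgroup.intro) (auto intro!: group.subgroupI simp: a_group a_inv_def)
qed (rule abelian_group_axioms)

lemma coset_eq_iff:
  assumes "x \<in> carrier A" "y \<in> carrier A"
  shows "I +> x = I +> y \<longleftrightarrow> x \<ominus> y \<in> I"
proof -
  interpret abelian_subgroup I A by (rule abelian_subgroup_ideal)
  have "x \<in> I +> y \<longleftrightarrow> x \<ominus> y \<in> I"
    using assms by (simp add: a_rcos_module minus_eq)
  then show ?thesis
    using assms a_rcos_self[of x] a_repr_independence[of x I y] a_subgroup by auto
qed

lemma coset_self: "x \<in> carrier A \<Longrightarrow> x \<in> I +> x"
  using abelian_subgroup.a_rcos_self[OF abelian_subgroup_ideal] .

lemma in_coset_iff:
  assumes "y \<in> carrier A"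
  shows "x \<in> I +> y \<longleftrightarrow> x \<in> carrier A \<and> x \<ominus> y \<in> I"
proof -
  interpret abelian_subgroup I A by (rule abelian_subgroup_ideal)
  show ?thesis
    using assms a_rcos_module[OF assms] a_r_coset_subset_G[OF subset_carrier assms] by (auto simp: minus_eq)
qed

text \<open>The operations of the quotient are unions over all representatives; each union is one coset
  as soon as the representatives agree.\<close>

lemma UN_constant_coset:
  assumes x: "x \<in> carrier A" and "\<And>a. a \<in> carrier A \<Longrightarrow> a \<ominus> x \<in> I \<Longrightarrow> f a = C"
  shows "(\<Union>a\<in>I +> x. f a) = C"
  using assms coset_self[OF x] by (auto simp: in_coset_iff[OF x])

lemma star_hom_quotient: "star_hom A (cstar_quotient A I) (\<lambda>x. I +> x)"
  unfolding star_hom_def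
proof (intro conjI ballI allI)
  interpret sub: abelian_subgroup I A by (rule abelian_subgroup_ideal)
  show "(+>) I \<in> carrier A \<rightarrow> carrier (cstar_quotient A I)"
    by (auto simp: cstar_quotient_def FactRing_def A_RCOSETS_def')
  fix x assume x: "x \<in> carrier A"
  show "I +> (c \<odot> x) = c \<odot>\<^bsub>cstar_quotient A I\<^esub> (I +> x)" for c
    unfolding cstar_quotient_def
    by (simp, rule UN_constant_coset[OF x, symmetric]) (use x in \<open>auto simp: coset_eq_iff smult_minus smult_in\<close>)
  show "I +> adj A x = adj (cstar_quotient A I) (I +> x)"
    unfolding cstar_quotient_def
    by (simp, rule UN_constant_coset[OF x, symmetric]) (use x in \<open>auto simp: coset_eq_iff adj_minus adj_in\<close>)
  fix y assume y: "y \<in> carrier A"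
  show "I +> (x \<oplus> y) = (I +> x) \<oplus>\<^bsub>cstar_quotient A I\<^esub> (I +> y)"
    using x y by (simp add: cstar_quotient_def FactRing_def sub.a_rcos_sum)
  have "I +> (a \<otimes> b) = I +> (x \<otimes> y)" 
    if "a \<in> carrier A" "a \<ominus> x \<in> I" "b \<in> carrier A" "b \<ominus> y \<in> I" for a b
    using that x y by (simp add: coset_eq_iff mult_minus_mult add_in mult_left_in mult_right_in)
  then have "(\<Union>a\<in>I +> x. \<Union>b\<in>I +> y. I +> (a \<otimes> b)) = I +> (x \<otimes> y)"
    using x y by (intro UN_constant_coset) auto
  then show "I +> (x \<otimes> y) = (I +> x) \<otimes>\<^bsub>cstar_quotient A I\<^esub> (I +> y)"
    by (simp add: cstar_quotient_def FactRing_def rcoset_mult_def)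
qed

end

lemma star_ideal_C0:
  fixes B :: "'b cstar_alg"
  assumes coarse: "\<And>S :: 'x::metric_space set. bounded S \<Longrightarrow> compact (closure S)"
    and B: "pre_cstar_algebra B"
  shows "star_ideal (vv_algebra B :: ('x \<Rightarrow> 'b) cstar_alg) (C0_functions B)"
proof -
  interpret B: pre_cstar_algebra B by fact
  let ?V = "vv_algebra B :: ('x \<Rightarrow> 'b) cstar_alg"
  interpret V: pre_cstar_algebra ?V by (rule B.pre_cstar_algebra_vv)
  have vv: "f \<in> carrier ?V" if "f \<in> C0_functions B" for f
    by (rule C0_subset_vv[OF coarse B that])
  have cont: "continuous_map euclidean (cstar_topology B) f" if "f \<in> carrier ?V" for f
    using that by (simp add: carrier_vv_algebra)
  have c: "f x \<in> carrier B" if "f \<in> carrier ?V" for f x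
    by (rule B.in_carrier_if_continuous[OF cont[OF that]])
  have mult: "(\<lambda>x. f x \<otimes>\<^bsub>B\<^esub> g x) \<in> C0_functions B \<and> (\<lambda>x. g x \<otimes>\<^bsub>B\<^esub> f x) \<in> C0_functions B"
    if f: "f \<in> C0_functions B" and g: "g \<in> carrier ?V" for f g
  proof -
    obtain C where C: "\<And>x. cnorm B (g x) \<le> C"
      using g by (auto simp: carrier_vv_algebra)
    have C0: "C \<ge> 0" using C[of undefined] B.cnorm_nonneg[OF c[OF g], of undefined] by linarith
    have "cnorm B (f x \<otimes>\<^bsub>B\<^esub> g x) \<le> (C + 1) * (cnorm B (f x) + cnorm B (f x))" 
      "cnorm B (g x \<otimes>\<^bsub>B\<^esub> f x) \<le> (C + 1) * (cnorm B (f x) + cnorm B (f x))" for x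
    proof -
      have "cnorm B (f x) * cnorm B (g x) \<le> (2 * cnorm B (f x)) * (C + 1)"
        using C[of x] C0 c[OF vv[OF f], of x] c[OF g, of x] by (intro mult_mono) auto
      then show "cnorm B (f x \<otimes>\<^bsub>B\<^esub> g x) \<le> (C + 1) * (cnorm B (f x) + cnorm B (f x))" 
        "cnorm B (g x \<otimes>\<^bsub>B\<^esub> f x) \<le> (C + 1) * (cnorm B (f x) + cnorm B (f x))"
        using B.cnorm_mult[OF c[OF vv[OF f]] c[OF g], of x x] B.cnorm_mult[OF c[OF g] c[OF vv[OF f]], of x x]
        by (auto simp: algebra_simps)
    qed
    then show ?thesis
      using C0 cont[OF g] cont[OF vv[OF f]]
      by (auto intro!: C0_by_domination[OF _ f f, of _ "C + 1"] B.continuous_map_mult_cstar)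
  qed
  show ?thesis
  proof
    show "\<zero>\<^bsub>?V\<^esub> \<in> C0_functions B"
      by (simp add: C0_functions_def)
    fix f :: "'x \<Rightarrow> 'b" assume f: "f \<in> C0_functions B"
    show "c \<odot>\<^bsub>?V\<^esub> f \<in> C0_functions B" for c
      using c[OF vv[OF f]] cont[OF vv[OF f]]
      by (auto intro!: C0_by_domination[OF _ f f, of _ "cmod c + 1"] B.continuous_map_smult_cstar
        simp: B.cnorm_smult algebra_simps intro: add_nonneg_pos)
    show "adj ?V f \<in> C0_functions B"
      using c[OF vv[OF f]] cont[OF vv[OF f]]
      by (auto intro!: C0_by_domination[OF _ f f, of _ 1] B.continuous_map_adj_cstar)
    show "f \<oplus>\<^bsub>?V\<^esub> g \<in> C0_functions B" if g: "g \<in> C0_functions B" for g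
      using c[OF vv[OF f]] cont[OF vv[OF f]] c[OF vv[OF g]] cont[OF vv[OF g]]
      by (auto intro!: C0_by_domination[OF _ f g, of _ 1] B.continuous_map_add_cstar B.cnorm_add)
    show "f \<otimes>\<^bsub>?V\<^esub> g \<in> C0_functions B" "g \<otimes>\<^bsub>?V\<^esub> f \<in> C0_functions B" if "g \<in> carrier ?V" for g
      using mult[OF f that] by simp_all
  qed (use vv in auto)
qed


section \<open>The canonical homomorphisms\<close>

lemma star_hom_comp: "star_hom A B \<phi> \<Longrightarrow> star_hom B C \<psi> \<Longrightarrow> star_hom A C (\<lambda>x. \<psi> (\<phi> x))"
  by (simp add: star_hom_def Pi_iff)

lemma cont_algebra_simps [simp]:
  "f \<otimes>\<^bsub>cont_algebra Y B\<^esub> g = (\<lambda>y\<in>topspace Y. f y \<otimes>\<^bsub>B\<^esub> g y)"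
  "f \<oplus>\<^bsub>cont_algebra Y B\<^esub> g = (\<lambda>y\<in>topspace Y. f y \<oplus>\<^bsub>B\<^esub> g y)"
  "\<zero>\<^bsub>cont_algebra Y B\<^esub> = (\<lambda>y\<in>topspace Y. \<zero>\<^bsub>B\<^esub>)"
  "c \<odot>\<^bsub>cont_algebra Y B\<^esub> f = (\<lambda>y\<in>topspace Y. c \<odot>\<^bsub>B\<^esub> f y)"
  "adj (cont_algebra Y B) f = (\<lambda>y\<in>topspace Y. adj B (f y))"
  by (simp_all add: cont_algebra_def)

lemma pullback_apply [simp]: "y \<in> topspace Y \<Longrightarrow> pullback Y \<pi> f y = f (\<pi> y)"
  by (simp add: pullback_def compose_def)

lemma pullback_extensional [simp]: "pullback Y \<pi> f \<in> extensional (topspace Y)"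
  by (simp add: pullback_def compose_def)

lemma pullback_in_cont_algebra:
  assumes \<pi>: "continuous_map Y Z \<pi>" and f: "f \<in> carrier (cont_algebra Z B)"
  shows "pullback Y \<pi> f \<in> carrier (cont_algebra Y B)"
proof -
  have "continuous_map Y (cstar_topology B) (f \<circ> \<pi>)"
    using \<pi> f by (auto simp: carrier_cont_algebra intro: continuous_map_compose)
  then show ?thesis
    unfolding carrier_cont_algebra by (auto elim!: continuous_map_eq)
qed

lemma injective_star_hom_pullback:
  assumes \<pi>: "continuous_map Y Z \<pi>" and onto: "\<pi> ` topspace Y = topspace Z"
  shows "injective_star_hom (cont_algebra Z B) (cont_algebra Y B) (pullback Y \<pi>)"
proof -
  have \<pi>Z: "\<pi> y \<in> topspace Z" if "y \<in> topspace Y" for y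
    using onto that by blast
  have "star_hom (cont_algebra Z B) (cont_algebra Y B) (pullback Y \<pi>)"
    unfolding star_hom_def
  proof (intro conjI ballI allI)
    show "pullback Y \<pi> \<in> carrier (cont_algebra Z B) \<rightarrow> carrier (cont_algebra Y B)"
      by (intro funcsetI pullback_in_cont_algebra[OF \<pi>])
  qed ((rule extensionalityI[of _ "topspace Y"]; simp add: \<pi>Z)+)
  moreover have "inj_on (pullback Y \<pi>) (carrier (cont_algebra Z B))"
  proof (rule inj_onI)
    fix f g assume fg: "f \<in> carrier (cont_algebra Z B)" "g \<in> carrier (cont_algebra Z B)"
      and eq: "pullback Y \<pi> f = pullback Y \<pi> g"
    have "f z = g z" if z: "z \<in> topspace Z" for z
    proof -
      obtain y where y: "y \<in> topspace Y" "z = \<pi> y" using onto z by blast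
      then show ?thesis using fun_cong[OF eq, of y] by simp
    qed
    then show "f = g"
      using fg by (intro extensionalityI[of f "topspace Z" g]) (auto simp: carrier_cont_algebra)
  qed
  ultimately show ?thesis by (simp add: injective_star_hom_def)
qed

lemma cnorm_pullback_le:
  assumes B: "pre_cstar_algebra B" and Z: "compact_space Z" 
    and \<pi>: "continuous_map Y Z \<pi>" and f: "f \<in> carrier (cont_algebra Z B)"
  shows "cnorm (cont_algebra Y B) (pullback Y \<pi> f) \<le> cnorm (cont_algebra Z B) f"
proof -
  have "\<pi> y \<in> topspace Z" if "y \<in> topspace Y" for y
    using \<pi> that by (auto simp: continuous_map_def)
  moreover have "0 \<le> cnorm (cont_algebra Z B) f"
    using pre_cstar_algebra.cnorm_nonneg[OF pre_cstar_algebra_cont_algebra[OF B Z] f] .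
  ultimately show ?thesis
    using bounded_norm_cont_algebra[OF B Z f]
    unfolding cont_algebra_def[of Y] by (intro cnorm_pointwise_le) auto
qed

text \<open>Corona points go to the remainder, so \<open>\<pi>\<close> restricts.\<close>

lemma continuous_map_remainder:
  fixes i :: "'x::metric_space \<Rightarrow> 'z"
  assumes coarse: "\<And>S :: 'x set. bounded S \<Longrightarrow> compact (closure S)"
    and Z: "compactification Z i" and \<pi>: "is_higson_extension Z i \<pi>"
  shows "continuous_map higson_corona (remainder Z i) \<pi>"
proof -
  have "continuous_map higson_corona Z \<pi>"
    using \<pi> by (auto simp: is_higson_extension_def higson_corona_def remainder_def continuous_map_from_subtopology)
  moreover have "\<pi> \<in> topspace higson_corona \<rightarrow> topspace Z - range i"
    using higson_extension_preserves_remainder[OF coarse Z \<pi>] by (auto simp: topspace_remainder)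
  ultimately show ?thesis
    unfolding remainder_def[of Z] by (auto simp: continuous_map_in_subtopology)
qed

lemma restrict_to_space_in_vv:
  fixes f :: "(('x::metric_space \<Rightarrow> complex) \<Rightarrow> complex) \<Rightarrow> 'b"
  assumes B: "pre_cstar_algebra B" and f: "f \<in> carrier (cont_algebra higson_compactification B)"
  shows "restrict_to_space f \<in> carrier (vv_algebra B)"
proof -
  have cont: "continuous_map higson_compactification (cstar_topology B) f"
    using f by (simp add: carrier_cont_algebra)
  have "continuous_map euclidean (cstar_topology B) (f \<circ> higson_embedding)"
    by (rule continuous_map_compose[OF continuous_map_higson_embedding cont])
  moreover have "vanishing_variation (cstar_dist B) (\<lambda>x. f (higson_embedding x))"
    by (rule vanishing_variation_if_continuous[OF pre_cstar_algebra.Metric_space_cstar_dist[OF B]])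
      (use cont in \<open>simp add: cstar_topology_def\<close>)
  moreover obtain C where "\<forall>\<omega>\<in>topspace higson_compactification. cnorm B (f \<omega>) \<le> C"
    using bounded_cont_algebra[OF B compact_higson_compactification cont] by blast
  ultimately show ?thesis
    by (auto simp: carrier_vv_algebra restrict_to_space_def o_def intro!: exI[of _ C])
qed

lemma injective_star_hom_restrict_to_space:
  assumes B: "pre_cstar_algebra B"
  shows "injective_star_hom (cont_algebra higson_compactification B)
    (vv_algebra B :: ('x::metric_space \<Rightarrow> 'b) cstar_alg) restrict_to_space"
proof -
  have "star_hom (cont_algebra higson_compactification B)
    (vv_algebra B :: ('x \<Rightarrow> 'b) cstar_alg) restrict_to_space"
    unfolding star_hom_def using restrict_to_space_in_vv[OF B] by (auto simp: restrict_to_space_def)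
  moreover have "inj_on restrict_to_space (carrier (cont_algebra 
    (higson_compactification :: (('x \<Rightarrow> complex) \<Rightarrow> complex) topology) B))"
  proof (rule inj_onI)
    fix f g :: "(('x \<Rightarrow> complex) \<Rightarrow> complex) \<Rightarrow> 'b"
    assume f: "f \<in> carrier (cont_algebra higson_compactification B)"
      and g: "g \<in> carrier (cont_algebra higson_compactification B)"
      and eq: "restrict_to_space f = restrict_to_space g"
    have "f \<omega> = g \<omega>" if "\<omega> \<in> topspace higson_compactification" for \<omega>
      by (rule eq_on_higson_compactification[OF pre_cstar_algebra.Hausdorff_cstar_topology[OF B], of f g])
        (use f g fun_cong[OF eq] that in \<open>auto simp: carrier_cont_algebra restrict_to_space_def\<close>)
    then show "f = g"
      using f g by (intro extensionalityI[of f "topspace higson_compactification" g]) (auto simp: carrier_cont_algebra)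
  qed
  ultimately show ?thesis by (simp add: injective_star_hom_def)
qed

lemma higson_corona_eq_subtopology:
  "higson_corona = subtopology higson_compactification (topspace higson_corona)"
  by (simp add: topspace_higson_corona) (simp add: higson_corona_def remainder_def)

lemma corona_function_extends:
  fixes g :: "(('x::metric_space \<Rightarrow> complex) \<Rightarrow> complex) \<Rightarrow> 'b"
  assumes coarse: "\<And>S :: 'x set. bounded S \<Longrightarrow> compact (closure S)"
    and B: "cstar_algebra B" and g: "g \<in> carrier (cont_algebra higson_corona B)"
  obtains f where "f \<in> carrier (cont_algebra higson_compactification B)" 
    "restrict f (topspace higson_corona) = g"
proof -
  have "continuous_map (subtopology higson_compactification (topspace higson_corona)) (cstar_topology B) g"
    using g unfolding carrier_cont_algebra higson_corona_eq_subtopology[symmetric] by blast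
  from cstar_algebra.Tietze_extension_cstar[OF B compact_higson_compactification 
      Hausdorff_higson_compactification closedin_corona[OF coarse] this]
  obtain h where h: "continuous_map higson_compactification (cstar_topology B) h"
      "\<And>\<omega>. \<omega> \<in> topspace higson_corona \<Longrightarrow> h \<omega> = g \<omega>"
    by (metis (no_types))
  show thesis
  proof
    show "restrict h (topspace higson_compactification) \<in> carrier (cont_algebra higson_compactification B)"
      by (rule restrict_in_cont_algebra[OF h(1)])
    show "restrict (restrict h (topspace higson_compactification)) (topspace higson_corona) = g"
      using g h(2)
      by (intro extensionalityI[of _ "topspace higson_corona"]) (auto simp: carrier_cont_algebra topspace_higson_corona)
  qed
qed

text \<open>By \<open>vanishes_on_corona_iff\<close>, two functions on \<open>\<eta>X\<close> have the same class modulo \<open>C\<^sub>0\<close> if and only if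
  they agree on the corona. One direction says that the class of an extension depends on \<open>g\<close> only,
  the other is injectivity; the algebraic identities are inherited from \<open>\<eta>X\<close>, as sums and products of
  extensions are extensions.\<close>

lemma injective_star_hom_corona_map:
  fixes B :: "'b cstar_alg"
  assumes coarse: "\<And>S :: 'x::metric_space set. bounded S \<Longrightarrow> compact (closure S)"
    and B: "cstar_algebra B"
  shows "injective_star_hom (cont_algebra higson_corona B)
    (stable_higson_corona B :: ('x \<Rightarrow> 'b) set cstar_alg) (corona_map B)"
proof -
  interpret B: pre_cstar_algebra B
    by (rule cstar_algebra_imp_pre_cstar_algebra[OF B])
  let ?V = "vv_algebra B :: ('x \<Rightarrow> 'b) cstar_alg"
  let ?Y = "higson_compactification :: (('x \<Rightarrow> complex) \<Rightarrow> complex) topology"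
  let ?dX = "higson_corona :: (('x \<Rightarrow> complex) \<Rightarrow> complex) topology"
  let ?I = "C0_functions B :: ('x \<Rightarrow> 'b) set"
  let ?E = "\<lambda>g. {f \<in> carrier (cont_algebra ?Y B). restrict f (topspace ?dX) = g}"
  let ?Q = "\<lambda>f. ?I +>\<^bsub>?V\<^esub> restrict_to_space f"
  interpret I: star_ideal ?V ?I
    by (rule star_ideal_C0[OF coarse B.pre_cstar_algebra_axioms])
  interpret Y: pre_cstar_algebra "cont_algebra ?Y B"
    by (rule pre_cstar_algebra_cont_algebra[OF B.pre_cstar_algebra_axioms compact_higson_compactification])
  have hom: "star_hom (cont_algebra ?Y B) ?V restrict_to_space"
    by (rule injective_star_hom_restrict_to_space[OF B.pre_cstar_algebra_axioms, 
        unfolded injective_star_hom_def, THEN conjunct1])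
  have V: "restrict_to_space f \<in> carrier ?V" if "f \<in> carrier (cont_algebra ?Y B)" for f
    using hom that by (auto simp: star_hom_def)
  have vals: "f \<omega> \<in> carrier B" if "f \<in> carrier (cont_algebra ?Y B)" "\<omega> \<in> topspace ?Y" for f \<omega>
    using that B.continuous_map_in_carrier[of ?Y f] by (simp add: carrier_cont_algebra)
  have Q_eq: "?Q f = ?Q f' \<longleftrightarrow> restrict f (topspace ?dX) = restrict f' (topspace ?dX)"
    if f: "f \<in> carrier (cont_algebra ?Y B)" and f': "f' \<in> carrier (cont_algebra ?Y B)" for f f'
  proof -
    let ?d = "\<lambda>\<omega>. f \<omega> \<ominus>\<^bsub>B\<^esub> f' \<omega>"
    have cont: "continuous_map ?Y (cstar_topology B) f" "continuous_map ?Y (cstar_topology B) f'"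
      using f f' by (simp_all add: carrier_cont_algebra)
    have "continuous_map ?Y (cstar_topology B) (\<lambda>\<omega>. f \<omega> \<oplus>\<^bsub>B\<^esub> (-1) \<odot>\<^bsub>B\<^esub> f' \<omega>)"
      by (intro B.continuous_map_add_cstar B.continuous_map_smult_cstar cont) simp
    then have d: "continuous_map ?Y (cstar_topology B) ?d"
      by (rule continuous_map_eq) (simp add: B.minus_eq_smult vals f f')
    have "restrict_to_space f \<ominus>\<^bsub>?V\<^esub> restrict_to_space f' = (\<lambda>x. ?d (higson_embedding x))"
      using V[OF f] V[OF f'] vals[OF f] vals[OF f']
      by (simp add: I.minus_eq_smult B.minus_eq_smult restrict_to_space_def)
    then have "?Q f = ?Q f' \<longleftrightarrow> (\<lambda>x. ?d (higson_embedding x)) \<in> ?I"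
      using V[OF f] V[OF f'] by (simp add: I.coset_eq_iff)
    also have "\<dots> \<longleftrightarrow> (\<forall>\<omega>\<in>topspace ?dX. ?d \<omega> = \<zero>\<^bsub>B\<^esub>)"
      by (rule vanishes_on_corona_iff[OF coarse B.pre_cstar_algebra_axioms d, symmetric])
    also have "\<dots> \<longleftrightarrow> (\<forall>\<omega>\<in>topspace ?dX. f \<omega> = f' \<omega>)"
      using vals[OF f] vals[OF f'] by (auto simp: topspace_higson_corona B.minus_eq_0_iff)
    also have "\<dots> \<longleftrightarrow> restrict f (topspace ?dX) = restrict f' (topspace ?dX)"
      by (auto simp: fun_eq_iff)
    finally show ?thesis .
  qed
  have corona: "corona_map B g = ?Q f" if f: "f \<in> ?E g" for f g
  proof -
    have "?Q f' = ?Q f" if "f' \<in> ?E g" for f'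
      using Q_eq[of f' f] f that by auto
    then have "(\<Union>f'\<in>?E g. ?Q f') = ?Q f"
      using f by blast
    then show ?thesis
      by (simp add: corona_map_def)
  qed
  have ex: "\<exists>f. f \<in> ?E g" if g: "g \<in> carrier (cont_algebra ?dX B)" for g
    by (rule corona_function_extends[OF coarse B g]) blast+
  have Qhom: "star_hom (cont_algebra ?Y B) (cstar_quotient ?V ?I) ?Q"
    by (rule star_hom_comp[OF hom I.star_hom_quotient])
  have sub: "\<omega> \<in> topspace ?Y" if "\<omega> \<in> topspace ?dX" for \<omega>
    using that by (simp add: topspace_higson_corona)
  have "star_hom (cont_algebra ?dX B) (cstar_quotient ?V ?I) (corona_map B)"
    unfolding star_hom_def
  proof (intro conjI ballI allI)
    show "corona_map B \<in> carrier (cont_algebra ?dX B) \<rightarrow> carrier (cstar_quotient ?V ?I)"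
    proof
      fix g assume "g \<in> carrier (cont_algebra ?dX B)"
      then obtain f where f: "f \<in> ?E g" using ex by blast
      then show "corona_map B g \<in> carrier (cstar_quotient ?V ?I)"
        using Qhom unfolding corona[OF f] by (auto simp: star_hom_def)
    qed
    fix g assume "g \<in> carrier (cont_algebra ?dX B)"
    then obtain f where f: "f \<in> ?E g" using ex by blast
    then have fY: "f \<in> carrier (cont_algebra ?Y B)" and g: "g = restrict f (topspace ?dX)" by auto
    show "corona_map B (c \<odot>\<^bsub>cont_algebra ?dX B\<^esub> g) = c \<odot>\<^bsub>cstar_quotient ?V ?I\<^esub> corona_map B g" for c
    proof -
      have m: "c \<odot>\<^bsub>cont_algebra ?Y B\<^esub> f \<in> ?E (c \<odot>\<^bsub>cont_algebra ?dX B\<^esub> g)"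
        using Y.smult_closed'[OF fY, of c] sub by (auto simp: g)
      show ?thesis
        unfolding corona[OF m] corona[OF f] using Qhom fY by (simp only: star_hom_def)
    qed
    show "corona_map B (adj (cont_algebra ?dX B) g) = adj (cstar_quotient ?V ?I) (corona_map B g)"
    proof -
      have m: "adj (cont_algebra ?Y B) f \<in> ?E (adj (cont_algebra ?dX B) g)"
        using Y.adj_closed[OF fY] sub by (auto simp: g)
      show ?thesis
        unfolding corona[OF m] corona[OF f] using Qhom fY by (simp only: star_hom_def)
    qed
    fix g' assume "g' \<in> carrier (cont_algebra ?dX B)"
    then obtain f' where f': "f' \<in> ?E g'" using ex by blast
    then have fY': "f' \<in> carrier (cont_algebra ?Y B)" and g': "g' = restrict f' (topspace ?dX)" by auto
    show "corona_map B (g \<oplus>\<^bsub>cont_algebra ?dX B\<^esub> g') = corona_map B g \<oplus>\<^bsub>cstar_quotient ?V ?I\<^esub> corona_map B g'"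
    proof -
      have m: "f \<oplus>\<^bsub>cont_algebra ?Y B\<^esub> f' \<in> ?E (g \<oplus>\<^bsub>cont_algebra ?dX B\<^esub> g')"
        using Y.a_closed[OF fY fY'] sub by (auto simp: g g')
      show ?thesis
        unfolding corona[OF m] corona[OF f] corona[OF f'] using Qhom fY fY' by (simp only: star_hom_def)
    qed
    show "corona_map B (g \<otimes>\<^bsub>cont_algebra ?dX B\<^esub> g') = corona_map B g \<otimes>\<^bsub>cstar_quotient ?V ?I\<^esub> corona_map B g'"
    proof -
      have m: "f \<otimes>\<^bsub>cont_algebra ?Y B\<^esub> f' \<in> ?E (g \<otimes>\<^bsub>cont_algebra ?dX B\<^esub> g')"
        using Y.mult_closed[OF fY fY'] sub by (auto simp: g g')
      show ?thesis
        unfolding corona[OF m] corona[OF f] corona[OF f'] using Qhom fY fY' by (simp only: star_hom_def)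
    qed
  qed
  moreover have "inj_on (corona_map B) (carrier (cont_algebra ?dX B))"
  proof (rule inj_onI)
    fix g g' assume g: "g \<in> carrier (cont_algebra ?dX B)" and g': "g' \<in> carrier (cont_algebra ?dX B)"
      and eq: "corona_map B g = corona_map B g'"
    obtain f where f: "f \<in> ?E g" using ex[OF g] by blast
    obtain f' where f': "f' \<in> ?E g'" using ex[OF g'] by blast
    have "?Q f = ?Q f'"
      using eq unfolding corona[OF f] corona[OF f'] .
    then show "g = g'"
      using Q_eq[of f f'] f f' by auto
  qed
  ultimately show ?thesis
    by (simp add: injective_star_hom_def stable_higson_corona_def)
qed


section \<open>Matrices over a ring with involution\<close>

text \<open>The algebraic structure on which projections, unitaries and Murray-von Neumann equivalence depend.\<close>

locale star_ring = ring U for U :: "'u cstar_alg" (structure) +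
  assumes adj_closed [simp]: "x \<in> carrier U \<Longrightarrow> adj U x \<in> carrier U"
    and adj_adj [simp]: "x \<in> carrier U \<Longrightarrow> adj U (adj U x) = x"
    and adj_add: "x \<in> carrier U \<Longrightarrow> y \<in> carrier U \<Longrightarrow> adj U (x \<oplus> y) = adj U x \<oplus> adj U y"
    and adj_mult: "x \<in> carrier U \<Longrightarrow> y \<in> carrier U \<Longrightarrow> adj U (x \<otimes> y) = adj U y \<otimes> adj U x"

lemma (in abelian_monoid) finsum_swap:
  assumes "finite S" "finite T" and f: "\<And>s t. s \<in> S \<Longrightarrow> t \<in> T \<Longrightarrow> f s t \<in> carrier G"
  shows "(\<Oplus>s\<in>S. \<Oplus>t\<in>T. f s t) = (\<Oplus>t\<in>T. \<Oplus>s\<in>S. f s t)"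
  using assms(1) f
proof (induction S rule: finite_induct)
  case empty
  then show ?case by (simp add: finsum_zero)
next
  case (insert s S)
  have "(\<Oplus>t\<in>T. \<Oplus>s'\<in>insert s S. f s' t) = (\<Oplus>t\<in>T. f s t \<oplus> (\<Oplus>s'\<in>S. f s' t))"
    using insert.hyps insert.prems by (intro finsum_cong') (auto simp: finsum_insert Pi_iff finsum_closed)
  then show ?case
    using insert \<open>finite T\<close> by (simp add: finsum_insert Pi_iff finsum_closed finsum_addf)
qed

lemma (in abelian_monoid) finsum_split:
  fixes k k' :: nat
  assumes "\<And>l. l < k + k' \<Longrightarrow> f l \<in> carrier G"
  shows "(\<Oplus>l\<in>{..<k + k'}. f l) = (\<Oplus>l\<in>{..<k}. f l) \<oplus> (\<Oplus>l\<in>{..<k'}. f (k + l))"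
  using assms
proof (induction k')
  case 0
  then show ?case by (simp add: finsum_closed Pi_iff)
next
  case (Suc k')
  have "(\<Oplus>l\<in>{..<k + Suc k'}. f l) = f (k + k') \<oplus> (\<Oplus>l\<in>{..<k + k'}. f l)"
    using Suc.prems by (simp add: lessThan_Suc finsum_insert Pi_iff)
  also have "\<dots> = f (k + k') \<oplus> ((\<Oplus>l\<in>{..<k}. f l) \<oplus> (\<Oplus>l\<in>{..<k'}. f (k + l)))"
    using Suc by simp
  also have "\<dots> = (\<Oplus>l\<in>{..<k}. f l) \<oplus> (f (k + k') \<oplus> (\<Oplus>l\<in>{..<k'}. f (k + l)))"
    using Suc.prems by (simp add: a_lcomm finsum_closed Pi_iff)
  also have "\<dots> = (\<Oplus>l\<in>{..<k}. f l) \<oplus> (\<Oplus>l\<in>{..<Suc k'}. f (k + l))"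
    using Suc.prems by (simp add: lessThan_Suc finsum_insert Pi_iff)
  finally show ?case .
qed

text \<open>The matrices \<open>(a 0; 0 b)\<close> and \<open>(0 a; b 0)\<close>, where \<open>a\<close> has \<open>m\<close> rows and the first column of
  blocks has width \<open>n\<close>.\<close>

definition block_diagonal ::
  "'u cstar_alg \<Rightarrow> nat \<Rightarrow> nat \<Rightarrow> (nat \<Rightarrow> nat \<Rightarrow> 'u) \<Rightarrow> (nat \<Rightarrow> nat \<Rightarrow> 'u) \<Rightarrow> nat \<Rightarrow> nat \<Rightarrow> 'u" where
  "block_diagonal U m n a b = (\<lambda>i j. if i < m \<and> j < n then a i j
     else if m \<le> i \<and> n \<le> j then b (i - m) (j - n) else \<zero>\<^bsub>U\<^esub>)"

definition block_antidiagonal ::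
  "'u cstar_alg \<Rightarrow> nat \<Rightarrow> nat \<Rightarrow> (nat \<Rightarrow> nat \<Rightarrow> 'u) \<Rightarrow> (nat \<Rightarrow> nat \<Rightarrow> 'u) \<Rightarrow> nat \<Rightarrow> nat \<Rightarrow> 'u" where
  "block_antidiagonal U m n a b = (\<lambda>i j. if i < m \<and> n \<le> j then a i (j - n)
     else if m \<le> i \<and> j < n then b (i - m) j else \<zero>\<^bsub>U\<^esub>)"

lemma direct_sum_eq: "direct_sum U (n, p) (m, q) = (n + m, block_diagonal U n n p q)"
  by (simp add: direct_sum_def block_diagonal_def)

lemma direct_sum_assoc:
  "direct_sum U (direct_sum U p q) r = direct_sum U p (direct_sum U q r)"
  by (cases p; cases q; cases r) (auto simp: direct_sum_def fun_eq_iff)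

context star_ring
begin

lemma adj_zero [simp]: "adj U \<zero> = \<zero>"
  using adj_add[of \<zero> \<zero>] add.l_cancel_one'[of "adj U \<zero>" "adj U \<zero>"] by simp

lemma adj_one [simp]: "adj U \<one> = \<one>"
  using adj_mult[of "adj U \<one>" \<one>] by simp

lemma adj_finsum:
  assumes "finite S" "\<And>s. s \<in> S \<Longrightarrow> f s \<in> carrier U"
  shows "adj U (\<Oplus>s\<in>S. f s) = (\<Oplus>s\<in>S. adj U (f s))"
  using assms by (induction S rule: finite_induct) (auto simp: finsum_insert Pi_iff adj_add finsum_closed)

lemma matricesI: 
  "(\<And>i j. a i j \<in> carrier U) \<Longrightarrow> (\<And>i j. m \<le> i \<or> n \<le> j \<Longrightarrow> a i j = \<zero>) \<Longrightarrow> a \<in> matrices U m n"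
  by (auto simp: matrices_def not_less)

lemma matrices_zero: "a \<in> matrices U m n \<Longrightarrow> m \<le> i \<or> n \<le> j \<Longrightarrow> a i j = \<zero>"
  by (auto simp: matrices_def)

lemma matrices_closed [simp]: "a \<in> matrices U m n \<Longrightarrow> a i j \<in> carrier U"
  by (simp add: matrices_def)

lemma matrix_mult_in_matrices [simp]:
  assumes "a \<in> matrices U m k" "b \<in> matrices U k n"
  shows "matrix_mult U k a b \<in> matrices U m n"
  using assms by (intro matricesI) (auto simp: matrix_mult_def finsum_closed Pi_iff matrices_zero[OF assms(1)] 
    matrices_zero[OF assms(2)] finsum_zero)

lemma matrix_adj_in_matrices [simp]: "a \<in> matrices U m n \<Longrightarrow> matrix_adj U a \<in> matrices U n m"
  by (rule matricesI) (auto simp: matrix_adj_def matrices_zero)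

lemma matrix_adj_adj [simp]: "a \<in> matrices U m n \<Longrightarrow> matrix_adj U (matrix_adj U a) = a"
  by (simp add: matrix_adj_def)

lemma matrix_adj_mult:
  assumes "a \<in> matrices U m k" "b \<in> matrices U k n"
  shows "matrix_adj U (matrix_mult U k a b) = matrix_mult U k (matrix_adj U b) (matrix_adj U a)"
  using assms by (simp add: matrix_mult_def matrix_adj_def adj_finsum adj_mult)

lemma matrix_mult_assoc:
  assumes "a \<in> matrices U m k" "b \<in> matrices U k l" "c \<in> matrices U l n"
  shows "matrix_mult U l (matrix_mult U k a b) c = matrix_mult U k a (matrix_mult U l b c)"
proof (intro ext)
  fix i j
  have "matrix_mult U l (matrix_mult U k a b) c i j = (\<Oplus>t\<in>{..<l}. \<Oplus>s\<in>{..<k}. a i s \<otimes> b s t \<otimes> c t j)"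
    using assms by (simp add: matrix_mult_def finsum_ldistr Pi_iff)
  also have "\<dots> = (\<Oplus>s\<in>{..<k}. \<Oplus>t\<in>{..<l}. a i s \<otimes> b s t \<otimes> c t j)"
    using assms by (intro finsum_swap) auto
  also have "\<dots> = matrix_mult U k a (matrix_mult U l b c) i j"
    using assms by (simp add: matrix_mult_def finsum_rdistr Pi_iff m_assoc)
  finally show "matrix_mult U l (matrix_mult U k a b) c i j = matrix_mult U k a (matrix_mult U l b c) i j" .
qed

lemma block_diagonal_in_matrices [simp]:
  "a \<in> matrices U m n \<Longrightarrow> b \<in> matrices U m' n' \<Longrightarrow> block_diagonal U m n a b \<in> matrices U (m + m') (n + n')"
  by (rule matricesI) (auto simp: block_diagonal_def intro!: matrices_zero[of a m n] matrices_zero[of b m' n'])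

lemma block_antidiagonal_in_matrices [simp]:
  "a \<in> matrices U m n' \<Longrightarrow> b \<in> matrices U m' n \<Longrightarrow> block_antidiagonal U m n a b \<in> matrices U (m + m') (n + n')"
  by (rule matricesI) (auto simp: block_antidiagonal_def intro!: matrices_zero[of a m n'] matrices_zero[of b m' n])

lemma matrix_adj_block_diagonal:
  "matrix_adj U (block_diagonal U m n a b) = block_diagonal U n m (matrix_adj U a) (matrix_adj U b)"
  by (auto simp: matrix_adj_def block_diagonal_def fun_eq_iff)

lemma matrix_adj_block_antidiagonal:
  "matrix_adj U (block_antidiagonal U m n a b) = block_antidiagonal U n m (matrix_adj U b) (matrix_adj U a)"
  by (auto simp: matrix_adj_def block_antidiagonal_def fun_eq_iff)

lemma block_diagonal_mult:
  assumes "a \<in> matrices U m k" "a' \<in> matrices U m' k'" "b \<in> matrices U k n" "b' \<in> matrices U k' n'"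
  shows "matrix_mult U (k + k') (block_diagonal U m k a a') (block_diagonal U k n b b') =
    block_diagonal U m n (matrix_mult U k a b) (matrix_mult U k' a' b')"
proof (intro ext)
  fix i j
  have D: "block_diagonal U m k a a' i l \<otimes> block_diagonal U k n b b' l j \<in> carrier U" for l
    using block_diagonal_in_matrices[OF assms(1,2)] block_diagonal_in_matrices[OF assms(3,4)] by simp
  have "matrix_mult U (k + k') (block_diagonal U m k a a') (block_diagonal U k n b b') i j =
      (\<Oplus>l\<in>{..<k}. if i < m \<and> j < n then a i l \<otimes> b l j else \<zero>) \<oplus> 
      (\<Oplus>l\<in>{..<k'}. if m \<le> i \<and> n \<le> j then a' (i - m) l \<otimes> b' l (j - n) else \<zero>)"
    unfolding matrix_mult_def finsum_split[OF D]
    by (intro arg_cong2[of _ _ _ _ "add U"] finsum_cong') (use assms in \<open>auto simp: block_diagonal_def\<close>)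
  also have "\<dots> = block_diagonal U m n (matrix_mult U k a b) (matrix_mult U k' a' b') i j"
    using assms by (auto simp: block_diagonal_def matrix_mult_def finsum_zero finsum_closed Pi_iff)
  finally show "matrix_mult U (k + k') (block_diagonal U m k a a') (block_diagonal U k n b b') i j =
    block_diagonal U m n (matrix_mult U k a b) (matrix_mult U k' a' b') i j" .
qed

lemma block_antidiagonal_mult:
  assumes "a \<in> matrices U m k'" "a' \<in> matrices U m' k" "b \<in> matrices U k n'" "b' \<in> matrices U k' n"
  shows "matrix_mult U (k + k') (block_antidiagonal U m k a a') (block_antidiagonal U k n b b') =
    block_diagonal U m n (matrix_mult U k' a b') (matrix_mult U k a' b)"
proof (intro ext)
  fix i j
  have D: "block_antidiagonal U m k a a' i l \<otimes> block_antidiagonal U k n b b' l j \<in> carrier U" for l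
    using block_antidiagonal_in_matrices[OF assms(1,2)] block_antidiagonal_in_matrices[OF assms(3,4)] by simp
  have "matrix_mult U (k + k') (block_antidiagonal U m k a a') (block_antidiagonal U k n b b') i j =
      (\<Oplus>l\<in>{..<k}. if m \<le> i \<and> n \<le> j then a' (i - m) l \<otimes> b l (j - n) else \<zero>) \<oplus> 
      (\<Oplus>l\<in>{..<k'}. if i < m \<and> j < n then a i l \<otimes> b' l j else \<zero>)"
    unfolding matrix_mult_def finsum_split[OF D]
    by (intro arg_cong2[of _ _ _ _ "add U"] finsum_cong') (use assms in \<open>auto simp: block_antidiagonal_def\<close>)
  also have "\<dots> = block_diagonal U m n (matrix_mult U k' a b') (matrix_mult U k a' b) i j"
    using assms by (auto simp: block_diagonal_def matrix_mult_def finsum_zero finsum_closed Pi_iff)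
  finally show "matrix_mult U (k + k') (block_antidiagonal U m k a a') (block_antidiagonal U k n b b') i j =
    block_diagonal U m n (matrix_mult U k' a b') (matrix_mult U k a' b) i j" .
qed

lemma matrix_one_in_matrices [simp]: "matrix_one U n \<in> matrices U n n"
  by (rule matricesI) (auto simp: matrix_one_def)

lemma matrix_adj_one [simp]: "matrix_adj U (matrix_one U n) = matrix_one U n"
  by (auto simp: matrix_adj_def matrix_one_def fun_eq_iff)

lemma block_diagonal_one: 
  "block_diagonal U m m (matrix_one U m) (matrix_one U n) = matrix_one U (m + n)"
  by (auto simp: block_diagonal_def matrix_one_def fun_eq_iff)

lemma matrix_mult_one [simp]: 
  assumes "a \<in> matrices U m n"
  shows "matrix_mult U m (matrix_one U m) a = a"
proof (intro ext)
  fix i j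
  have "matrix_mult U m (matrix_one U m) a i j = (\<Oplus>l\<in>{..<m}. if i = l then a l j else \<zero>)"
    unfolding matrix_mult_def by (rule finsum_cong') (use assms in \<open>auto simp: matrix_one_def\<close>)
  also have "\<dots> = a i j"
  proof (cases "i < m")
    case True
    then show ?thesis
      using assms finsum_singleton[of i "{..<m}" "\<lambda>l. a l j"] by (simp add: Pi_iff)
  next
    case False
    then have "(\<Oplus>l\<in>{..<m}. if i = l then a l j else \<zero>) = (\<Oplus>l\<in>{..<m}. \<zero>)"
      by (intro finsum_cong') auto
    then show ?thesis
      using assms False by (simp add: finsum_zero matrices_zero)
  qed
  finally show "matrix_mult U m (matrix_one U m) a i j = a i j" .
qed


subsection \<open>Murray-von Neumann equivalence\<close>

lemma projections_iff: "(n, p) \<in> projections U \<longleftrightarrow>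
    p \<in> matrices U n n \<and> matrix_adj U p = p \<and> matrix_mult U n p p = p"
  by (simp add: projections_def)

lemma direct_sum_projections:
  "p \<in> projections U \<Longrightarrow> q \<in> projections U \<Longrightarrow> direct_sum U p q \<in> projections U"
  using block_diagonal_mult[of "snd p" "fst p" "fst p" "snd q" "fst q" "fst q" "snd p" "fst p" "snd q" "fst q"]
  by (cases p; cases q) (simp add: direct_sum_eq projections_iff matrix_adj_block_diagonal)

lemma murray_von_neumann_refl: "p \<in> projections U \<Longrightarrow> murray_von_neumann U p p"
  by (cases p) (auto simp: murray_von_neumann_def projections_iff intro!: bexI[of _ "snd p"])

lemma murray_von_neumann_sym: "murray_von_neumann U p q \<Longrightarrow> murray_von_neumann U q p"
proof -
  assume "murray_von_neumann U p q"
  moreover obtain n P m Q where eq: "p = (n, P)" "q = (m, Q)"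
    by (metis surj_pair)
  ultimately obtain v where "v \<in> matrices U m n" "matrix_mult U m (matrix_adj U v) v = P" 
      "matrix_mult U n v (matrix_adj U v) = Q"
    by (auto simp: murray_von_neumann_def)
  then show ?thesis
    by (auto simp: murray_von_neumann_def eq intro!: bexI[of _ "matrix_adj U v"])
qed

text \<open>If \<open>v\<close> implements the first equivalence and \<open>w\<close> the second, then \<open>w v\<close> implements the composite.\<close>

lemma murray_von_neumann_trans:
  assumes p: "p \<in> projections U" and q: "q \<in> projections U" and r: "r \<in> projections U"
    and pq: "murray_von_neumann U p q" and qr: "murray_von_neumann U q r"
  shows "murray_von_neumann U p r"
proof -
  obtain n P m Q k R where eq: "p = (n, P)" "q = (m, Q)" "r = (k, R)"
    by (metis surj_pair)
  obtain v where v: "v \<in> matrices U m n" "matrix_mult U m (matrix_adj U v) v = P" 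
      "matrix_mult U n v (matrix_adj U v) = Q"
    using pq by (auto simp: murray_von_neumann_def eq)
  obtain w where w: "w \<in> matrices U k m" "matrix_mult U k (matrix_adj U w) w = Q" 
      "matrix_mult U m w (matrix_adj U w) = R"
    using qr by (auto simp: murray_von_neumann_def eq)
  let ?u = "matrix_mult U m w v"
  have mats: "P \<in> matrices U n n" "Q \<in> matrices U m m" "R \<in> matrices U k k"
    using p q r by (simp_all add: eq projections_iff)
  note v' = matrix_adj_in_matrices[OF v(1)] and w' = matrix_adj_in_matrices[OF w(1)]
  have u: "?u \<in> matrices U k n" and u': "matrix_mult U m (matrix_adj U v) (matrix_adj U w) \<in> matrices U n k"
    using matrix_mult_in_matrices[OF w(1) v(1)] matrix_mult_in_matrices[OF v' w'] .
  have adj_u: "matrix_adj U ?u = matrix_mult U m (matrix_adj U v) (matrix_adj U w)"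
    by (rule matrix_adj_mult[OF w(1) v(1)])
  have "matrix_mult U k (matrix_adj U ?u) ?u = matrix_mult U m (matrix_adj U v) (matrix_mult U k (matrix_adj U w) ?u)"
    unfolding adj_u by (rule matrix_mult_assoc[OF v' w' u])
  also have "\<dots> = matrix_mult U m (matrix_adj U v) (matrix_mult U m Q v)"
    by (simp only: matrix_mult_assoc[OF w' w(1) v(1), symmetric] w(2))
  also have "\<dots> = matrix_mult U m (matrix_adj U v) (matrix_mult U n v P)"
    by (simp only: v(3)[symmetric] matrix_mult_assoc[OF v(1) v' v(1)] v(2))
  also have "\<dots> = matrix_mult U n P P"
    by (simp only: matrix_mult_assoc[OF v' v(1) mats(1), symmetric] v(2))
  also have "\<dots> = P"
    using p by (simp add: eq projections_iff)
  finally have 1: "matrix_mult U k (matrix_adj U ?u) ?u = P" .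
  have "matrix_mult U n ?u (matrix_adj U ?u) = matrix_mult U m w (matrix_mult U n v (matrix_mult U m (matrix_adj U v) (matrix_adj U w)))"
    unfolding adj_u by (rule matrix_mult_assoc[OF w(1) v(1) u'])
  also have "\<dots> = matrix_mult U m w (matrix_mult U m Q (matrix_adj U w))"
    by (simp only: matrix_mult_assoc[OF v(1) v' w', symmetric] v(3))
  also have "\<dots> = matrix_mult U m w (matrix_mult U k (matrix_adj U w) R)"
    by (simp only: w(2)[symmetric] matrix_mult_assoc[OF w' w(1) w'] w(3))
  also have "\<dots> = matrix_mult U k R R"
    by (simp only: matrix_mult_assoc[OF w(1) w' mats(3), symmetric] w(3))
  also have "\<dots> = R"
    using r by (simp add: eq projections_iff)
  finally have 2: "matrix_mult U n ?u (matrix_adj U ?u) = R" .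
  show ?thesis
    using u 1 2 by (auto simp: murray_von_neumann_def eq intro!: bexI[of _ ?u])
qed

lemma murray_von_neumann_direct_sum:
  assumes "murray_von_neumann U p q" "murray_von_neumann U p' q'"
  shows "murray_von_neumann U (direct_sum U p p') (direct_sum U q q')"
proof -
  obtain n P m Q n' P' m' Q' where eq: "p = (n, P)" "q = (m, Q)" "p' = (n', P')" "q' = (m', Q')"
    by (metis surj_pair)
  obtain v where v: "v \<in> matrices U m n" "matrix_mult U m (matrix_adj U v) v = P" 
      "matrix_mult U n v (matrix_adj U v) = Q"
    using assms(1) by (auto simp: murray_von_neumann_def eq)
  obtain w where w: "w \<in> matrices U m' n'" "matrix_mult U m' (matrix_adj U w) w = P'" 
      "matrix_mult U n' w (matrix_adj U w) = Q'"
    using assms(2) by (auto simp: murray_von_neumann_def eq)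
  have "matrix_mult U (m + m') (matrix_adj U (block_diagonal U m n v w)) (block_diagonal U m n v w) = block_diagonal U n n P P'"
    "matrix_mult U (n + n') (block_diagonal U m n v w) (matrix_adj U (block_diagonal U m n v w)) = block_diagonal U m m Q Q'"
    using v w block_diagonal_mult[of "matrix_adj U v" n m "matrix_adj U w" n' m' v n w n']
      block_diagonal_mult[of v m n w m' n' "matrix_adj U v" m "matrix_adj U w" m']
    by (simp_all add: matrix_adj_block_diagonal)
  then show ?thesis
    using v w by (auto simp: murray_von_neumann_def eq direct_sum_eq intro!: bexI[of _ "block_diagonal U m n v w"])
qed

text \<open>The antidiagonal partial isometry with entries \<open>q\<close> and \<open>p\<close> exchanges the summands.\<close>

lemma murray_von_neumann_commute:
  assumes "p \<in> projections U" "q \<in> projections U"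
  shows "murray_von_neumann U (direct_sum U p q) (direct_sum U q p)"
proof -
  obtain n P m Q where eq: "p = (n, P)" "q = (m, Q)"
    by (metis surj_pair)
  have P: "P \<in> matrices U n n" "matrix_adj U P = P" "matrix_mult U n P P = P"
    and Q: "Q \<in> matrices U m m" "matrix_adj U Q = Q" "matrix_mult U m Q Q = Q"
    using assms by (simp_all add: eq projections_iff)
  let ?v = "block_antidiagonal U m n Q P"
  have "?v \<in> matrices U (m + n) (n + m)"
    using P Q by simp
  moreover have "matrix_adj U ?v = block_antidiagonal U n m P Q"
    using P Q by (simp add: matrix_adj_block_antidiagonal)
  moreover have "matrix_mult U (m + n) (block_antidiagonal U n m P Q) ?v = block_diagonal U n n P Q"
    using block_antidiagonal_mult[of P n n Q m m Q m P n] P Q by simp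
  moreover have "matrix_mult U (n + m) ?v (block_antidiagonal U n m P Q) = block_diagonal U m m Q P"
    using block_antidiagonal_mult[of Q m m P n n P n Q m] P Q by simp
  ultimately show ?thesis
    by (auto simp: murray_von_neumann_def eq direct_sum_eq intro!: bexI[of _ ?v])
qed

text \<open>The middle terms of a sum of four projections may be exchanged.\<close>

lemma murray_von_neumann_exchange:
  assumes "a \<in> projections U" "b \<in> projections U" "c \<in> projections U" "d \<in> projections U"
  shows "murray_von_neumann U (direct_sum U (direct_sum U a b) (direct_sum U c d))
    (direct_sum U (direct_sum U a c) (direct_sum U b d))"
proof -
  have "murray_von_neumann U (direct_sum U a (direct_sum U (direct_sum U b c) d))
      (direct_sum U a (direct_sum U (direct_sum U c b) d))"
    by (rule murray_von_neumann_direct_sum[OF murray_von_neumann_refl 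
        murray_von_neumann_direct_sum[OF murray_von_neumann_commute murray_von_neumann_refl]]) fact+
  then show ?thesis
    by (simp add: direct_sum_assoc)
qed

text \<open>Add the two relations. Up to equivalence, both sides then contain the projections \<open>p'\<close>, \<open>q'\<close>, \<open>r\<close> and
  \<open>s\<close>, which together serve as the stabilizing summand of the composite.\<close>

lemma K0_rel_trans: "trans (K0_rel U)"
proof (rule transI)
  let ?s = "direct_sum U" and ?M = "murray_von_neumann U"
  fix x y z assume "(x, y) \<in> K0_rel U" "(y, z) \<in> K0_rel U"
  moreover obtain p q p' q' p'' q'' where eq: "x = (p, q)" "y = (p', q')" "z = (p'', q'')"
    by (metis surj_pair)
  ultimately obtain r s where pr: "p \<in> projections U" "q \<in> projections U" "p' \<in> projections U" "q' \<in> projections U"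
      "p'' \<in> projections U" "q'' \<in> projections U" "r \<in> projections U" "s \<in> projections U"
    and M1: "?M (?s (?s p q') r) (?s (?s p' q) r)" and M2: "?M (?s (?s p' q'') s) (?s (?s p'' q') s)"
    by (auto simp: K0_rel_def)
  note intros = direct_sum_projections pr
  let ?t = "?s (?s q' p') (?s r s)"
  have "?M (?s (?s p q'') (?s q' p')) (?s (?s p q') (?s q'' p'))"
    by (intro murray_von_neumann_exchange intros)
  moreover have "?M (?s (?s p q') (?s q'' p')) (?s (?s p q') (?s p' q''))"
    by (rule murray_von_neumann_direct_sum[OF murray_von_neumann_refl murray_von_neumann_commute]) (intro intros)+
  ultimately have "?M (?s (?s p q'') (?s q' p')) (?s (?s p q') (?s p' q''))"
    by (rule murray_von_neumann_trans[rotated 3]) (intro intros)+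
  then have "?M (?s (?s (?s p q'') (?s q' p')) (?s r s)) (?s (?s (?s p q') (?s p' q'')) (?s r s))"
    by (rule murray_von_neumann_direct_sum) (intro murray_von_neumann_refl intros)
  moreover have "?M (?s (?s (?s p q') (?s p' q'')) (?s r s)) (?s (?s (?s p q') r) (?s (?s p' q'') s))"
    by (intro murray_von_neumann_exchange intros)
  ultimately have A: "?M (?s (?s (?s p q'') (?s q' p')) (?s r s)) (?s (?s (?s p q') r) (?s (?s p' q'') s))"
    by (rule murray_von_neumann_trans[rotated 3]) (intro intros)+
  have B: "?M (?s (?s (?s p q') r) (?s (?s p' q'') s)) (?s (?s (?s p' q) r) (?s (?s p'' q') s))"
    by (intro murray_von_neumann_direct_sum M1 M2)
  have "?M (?s (?s p' q) (?s p'' q')) (?s (?s p'' q') (?s p' q))"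
    by (intro murray_von_neumann_commute intros)
  moreover have "?M (?s (?s p'' q') (?s p' q)) (?s (?s p'' q') (?s q p'))"
    by (rule murray_von_neumann_direct_sum[OF murray_von_neumann_refl murray_von_neumann_commute]) (intro intros)+
  ultimately have "?M (?s (?s p' q) (?s p'' q')) (?s (?s p'' q') (?s q p'))"
    by (rule murray_von_neumann_trans[rotated 3]) (intro intros)+
  moreover have "?M (?s (?s p'' q') (?s q p')) (?s (?s p'' q) (?s q' p'))"
    by (intro murray_von_neumann_exchange intros)
  ultimately have "?M (?s (?s p' q) (?s p'' q')) (?s (?s p'' q) (?s q' p'))"
    by (rule murray_von_neumann_trans[rotated 3]) (intro intros)+
  then have C2: "?M (?s (?s (?s p' q) (?s p'' q')) (?s r s)) (?s (?s (?s p'' q) (?s q' p')) (?s r s))"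
    by (rule murray_von_neumann_direct_sum) (intro murray_von_neumann_refl intros)
  have C1: "?M (?s (?s (?s p' q) r) (?s (?s p'' q') s)) (?s (?s (?s p' q) (?s p'' q')) (?s r s))"
    by (intro murray_von_neumann_exchange intros)
  have C: "?M (?s (?s (?s p' q) r) (?s (?s p'' q') s)) (?s (?s (?s p'' q) (?s q' p')) (?s r s))"
    by (rule murray_von_neumann_trans[OF _ _ _ C1 C2]) (intro intros)+
  have AB: "?M (?s (?s (?s p q'') (?s q' p')) (?s r s)) (?s (?s (?s p' q) r) (?s (?s p'' q') s))"
    by (rule murray_von_neumann_trans[OF _ _ _ A B]) (intro intros)+
  have "?M (?s (?s (?s p q'') (?s q' p')) (?s r s)) (?s (?s (?s p'' q) (?s q' p')) (?s r s))"
    by (rule murray_von_neumann_trans[OF _ _ _ AB C]) (intro intros)+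
  then have "?M (?s (?s p q'') ?t) (?s (?s p'' q) ?t)"
    by (simp add: direct_sum_assoc)
  moreover have "?t \<in> projections U"
    by (intro intros)
  ultimately show "(x, z) \<in> K0_rel U"
    using pr unfolding K0_rel_def eq by blast
qed

lemma equiv_K0_rel: "equiv (projections U \<times> projections U) (K0_rel U)"
proof (rule equivI)
  show "K0_rel U \<subseteq> (projections U \<times> projections U) \<times> (projections U \<times> projections U)"
    by (auto simp: K0_rel_def)
  show "refl_on (projections U \<times> projections U) (K0_rel U)"
    using murray_von_neumann_refl direct_sum_projections by (auto simp: refl_on_def K0_rel_def)
  show "sym (K0_rel U)"
    by (auto simp: sym_def K0_rel_def intro: murray_von_neumann_sym)
  show "trans (K0_rel U)"
    by (rule K0_rel_trans)
qed

lemma unitaries_iff: "(n, u) \<in> unitaries U \<longleftrightarrow> u \<in> matrices U n n \<and>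
    matrix_mult U n (matrix_adj U u) u = matrix_one U n \<and> matrix_mult U n u (matrix_adj U u) = matrix_one U n"
  by (simp add: unitaries_def)

lemma direct_sum_unitaries:
  "u \<in> unitaries U \<Longrightarrow> v \<in> unitaries U \<Longrightarrow> direct_sum U u v \<in> unitaries U"
  using block_diagonal_mult[of "matrix_adj U (snd u)" "fst u" "fst u" "matrix_adj U (snd v)" "fst v" "fst v" "snd u" "fst u" "snd v" "fst v"]
    block_diagonal_mult[of "snd u" "fst u" "fst u" "snd v" "fst v" "fst v" "matrix_adj U (snd u)" "fst u" "matrix_adj U (snd v)" "fst v"]
  by (cases u; cases v) (simp add: direct_sum_eq unitaries_iff matrix_adj_block_diagonal block_diagonal_one)

lemma one_unitary: "(n, matrix_one U n) \<in> unitaries U"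
  by (simp add: unitaries_iff matrix_mult_one[OF matrix_one_in_matrices])

end


subsection \<open>Homotopy of unitaries\<close>

lemma pathin_reverse: 
  assumes "pathin X g"
  shows "pathin X (\<lambda>t. g (1 - t))"
proof -
  have "continuous_map (top_of_set {0..1}) (top_of_set {0..1::real}) (\<lambda>t. 1 - t)"
    by (auto simp: continuous_map_in_subtopology intro!: continuous_intros)
  from continuous_map_compose[OF this assms[unfolded pathin_def]] show ?thesis
    by (simp add: pathin_def o_def)
qed

lemma pathin_join:
  assumes g: "pathin X g" and h: "pathin X h" and "g 1 = h 0"
  shows "pathin X (\<lambda>t. if t \<le> 1 / 2 then g (2 * t) else h (2 * t - 1))"
  unfolding pathin_def
proof (rule continuous_map_cases_le)
  let ?I = "top_of_set {0..1::real}"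
  have "continuous_map (subtopology ?I {t \<in> topspace ?I. t \<le> 1 / 2}) ?I (\<lambda>t. 2 * t)"
    by (auto simp: continuous_map_in_subtopology subtopology_subtopology intro!: continuous_intros)
  from continuous_map_compose[OF this g[unfolded pathin_def]]
  show "continuous_map (subtopology ?I {t \<in> topspace ?I. t \<le> 1 / 2}) X (\<lambda>t. g (2 * t))"
    by (simp add: o_def)
  have "continuous_map (subtopology ?I {t \<in> topspace ?I. 1 / 2 \<le> t}) ?I (\<lambda>t. 2 * t - 1)"
    by (auto simp: continuous_map_in_subtopology subtopology_subtopology intro!: continuous_intros)
  from continuous_map_compose[OF this h[unfolded pathin_def]]
  show "continuous_map (subtopology ?I {t \<in> topspace ?I. 1 / 2 \<le> t}) X (\<lambda>t. h (2 * t - 1))"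
    by (simp add: o_def)
qed (use assms(3) in \<open>auto intro!: continuous_intros simp: mult.commute\<close>)

lemma unitary_homotopic_iff:
  "unitary_homotopic U (n, u) (m, v) \<longleftrightarrow> n = m \<and> (\<exists>\<gamma>. (\<forall>t\<in>{0..1}. (n, \<gamma> t) \<in> unitaries U) \<and>
     (\<forall>i<n. \<forall>j<n. pathin (cstar_topology U) (\<lambda>t. \<gamma> t i j)) \<and> \<gamma> 0 = u \<and> \<gamma> 1 = v)"
  by (simp add: unitary_homotopic_def)

lemma unitary_homotopic_sym:
  assumes "unitary_homotopic U x y"
  shows "unitary_homotopic U y x"
proof -
  obtain n u m v where eq: "x = (n, u)" "y = (m, v)" by (metis surj_pair)
  obtain \<gamma> where "n = m" "\<forall>t\<in>{0..1}. (n, \<gamma> t) \<in> unitaries U" 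
     "\<forall>i<n. \<forall>j<n. pathin (cstar_topology U) (\<lambda>t. \<gamma> t i j)" "\<gamma> 0 = u" "\<gamma> 1 = v"
    using assms unfolding eq unitary_homotopic_iff by blast
  then show ?thesis
    unfolding eq unitary_homotopic_iff
    by (intro conjI exI[of _ "\<lambda>t. \<gamma> (1 - t)"]) (auto intro: pathin_reverse)
qed

lemma unitary_homotopic_trans:
  assumes "unitary_homotopic U x y" "unitary_homotopic U y z"
  shows "unitary_homotopic U x z"
proof -
  obtain n u m v k w where eq: "x = (n, u)" "y = (m, v)" "z = (k, w)" by (metis surj_pair)
  obtain \<gamma> where g: "n = m" "\<forall>t\<in>{0..1}. (n, \<gamma> t) \<in> unitaries U" 
     "\<forall>i<n. \<forall>j<n. pathin (cstar_topology U) (\<lambda>t. \<gamma> t i j)" "\<gamma> 0 = u" "\<gamma> 1 = v"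
    using assms(1) unfolding eq unitary_homotopic_iff by blast
  obtain \<delta> where d: "m = k" "\<forall>t\<in>{0..1}. (m, \<delta> t) \<in> unitaries U" 
     "\<forall>i<m. \<forall>j<m. pathin (cstar_topology U) (\<lambda>t. \<delta> t i j)" "\<delta> 0 = v" "\<delta> 1 = w"
    using assms(2) unfolding eq unitary_homotopic_iff by blast
  let ?e = "\<lambda>t. if t \<le> 1 / 2 then \<gamma> (2 * t) else \<delta> (2 * t - 1)"
  have "pathin (cstar_topology U) (\<lambda>t. ?e t i j)" if "i < n" "j < n" for i j
  proof -
    have "pathin (cstar_topology U) (\<lambda>t. if t \<le> 1 / 2 then \<gamma> (2 * t) i j else \<delta> (2 * t - 1) i j)"
      using that g d by (intro pathin_join) auto
    then show ?thesis by (simp add: if_distrib[of "\<lambda>f. f i j"] cong: if_cong)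
  qed
  moreover have "\<forall>t\<in>{0..1}. (n, ?e t) \<in> unitaries U"
    using g d by auto
  ultimately show ?thesis
    unfolding eq unitary_homotopic_iff using g d by (intro conjI exI[of _ ?e]) auto
qed

locale topological_star_ring = star_ring +
  assumes topspace_carrier: "topspace (cstar_topology U) = carrier U"
begin

lemma unitary_homotopic_refl: "u \<in> unitaries U \<Longrightarrow> unitary_homotopic U u u"
  by (cases u) (auto simp: unitary_homotopic_iff topspace_carrier unitaries_iff intro!: exI[of _ "\<lambda>_. snd u"])

lemma unitary_homotopic_stabilize:
  assumes "unitary_homotopic U x y"
  shows "unitary_homotopic U (direct_sum U x (k, matrix_one U k)) (direct_sum U y (k, matrix_one U k))"
proof -
  obtain n u m v where eq: "x = (n, u)" "y = (m, v)" by (metis surj_pair)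
  obtain \<gamma> where g: "n = m" "\<forall>t\<in>{0..1}. (n, \<gamma> t) \<in> unitaries U" 
     "\<forall>i<n. \<forall>j<n. pathin (cstar_topology U) (\<lambda>t. \<gamma> t i j)" "\<gamma> 0 = u" "\<gamma> 1 = v"
    using assms unfolding eq unitary_homotopic_iff by blast
  let ?\<delta> = "\<lambda>t. block_diagonal U n n (\<gamma> t) (matrix_one U k)"
  have "(n + k, ?\<delta> t) \<in> unitaries U" if "t \<in> {0..1}" for t
    using direct_sum_unitaries[of "(n, \<gamma> t)" "(k, matrix_one U k)"] one_unitary[of k] g(2) that
    by (simp add: direct_sum_eq)
  moreover have "pathin (cstar_topology U) (\<lambda>t. ?\<delta> t i j)" for i j
    using g(3) by (cases "i < n"; cases "j < n") (auto simp: block_diagonal_def topspace_carrier matrix_one_def)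
  ultimately show ?thesis
    unfolding eq direct_sum_eq unitary_homotopic_iff using g by (intro conjI exI[of _ ?\<delta>]) auto
qed

lemma equiv_K1_rel: "equiv (unitaries U) (K1_rel U)"
proof (rule equivI)
  show "K1_rel U \<subseteq> unitaries U \<times> unitaries U"
    by (auto simp: K1_rel_def)
  show "refl_on (unitaries U) (K1_rel U)"
  proof (rule refl_onI)
    fix u assume u: "u \<in> unitaries U"
    have "unitary_homotopic U (direct_sum U u (0, matrix_one U 0)) (direct_sum U u (0, matrix_one U 0))"
      by (intro unitary_homotopic_refl direct_sum_unitaries one_unitary u)
    then show "(u, u) \<in> K1_rel U"
      using u unfolding K1_rel_def by blast
  qed
  show "sym (K1_rel U)"
    unfolding sym_def K1_rel_def using unitary_homotopic_sym by blast
  show "trans (K1_rel U)"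
  proof (rule transI)
    let ?o = "\<lambda>k. (k, matrix_one U k)"
    fix u v w assume "(u, v) \<in> K1_rel U" "(v, w) \<in> K1_rel U"
    then obtain k l k' l' where uw: "u \<in> unitaries U" "w \<in> unitaries U"
      and 1: "unitary_homotopic U (direct_sum U u (?o k)) (direct_sum U v (?o l))"
      and 2: "unitary_homotopic U (direct_sum U v (?o k')) (direct_sum U w (?o l'))"
      by (auto simp: K1_rel_def)
    have sum: "direct_sum U (direct_sum U x (?o a)) (?o b) = direct_sum U x (?o (a + b))" for x a b
      by (simp add: direct_sum_assoc direct_sum_eq block_diagonal_one)
    have "unitary_homotopic U (direct_sum U u (?o (k + k'))) (direct_sum U v (?o (l + k')))"
      using unitary_homotopic_stabilize[OF 1, of k'] by (simp add: sum)
    moreover have "unitary_homotopic U (direct_sum U v (?o (l + k'))) (direct_sum U w (?o (l' + l)))"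
      using unitary_homotopic_stabilize[OF 2, of l] by (simp add: sum add.commute)
    ultimately have "unitary_homotopic U (direct_sum U u (?o (k + k'))) (direct_sum U w (?o (l' + l)))"
      by (rule unitary_homotopic_trans)
    then show "(u, w) \<in> K1_rel U"
      using uw by (auto simp: K1_rel_def)
  qed
qed

end


subsection \<open>Functoriality\<close>

locale star_ring_hom = U: star_ring U + V: star_ring V 
  for U :: "'u cstar_alg" and V :: "'v cstar_alg" +
  fixes \<phi> :: "'u \<Rightarrow> 'v"
  assumes hom_closed [simp]: "x \<in> carrier U \<Longrightarrow> \<phi> x \<in> carrier V"
    and hom_add: "x \<in> carrier U \<Longrightarrow> y \<in> carrier U \<Longrightarrow> \<phi> (x \<oplus>\<^bsub>U\<^esub> y) = \<phi> x \<oplus>\<^bsub>V\<^esub> \<phi> y"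
    and hom_mult: "x \<in> carrier U \<Longrightarrow> y \<in> carrier U \<Longrightarrow> \<phi> (x \<otimes>\<^bsub>U\<^esub> y) = \<phi> x \<otimes>\<^bsub>V\<^esub> \<phi> y"
    and hom_one [simp]: "\<phi> \<one>\<^bsub>U\<^esub> = \<one>\<^bsub>V\<^esub>"
    and hom_adj: "x \<in> carrier U \<Longrightarrow> \<phi> (adj U x) = adj V (\<phi> x)"
begin

lemma hom_zero [simp]: "\<phi> \<zero>\<^bsub>U\<^esub> = \<zero>\<^bsub>V\<^esub>"
  using hom_add[of "\<zero>\<^bsub>U\<^esub>" "\<zero>\<^bsub>U\<^esub>"] V.add.l_cancel_one'[of "\<phi> \<zero>\<^bsub>U\<^esub>" "\<phi> \<zero>\<^bsub>U\<^esub>"] by simp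

lemma hom_finsum:
  assumes "finite S" "\<And>s. s \<in> S \<Longrightarrow> f s \<in> carrier U"
  shows "\<phi> (\<Oplus>\<^bsub>U\<^esub>s\<in>S. f s) = (\<Oplus>\<^bsub>V\<^esub>s\<in>S. \<phi> (f s))"
  using assms by (induction S rule: finite_induct) (simp_all add: Pi_iff hom_add)

abbreviation map_matrix :: "(nat \<Rightarrow> nat \<Rightarrow> 'u) \<Rightarrow> nat \<Rightarrow> nat \<Rightarrow> 'v" where
  "map_matrix a \<equiv> \<lambda>i j. \<phi> (a i j)"

lemma map_matrix_in_matrices: "a \<in> matrices U m n \<Longrightarrow> map_matrix a \<in> matrices V m n"
  by (rule V.matricesI) (auto simp: U.matrices_zero)

lemma map_matrix_mult:
  assumes "\<forall>i j. a i j \<in> carrier U" "\<forall>i j. b i j \<in> carrier U"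
  shows "map_matrix (matrix_mult U k a b) = matrix_mult V k (map_matrix a) (map_matrix b)"
  using assms by (simp add: matrix_mult_def hom_finsum hom_mult)

lemma map_matrix_adj:
  assumes "\<forall>i j. a i j \<in> carrier U"
  shows "map_matrix (matrix_adj U a) = matrix_adj V (map_matrix a)"
  using assms by (simp add: matrix_adj_def hom_adj)

lemma map_matrix_one: "map_matrix (matrix_one U n) = matrix_one V n"
  by (auto simp: matrix_one_def fun_eq_iff)

lemma map_block_diagonal:
  "map_matrix (block_diagonal U m n a b) = block_diagonal V m n (map_matrix a) (map_matrix b)"
  by (auto simp: block_diagonal_def fun_eq_iff)

lemma sqmat_map_direct_sum: 
  "sqmat_map \<phi> (direct_sum U p q) = direct_sum V (sqmat_map \<phi> p) (sqmat_map \<phi> q)"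
  by (cases p; cases q) (simp add: sqmat_map_def direct_sum_eq map_block_diagonal)

lemma sqmat_map_projections:
  assumes "p \<in> projections U"
  shows "sqmat_map \<phi> p \<in> projections V"
proof -
  obtain n P where eq: "p = (n, P)" by (metis surj_pair)
  have P: "P \<in> matrices U n n" "matrix_adj U P = P" "matrix_mult U n P P = P"
    using assms by (simp_all add: eq U.projections_iff)
  show ?thesis
    using map_matrix_mult[of P P n] map_matrix_adj[of P] map_matrix_in_matrices[OF P(1)] P
    by (simp add: eq sqmat_map_def V.projections_iff)
qed

lemma sqmat_map_murray_von_neumann:
  assumes "murray_von_neumann U p q"
  shows "murray_von_neumann V (sqmat_map \<phi> p) (sqmat_map \<phi> q)"
proof -
  obtain n P m Q where eq: "p = (n, P)" "q = (m, Q)" by (metis surj_pair)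
  obtain v where v: "v \<in> matrices U m n" "matrix_mult U m (matrix_adj U v) v = P" 
      "matrix_mult U n v (matrix_adj U v) = Q"
    using assms by (auto simp: murray_von_neumann_def eq)
  have c: "\<forall>i j. v i j \<in> carrier U" "\<forall>i j. matrix_adj U v i j \<in> carrier U"
    using U.matrices_closed[OF v(1)] U.matrices_closed[OF U.matrix_adj_in_matrices[OF v(1)]] by blast+
  have "map_matrix P = matrix_mult V m (matrix_adj V (map_matrix v)) (map_matrix v)"
    "map_matrix Q = matrix_mult V n (map_matrix v) (matrix_adj V (map_matrix v))"
    using map_matrix_mult[OF c(2,1), of m] map_matrix_mult[OF c(1,2), of n]
    unfolding map_matrix_adj[OF c(1)] v(2,3) .
  then show ?thesis
    using map_matrix_in_matrices[OF v(1)]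
    by (auto simp: murray_von_neumann_def eq sqmat_map_def)
qed

lemma sqmat_map_unitaries:
  assumes "u \<in> unitaries U"
  shows "sqmat_map \<phi> u \<in> unitaries V"
proof -
  obtain n v where eq: "u = (n, v)" by (metis surj_pair)
  have v: "v \<in> matrices U n n" "matrix_mult U n (matrix_adj U v) v = matrix_one U n" 
      "matrix_mult U n v (matrix_adj U v) = matrix_one U n"
    using assms by (simp_all add: eq U.unitaries_iff)
  have c: "\<forall>i j. v i j \<in> carrier U" "\<forall>i j. matrix_adj U v i j \<in> carrier U"
    using U.matrices_closed[OF v(1)] U.matrices_closed[OF U.matrix_adj_in_matrices[OF v(1)]] by blast+
  have "map_matrix (matrix_one U n) = matrix_mult V n (matrix_adj V (map_matrix v)) (map_matrix v)"
    "map_matrix (matrix_one U n) = matrix_mult V n (map_matrix v) (matrix_adj V (map_matrix v))"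
    using map_matrix_mult[OF c(2,1), of n] map_matrix_mult[OF c(1,2), of n]
    unfolding map_matrix_adj[OF c(1)] v(2,3) .
  then show ?thesis
    using map_matrix_in_matrices[OF v(1)]
    by (simp add: map_matrix_one eq sqmat_map_def V.unitaries_iff)
qed

lemma K0_rel_map:
  assumes "((p, q), (p', q')) \<in> K0_rel U"
  shows "((sqmat_map \<phi> p, sqmat_map \<phi> q), (sqmat_map \<phi> p', sqmat_map \<phi> q')) \<in> K0_rel V"
proof -
  obtain r where r: "r \<in> projections U" "murray_von_neumann U
        (direct_sum U (direct_sum U p q') r) (direct_sum U (direct_sum U p' q) r)"
    and pr: "p \<in> projections U" "q \<in> projections U" "p' \<in> projections U" "q' \<in> projections U"
    using assms by (auto simp: K0_rel_def)
  have "murray_von_neumann V (direct_sum V (direct_sum V (sqmat_map \<phi> p) (sqmat_map \<phi> q')) (sqmat_map \<phi> r))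
      (direct_sum V (direct_sum V (sqmat_map \<phi> p') (sqmat_map \<phi> q)) (sqmat_map \<phi> r))"
    using sqmat_map_murray_von_neumann[OF r(2)] by (simp add: sqmat_map_direct_sum)
  then show ?thesis
    using r(1) pr sqmat_map_projections unfolding K0_rel_def by blast
qed

text \<open>The union over representatives in the definition of the induced map is a single class.\<close>

lemma K0_unital_map_class:
  assumes p: "p \<in> projections U" and q: "q \<in> projections U"
  shows "K0_unital_map V \<phi> (K0_rel U `` {(p, q)}) = K0_rel V `` {(sqmat_map \<phi> p, sqmat_map \<phi> q)}"
proof -
  have "K0_rel V `` {(sqmat_map \<phi> p', sqmat_map \<phi> q')} = K0_rel V `` {(sqmat_map \<phi> p, sqmat_map \<phi> q)}"
    if "(p', q') \<in> K0_rel U `` {(p, q)}" for p' q'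
    using equiv_class_eq[OF V.equiv_K0_rel K0_rel_map[of p q p' q']] that by simp
  moreover have "(p, q) \<in> K0_rel U `` {(p, q)}"
    using p q equiv_class_self[OF U.equiv_K0_rel] by blast
  ultimately show ?thesis
    unfolding K0_unital_map_def by blast
qed

lemma sqmat_map_unitary_homotopic:
  assumes cont: "continuous_map (cstar_topology U) (cstar_topology V) \<phi>"
    and "unitary_homotopic U u v"
  shows "unitary_homotopic V (sqmat_map \<phi> u) (sqmat_map \<phi> v)"
proof -
  obtain n x m y where eq: "u = (n, x)" "v = (m, y)" by (metis surj_pair)
  obtain \<gamma> where g: "n = m" "\<forall>t\<in>{0..1}. (n, \<gamma> t) \<in> unitaries U" 
     "\<forall>i<n. \<forall>j<n. pathin (cstar_topology U) (\<lambda>t. \<gamma> t i j)" "\<gamma> 0 = x" "\<gamma> 1 = y"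
    using assms(2) unfolding eq unitary_homotopic_iff by blast
  have "(n, map_matrix (\<gamma> t)) \<in> unitaries V" if "t \<in> {0..1}" for t
    using sqmat_map_unitaries[of "(n, \<gamma> t)"] g(2) that by (simp add: sqmat_map_def)
  moreover have "pathin (cstar_topology V) (\<lambda>t. \<phi> (\<gamma> t i j))" if "i < n" "j < n" for i j
    using pathin_compose[OF _ cont, of "\<lambda>t. \<gamma> t i j"] g(3) that by (simp add: o_def)
  ultimately show ?thesis
    unfolding eq sqmat_map_def prod.case unitary_homotopic_iff
    using g by (intro conjI exI[of _ "\<lambda>t. map_matrix (\<gamma> t)"]) auto
qed

lemma K1_map_class:
  assumes V: "topological_star_ring V" and U: "topological_star_ring U"
    and cont: "continuous_map (cstar_topology U) (cstar_topology V) \<phi>" and u: "u \<in> unitaries U"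
  shows "(\<Union>v\<in>K1_rel U `` {u}. K1_rel V `` {sqmat_map \<phi> v}) = K1_rel V `` {sqmat_map \<phi> u}"
proof -
  have "K1_rel V `` {sqmat_map \<phi> v} = K1_rel V `` {sqmat_map \<phi> u}" if uv: "(u, v) \<in> K1_rel U" for v
  proof -
    obtain k l where v: "v \<in> unitaries U" and h: "unitary_homotopic U (direct_sum U u (k, matrix_one U k))
        (direct_sum U v (l, matrix_one U l))"
      using uv by (auto simp: K1_rel_def)
    have "sqmat_map \<phi> (k, matrix_one U k) = (k, matrix_one V k)" for k
      using map_matrix_one[of k] by (simp add: sqmat_map_def)
    then have "unitary_homotopic V (direct_sum V (sqmat_map \<phi> u) (k, matrix_one V k))
        (direct_sum V (sqmat_map \<phi> v) (l, matrix_one V l))"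
      using sqmat_map_unitary_homotopic[OF cont h] by (simp add: sqmat_map_direct_sum)
    then have "(sqmat_map \<phi> u, sqmat_map \<phi> v) \<in> K1_rel V"
      using sqmat_map_unitaries u v by (auto simp: K1_rel_def)
    then show ?thesis
      by (rule equiv_class_eq[OF topological_star_ring.equiv_K1_rel[OF V], symmetric])
  qed
  moreover have "u \<in> K1_rel U `` {u}"
    using equiv_class_self[OF topological_star_ring.equiv_K1_rel[OF U] u] .
  ultimately show ?thesis by blast
qed

text \<open>If \<open>\<phi>\<close> is injective, matrix identities hold as soon as they hold after applying \<open>\<phi>\<close>, so that
  projections and unitaries with entries in the image come from projections and unitaries.\<close>

context
  assumes inj: "inj_on \<phi> (carrier U)"
begin

lemma map_matrix_eqD:
  assumes "\<And>i j. a i j \<in> carrier U" "\<And>i j. b i j \<in> carrier U" "map_matrix a = map_matrix b"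
  shows "a = b"
  using assms inj_onD[OF inj] by (intro ext) (metis (no_types))

lemma matrix_lift:
  assumes "P \<in> matrices V n n" and im: "\<And>i j. P i j \<in> \<phi> ` carrier U"
  obtains P' where "P' \<in> matrices U n n" "map_matrix P' = P"
proof
  let ?P = "\<lambda>i j. inv_into (carrier U) \<phi> (P i j)"
  show "map_matrix ?P = P"
    using im by (simp add: f_inv_into_f)
  show "?P \<in> matrices U n n"
  proof (rule U.matricesI)
    show "?P i j \<in> carrier U" for i j by (rule inv_into_into[OF im])
    show "?P i j = \<zero>\<^bsub>U\<^esub>" if "n \<le> i \<or> n \<le> j" for i j
      using that V.matrices_zero[OF assms(1)] inv_into_f_f[OF inj, of "\<zero>\<^bsub>U\<^esub>"] by simp
  qed
qed

lemma projection_lift: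
  assumes p: "p \<in> projections V" and im: "\<And>i j. snd p i j \<in> \<phi> ` carrier U"
  obtains p' where "p' \<in> projections U" "sqmat_map \<phi> p' = p"
proof -
  obtain n P where eq: "p = (n, P)" by (metis surj_pair)
  have P: "P \<in> matrices V n n" "matrix_adj V P = P" "matrix_mult V n P P = P"
    using p by (simp_all add: eq V.projections_iff)
  obtain P' where P': "P' \<in> matrices U n n" "map_matrix P' = P"
    using matrix_lift[OF P(1)] im by (metis eq snd_conv)
  have "matrix_adj U P' = P'" 
  proof (rule map_matrix_eqD)
    show "map_matrix (matrix_adj U P') = map_matrix P'"
      using map_matrix_adj[of P'] U.matrices_closed[OF P'(1)] by (simp add: P' P)
  qed (rule U.matrices_closed[OF U.matrix_adj_in_matrices[OF P'(1)]] U.matrices_closed[OF P'(1)])+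
  moreover have "matrix_mult U n P' P' = P'" 
  proof (rule map_matrix_eqD)
    show "map_matrix (matrix_mult U n P' P') = map_matrix P'"
      using map_matrix_mult[of P' P' n] U.matrices_closed[OF P'(1)] by (simp add: P' P)
  qed (rule U.matrices_closed[OF U.matrix_mult_in_matrices[OF P'(1) P'(1)]] U.matrices_closed[OF P'(1)])+
  ultimately show thesis
    using that[of "(n, P')"] P' by (simp add: U.projections_iff sqmat_map_def eq)
qed

lemma unitary_lift:
  assumes u: "u \<in> unitaries V" and im: "\<And>i j. snd u i j \<in> \<phi> ` carrier U"
  obtains u' where "u' \<in> unitaries U" "sqmat_map \<phi> u' = u"
proof -
  obtain n P where eq: "u = (n, P)" by (metis surj_pair)
  have P: "P \<in> matrices V n n" "matrix_mult V n (matrix_adj V P) P = matrix_one V n"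
      "matrix_mult V n P (matrix_adj V P) = matrix_one V n"
    using u by (simp_all add: eq V.unitaries_iff)
  obtain P' where P': "P' \<in> matrices U n n" "map_matrix P' = P"
    using matrix_lift[OF P(1)] im by (metis eq snd_conv)
  have c: "\<forall>i j. P' i j \<in> carrier U" "\<forall>i j. matrix_adj U P' i j \<in> carrier U"
    using U.matrices_closed[OF P'(1)] U.matrices_closed[OF U.matrix_adj_in_matrices[OF P'(1)]] by blast+
  have adj: "map_matrix (matrix_adj U P') = matrix_adj V P"
    using map_matrix_adj[of P'] c P' by simp
  have "matrix_mult U n (matrix_adj U P') P' = matrix_one U n" 
  proof (rule map_matrix_eqD)
    show "map_matrix (matrix_mult U n (matrix_adj U P') P') = map_matrix (matrix_one U n)"
      unfolding map_matrix_mult[OF c(2,1)] adj P'(2) map_matrix_one P(2) ..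
  qed (use U.matrices_closed[OF U.matrix_mult_in_matrices[OF U.matrix_adj_in_matrices[OF P'(1)] P'(1)]]
      U.matrices_closed[OF U.matrix_one_in_matrices] in auto)
  moreover have "matrix_mult U n P' (matrix_adj U P') = matrix_one U n" 
  proof (rule map_matrix_eqD)
    show "map_matrix (matrix_mult U n P' (matrix_adj U P')) = map_matrix (matrix_one U n)"
      unfolding map_matrix_mult[OF c(1,2)] adj P'(2) map_matrix_one P(3) ..
  qed (use U.matrices_closed[OF U.matrix_mult_in_matrices[OF P'(1) U.matrix_adj_in_matrices[OF P'(1)]]]
      U.matrices_closed[OF U.matrix_one_in_matrices] in auto)
  ultimately show thesis
    using that[of "(n, P')"] P' by (simp add: U.unitaries_iff sqmat_map_def eq)
qed

end

end


section \<open>Unitizations\<close>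

lemma star_ring_complex: "star_ring complex_cstar"
proof -
  have "monoid complex_cstar"
    by (rule monoidI) (auto simp: algebra_simps)
  then have "ring complex_cstar"
    by (intro ringI complex.abelian_group_axioms) (auto simp: algebra_simps)
  then show ?thesis
    by (rule star_ring.intro) (unfold_locales, auto)
qed

lemma unitization_simps [simp]:
  "carrier (unitization A) = carrier A \<times> UNIV"
  "(a, l) \<otimes>\<^bsub>unitization A\<^esub> (b, m) = (a \<otimes>\<^bsub>A\<^esub> b \<oplus>\<^bsub>A\<^esub> l \<odot>\<^bsub>A\<^esub> b \<oplus>\<^bsub>A\<^esub> m \<odot>\<^bsub>A\<^esub> a, l * m)"
  "\<one>\<^bsub>unitization A\<^esub> = (\<zero>\<^bsub>A\<^esub>, 1)"
  "\<zero>\<^bsub>unitization A\<^esub> = (\<zero>\<^bsub>A\<^esub>, 0)"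
  "(a, l) \<oplus>\<^bsub>unitization A\<^esub> (b, m) = (a \<oplus>\<^bsub>A\<^esub> b, l + m)"
  "adj (unitization A) (a, l) = (adj A a, cnj l)"
  by (simp_all add: unitization_def)

context pre_cstar_algebra
begin

lemma abelian_group_unitization: "abelian_group (unitization A)"
proof (rule abelian_groupI)
  fix x assume "x \<in> carrier (unitization A)"
  then obtain a l where x: "x = (a, l)" "a \<in> carrier A" by auto
  then show "\<exists>y\<in>carrier (unitization A). y \<oplus>\<^bsub>unitization A\<^esub> x = \<zero>\<^bsub>unitization A\<^esub>"
    by (intro bexI[of _ "(\<ominus> a, - l)"]) (auto simp: l_neg)
qed (auto simp: a_assoc a_comm a_lcomm)

lemma star_ring_unitization: "star_ring (unitization A)"
proof -
  have "monoid (unitization A)"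
  proof (rule monoidI)
    fix x y z assume "x \<in> carrier (unitization A)" "y \<in> carrier (unitization A)" "z \<in> carrier (unitization A)"
    then show "x \<otimes>\<^bsub>unitization A\<^esub> y \<otimes>\<^bsub>unitization A\<^esub> z = x \<otimes>\<^bsub>unitization A\<^esub> (y \<otimes>\<^bsub>unitization A\<^esub> z)"
      by (auto simp: mult_assoc distrib_left distrib_right smult_mult_left smult_mult_right smult_add
        smult_smult mult.commute mult.left_commute a_assoc a_comm a_lcomm)
  qed auto
  then have "ring (unitization A)"
  proof (intro ringI abelian_group_unitization)
    fix x y z assume "x \<in> carrier (unitization A)" "y \<in> carrier (unitization A)" "z \<in> carrier (unitization A)"
    then show "(x \<oplus>\<^bsub>unitization A\<^esub> y) \<otimes>\<^bsub>unitization A\<^esub> z = x \<otimes>\<^bsub>unitization A\<^esub> z \<oplus>\<^bsub>unitization A\<^esub> y \<otimes>\<^bsub>unitization A\<^esub> z"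
      "z \<otimes>\<^bsub>unitization A\<^esub> (x \<oplus>\<^bsub>unitization A\<^esub> y) = z \<otimes>\<^bsub>unitization A\<^esub> x \<oplus>\<^bsub>unitization A\<^esub> z \<otimes>\<^bsub>unitization A\<^esub> y"
      by (auto simp: distrib_left distrib_right smult_add smult_add_scalar algebra_simps a_assoc a_comm a_lcomm)
  qed
  then show ?thesis
  proof (rule star_ring.intro)
    show "star_ring_axioms (unitization A)"
      by unfold_locales (auto simp: adj_adj adj_add adj_mult adj_smult a_assoc a_comm a_lcomm)
  qed
qed

lemma minus_unitization:
  assumes "a \<in> carrier A" "b \<in> carrier A"
  shows "(a, l) \<ominus>\<^bsub>unitization A\<^esub> (b, m) = (a \<ominus> b, l - m)"
proof -
  interpret U: abelian_group "unitization A" by (rule abelian_group_unitization)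
  have "\<ominus>\<^bsub>unitization A\<^esub> (b, m) = (\<ominus> b, - m)"
    using assms by (intro U.minus_equality) (auto simp: l_neg)
  then show ?thesis
    by (simp add: a_minus_def)
qed

text \<open>The norm of left multiplication by \<open>(a, l)\<close> on \<open>A\<close>.\<close>

definition multiplier_norm :: "'a \<Rightarrow> complex \<Rightarrow> real" where
  "multiplier_norm a l = (SUP b\<in>{b \<in> carrier A. cnorm A b \<le> 1}. cnorm A (a \<otimes> b \<oplus> l \<odot> b))"

lemma cnorm_unitization: "cnorm (unitization A) (a, l) = max (cmod l) (multiplier_norm a l)"
  by (simp add: unitization_def multiplier_norm_def)

lemma cnorm_multiplier_le:
  assumes a: "a \<in> carrier A" and b: "b \<in> carrier A" "cnorm A b \<le> 1"
  shows "cnorm A (a \<otimes> b \<oplus> l \<odot> b) \<le> cnorm A a + cmod l"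
proof -
  have "cnorm A (a \<otimes> b \<oplus> l \<odot> b) \<le> cnorm A a * cnorm A b + cmod l * cnorm A b"
    using a b cnorm_add[of "a \<otimes> b" "l \<odot> b"] cnorm_mult[of a b] by (simp add: cnorm_smult)
  also have "\<dots> \<le> cnorm A a * 1 + cmod l * 1"
    using a b by (intro add_mono mult_left_mono) auto
  finally show ?thesis by simp
qed

lemma cnorm_le_multiplier_norm:
  assumes "a \<in> carrier A" "b \<in> carrier A" "cnorm A b \<le> 1"
  shows "cnorm A (a \<otimes> b \<oplus> l \<odot> b) \<le> multiplier_norm a l"
  unfolding multiplier_norm_def
  using assms cnorm_multiplier_le[OF assms(1)] by (intro cSUP_upper bdd_aboveI2) auto

lemma multiplier_norm_le:
  assumes "\<And>b. b \<in> carrier A \<Longrightarrow> cnorm A b \<le> 1 \<Longrightarrow> cnorm A (a \<otimes> b \<oplus> l \<odot> b) \<le> C"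
  shows "multiplier_norm a l \<le> C"
  unfolding multiplier_norm_def
  by (rule cSUP_least) (use assms in \<open>auto intro!: exI[of _ \<zero>]\<close>)

text \<open>Left multiplication by \<open>a\<close> attains its norm at the normalized adjoint of \<open>a\<close>, by the C*-identity.
  Hence the norm of the unitization is equivalent to the sum norm, up to the factor \<open>3\<close>.\<close>

lemma cnorm_le_unitization:
  assumes a: "a \<in> carrier A"
  shows "cnorm A a \<le> multiplier_norm a l + cmod l"
proof (cases "cnorm A a = 0")
  case True
  have "0 \<le> multiplier_norm a l"
    using cnorm_le_multiplier_norm[OF a, of \<zero> l] a by simp
  then show ?thesis using True by simp
next
  case False
  then have pos: "cnorm A a > 0" using a cnorm_nonneg[OF a] by linarith
  define b where "b = complex_of_real (1 / cnorm A a) \<odot> adj A a"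
  have b: "b \<in> carrier A" "cnorm A b = 1"
    using a pos by (simp_all add: b_def cnorm_smult norm_divide)
  have "cnorm A (a \<otimes> adj A a) = (cnorm A a)\<^sup>2"
    using cstar_identity[of "adj A a"] a by (simp add: adj_adj)
  then have "cnorm A (a \<otimes> b) = cnorm A a"
    using a pos by (simp add: b_def smult_mult_right cnorm_smult norm_divide power2_eq_square)
  moreover have "cnorm A (a \<otimes> b) \<le> cnorm A (a \<otimes> b \<oplus> l \<odot> b) + cnorm A (l \<odot> b)"
  proof -
    have "a \<otimes> b = (a \<otimes> b \<oplus> l \<odot> b) \<ominus> l \<odot> b"
      using a b by (simp add: a_minus_def a_assoc r_neg)
    then show ?thesis
      using cnorm_minus_le[of "a \<otimes> b \<oplus> l \<odot> b" "l \<odot> b"] a b by simp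
  qed
  moreover have "cnorm A (a \<otimes> b \<oplus> l \<odot> b) \<le> multiplier_norm a l"
    using a b by (intro cnorm_le_multiplier_norm) auto
  ultimately show ?thesis
    using b by (simp add: cnorm_smult)
qed

lemma cnorm_unitization_le: "a \<in> carrier A \<Longrightarrow> cnorm (unitization A) (a, l) \<le> cnorm A a + cmod l"
  using multiplier_norm_le[OF cnorm_multiplier_le, of a l] by (simp add: cnorm_unitization)

lemma sum_norm_le_cnorm_unitization: 
  "a \<in> carrier A \<Longrightarrow> cnorm A a + cmod l \<le> 3 * cnorm (unitization A) (a, l)"
  using cnorm_le_unitization[of a l] by (simp add: cnorm_unitization)

lemma Metric_space_unitization: "Metric_space (carrier (unitization A)) (cstar_dist (unitization A))"
proof
  let ?U = "unitization A"
  have d: "cstar_dist ?U (a, l) (b, m) = max (cmod (l - m)) (multiplier_norm (a \<ominus> b) (l - m))"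
    if "a \<in> carrier A" "b \<in> carrier A" for a b l m
    using that by (simp add: cstar_dist_def minus_unitization cnorm_unitization)
  have d0: "cstar_dist ?U x y = 0" if "x \<notin> carrier ?U \<or> y \<notin> carrier ?U" for x y
    using that by (auto simp: cstar_dist_def)
  have sym: "multiplier_norm (a \<ominus> b) (l - m) \<le> multiplier_norm (b \<ominus> a) (m - l)"
    if ab: "a \<in> carrier A" "b \<in> carrier A" for a b l m
  proof (rule multiplier_norm_le)
    fix c assume c: "c \<in> carrier A" "cnorm A c \<le> 1"
    have "(a \<ominus> b) \<otimes> c \<oplus> (l - m) \<odot> c = (-1) \<odot> ((b \<ominus> a) \<otimes> c \<oplus> (m - l) \<odot> c)"
      using ab c by (simp add: minus_eq_smult distrib_right smult_mult_left smult_add smult_smult a_comm)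
    then have "cnorm A ((a \<ominus> b) \<otimes> c \<oplus> (l - m) \<odot> c) = cnorm A ((b \<ominus> a) \<otimes> c \<oplus> (m - l) \<odot> c)"
      using ab c by (simp add: cnorm_smult)
    also have "\<dots> \<le> multiplier_norm (b \<ominus> a) (m - l)"
      using ab c by (intro cnorm_le_multiplier_norm) auto
    finally show "cnorm A ((a \<ominus> b) \<otimes> c \<oplus> (l - m) \<odot> c) \<le> multiplier_norm (b \<ominus> a) (m - l)" .
  qed
  fix x y z
  show "0 \<le> cstar_dist ?U x y"
    by (cases x; cases y) (auto simp: cstar_dist_def minus_unitization cnorm_unitization le_max_iff_disj)
  show "cstar_dist ?U x y = cstar_dist ?U y x"
  proof (cases "x \<in> carrier ?U \<and> y \<in> carrier ?U")
    case True
    then obtain a l b m where "x = (a, l)" "y = (b, m)" "a \<in> carrier A" "b \<in> carrier A" by auto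
    then show ?thesis
      using sym[of a b l m] sym[of b a m l] by (simp add: d norm_minus_commute)
  next
    case False
    then show ?thesis using d0[of x y] d0[of y x] by metis
  qed
  assume x: "x \<in> carrier ?U" and y: "y \<in> carrier ?U"
  then obtain a l b m where xy: "x = (a, l)" "y = (b, m)" "a \<in> carrier A" "b \<in> carrier A" by auto
  show "cstar_dist ?U x y = 0 \<longleftrightarrow> x = y"
  proof
    assume "cstar_dist ?U x y = 0"
    then have 0: "max (cmod (l - m)) (multiplier_norm (a \<ominus> b) (l - m)) = 0"
      using xy by (simp add: d)
    then have "l = m"
      by (metis max.cobounded1 norm_le_zero_iff right_minus_eq)
    moreover have "multiplier_norm (a \<ominus> b) (l - m) \<le> 0"
      using 0 by (metis max.cobounded2)
    ultimately have "cnorm A (a \<ominus> b) \<le> 0"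
      using cnorm_le_unitization[of "a \<ominus> b" "l - m"] xy by simp
    then have "cnorm A (a \<ominus> b) = 0"
      using xy by (intro antisym) auto
    then show "x = y"
      using xy \<open>l = m\<close> by (simp add: cnorm_eq_0 minus_eq_0_iff)
  next
    assume "x = y"
    moreover have "multiplier_norm \<zero> 0 \<le> 0"
      by (rule multiplier_norm_le) simp
    ultimately show "cstar_dist ?U x y = 0"
      using xy by (simp add: d minus_eq_0_iff[THEN iffD2])
  qed
  assume "z \<in> carrier ?U"
  then obtain c n where z: "z = (c, n)" "c \<in> carrier A" by auto
  have "multiplier_norm (a \<ominus> c) (l - n) \<le> multiplier_norm (a \<ominus> b) (l - m) + multiplier_norm (b \<ominus> c) (m - n)"
  proof (rule multiplier_norm_le)
    fix e assume e: "e \<in> carrier A" "cnorm A e \<le> 1"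
    have "(a \<ominus> c) \<otimes> e \<oplus> (l - n) \<odot> e = ((a \<ominus> b) \<oplus> (b \<ominus> c)) \<otimes> e \<oplus> ((l - m) + (m - n)) \<odot> e"
      using xy z by (simp add: minus_add_minus)
    also have "\<dots> = ((a \<ominus> b) \<otimes> e \<oplus> (l - m) \<odot> e) \<oplus> ((b \<ominus> c) \<otimes> e \<oplus> (m - n) \<odot> e)"
      using xy z e by (simp only: distrib_right smult_add_scalar minus_closed) 
        (simp add: a_assoc a_comm a_lcomm)
    finally have "cnorm A ((a \<ominus> c) \<otimes> e \<oplus> (l - n) \<odot> e) \<le> 
        cnorm A ((a \<ominus> b) \<otimes> e \<oplus> (l - m) \<odot> e) + cnorm A ((b \<ominus> c) \<otimes> e \<oplus> (m - n) \<odot> e)"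
      using xy z e by (simp add: cnorm_add)
    then show "cnorm A ((a \<ominus> c) \<otimes> e \<oplus> (l - n) \<odot> e) \<le> 
        multiplier_norm (a \<ominus> b) (l - m) + multiplier_norm (b \<ominus> c) (m - n)"
      using cnorm_le_multiplier_norm[of "a \<ominus> b" e "l - m"] cnorm_le_multiplier_norm[of "b \<ominus> c" e "m - n"] xy z e
      by simp
  qed
  moreover have "cmod (l - n) \<le> cmod (l - m) + cmod (m - n)"
    using norm_triangle_ineq[of "l - m" "m - n"] by simp
  ultimately show "cstar_dist ?U x z \<le> cstar_dist ?U x y + cstar_dist ?U y z"
    using xy z by (simp add: d) linarith
qed

lemma topological_star_ring_unitization: "topological_star_ring (unitization A)"
  by (intro topological_star_ring.intro star_ring_unitization topological_star_ring_axioms.intro)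
    (simp only: cstar_topology_def Metric_space.topspace_mtopology[OF Metric_space_unitization])

lemma star_ring_hom_snd: "star_ring_hom (unitization A) complex_cstar snd"
  by (intro star_ring_hom.intro star_ring_unitization star_ring_complex) (unfold_locales, auto)

end

lemma unitization_map_apply [simp]: "unitization_map \<phi> (a, l) = (\<phi> a, l)"
  by (simp add: unitization_map_def)

lemma star_hom_zero:
  assumes A: "pre_cstar_algebra A" and B: "pre_cstar_algebra B" and \<phi>: "star_hom A B \<phi>"
  shows "\<phi> \<zero>\<^bsub>A\<^esub> = \<zero>\<^bsub>B\<^esub>"
proof -
  interpret A: pre_cstar_algebra A by fact
  interpret B: pre_cstar_algebra B by fact
  have "\<forall>c. \<forall>a\<in>carrier A. \<phi> (c \<odot>\<^bsub>A\<^esub> a) = c \<odot>\<^bsub>B\<^esub> \<phi> a" and "\<phi> \<zero>\<^bsub>A\<^esub> \<in> carrier B"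
    using \<phi> A.zero_closed by (auto simp: star_hom_def)
  from this(1)[rule_format, of "\<zero>\<^bsub>A\<^esub>" 0] this(2) show ?thesis by simp
qed

lemma star_ring_hom_unitization_map:
  assumes A: "pre_cstar_algebra A" and B: "pre_cstar_algebra B" and \<phi>: "star_hom A B \<phi>"
  shows "star_ring_hom (unitization A) (unitization B) (unitization_map \<phi>)"
proof -
  interpret A: pre_cstar_algebra A by fact
  interpret B: pre_cstar_algebra B by fact
  have "star_ring_hom_axioms (unitization A) (unitization B) (unitization_map \<phi>)"
    using \<phi> star_hom_zero[OF A B \<phi>] by unfold_locales (auto simp: star_hom_def)
  then show ?thesis
    by (intro star_ring_hom.intro A.star_ring_unitization B.star_ring_unitization)
qed

text \<open>By the equivalence with the sum norm, the induced map is Lipschitz.\<close>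

lemma continuous_map_unitization_map:
  assumes A: "pre_cstar_algebra A" and B: "pre_cstar_algebra B" and \<phi>: "star_hom A B \<phi>"
    and le: "\<And>a. a \<in> carrier A \<Longrightarrow> cnorm B (\<phi> a) \<le> cnorm A a"
  shows "continuous_map (cstar_topology (unitization A)) (cstar_topology (unitization B)) (unitization_map \<phi>)"
proof -
  interpret A: pre_cstar_algebra A by fact
  interpret B: pre_cstar_algebra B by fact
  let ?U = "unitization A" and ?V = "unitization B"
  interpret U: Metric_space "carrier ?U" "cstar_dist ?U" by (rule A.Metric_space_unitization)
  interpret V: Metric_space "carrier ?V" "cstar_dist ?V" by (rule B.Metric_space_unitization)
  have c: "\<phi> a \<in> carrier B" if "a \<in> carrier A" for a
    using \<phi> that by (auto simp: star_hom_def)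
  have minus: "\<phi> (a \<ominus>\<^bsub>A\<^esub> b) = \<phi> a \<ominus>\<^bsub>B\<^esub> \<phi> b" if "a \<in> carrier A" "b \<in> carrier A" for a b
    using \<phi> that by (simp add: star_hom_def A.minus_eq_smult B.minus_eq_smult c)
  have lip: "cstar_dist ?V (unitization_map \<phi> x) (unitization_map \<phi> y) \<le> 3 * cstar_dist ?U x y"
    if xyU: "x \<in> carrier ?U" "y \<in> carrier ?U" for x y
  proof -
    obtain a l b m where xy: "x = (a, l)" "y = (b, m)" "a \<in> carrier A" "b \<in> carrier A" using xyU by auto
    have "cstar_dist ?V (unitization_map \<phi> x) (unitization_map \<phi> y) = cnorm ?V (\<phi> (a \<ominus>\<^bsub>A\<^esub> b), l - m)"
      using xy by (simp add: cstar_dist_def c B.minus_unitization minus)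
    also have "\<dots> \<le> cnorm B (\<phi> (a \<ominus>\<^bsub>A\<^esub> b)) + cmod (l - m)"
      using xy by (intro B.cnorm_unitization_le c) auto
    also have "\<dots> \<le> cnorm A (a \<ominus>\<^bsub>A\<^esub> b) + cmod (l - m)"
      using le[of "a \<ominus>\<^bsub>A\<^esub> b"] xy by simp
    also have "\<dots> \<le> 3 * cnorm ?U (a \<ominus>\<^bsub>A\<^esub> b, l - m)"
      using xy by (intro A.sum_norm_le_cnorm_unitization) auto
    also have "\<dots> = 3 * cstar_dist ?U x y"
      using xy by (simp add: cstar_dist_def A.minus_unitization)
    finally show ?thesis .
  qed
  show ?thesis
    unfolding cstar_topology_def U.metric_continuous_map[OF V.Metric_space_axioms]
  proof (intro conjI ballI allI impI)
    show "unitization_map \<phi> ` carrier ?U \<subseteq> carrier ?V"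
      using c by auto
    fix x \<epsilon> assume x: "x \<in> carrier ?U" and "\<epsilon> > (0::real)"
    show "\<exists>\<delta>>0. \<forall>y. y \<in> carrier ?U \<and> cstar_dist ?U x y < \<delta> \<longrightarrow>
        cstar_dist ?V (unitization_map \<phi> x) (unitization_map \<phi> y) < \<epsilon>"
    proof (intro exI[of _ "\<epsilon> / 3"] conjI allI impI)
      fix y assume "y \<in> carrier ?U \<and> cstar_dist ?U x y < \<epsilon> / 3"
      then show "cstar_dist ?V (unitization_map \<phi> x) (unitization_map \<phi> y) < \<epsilon>"
        using lip[OF x, of y] by linarith
    qed (use \<open>\<epsilon> > 0\<close> in simp)
  qed
qed

lemma inj_on_unitization_map: "inj_on \<phi> (carrier A) \<Longrightarrow> inj_on (unitization_map \<phi>) (carrier (unitization A))"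
  by (auto simp: inj_on_def)


section \<open>Lifting classes in K-theory\<close>

text \<open>The lifted projections represent a class of \<open>K\<^sub>0(A)\<close>, not just of its unitization, because \<open>\<phi>\<close> does not
  change the scalar parts of the entries.\<close>

lemma K0_class_lift:
  assumes A: "pre_cstar_algebra A" and B: "pre_cstar_algebra B" and \<phi>: "injective_star_hom A B \<phi>"
    and p: "p \<in> projections (unitization B)" and q: "q \<in> projections (unitization B)"
    and K: "K0_rel (unitization B) `` {(p, q)} \<in> carrier (K0 B)"
    and im: "\<And>i j. fst (snd p i j) \<in> \<phi> ` carrier A" "\<And>i j. fst (snd q i j) \<in> \<phi> ` carrier A"
  shows "K0_rel (unitization B) `` {(p, q)} \<in> K0_map B \<phi> ` carrier (K0 A)"
proof -
  interpret A: pre_cstar_algebra A by fact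
  interpret B: pre_cstar_algebra B by fact
  let ?U = "unitization A" and ?V = "unitization B" and ?F = "unitization_map \<phi>"
  have hom: "star_hom A B \<phi>" and inj: "inj_on ?F (carrier ?U)"
    using \<phi> inj_on_unitization_map by (auto simp: injective_star_hom_def)
  interpret F: star_ring_hom ?U ?V ?F
    by (rule star_ring_hom_unitization_map[OF A B hom])
  interpret SU: star_ring_hom ?U complex_cstar snd by (rule A.star_ring_hom_snd)
  interpret SV: star_ring_hom ?V complex_cstar snd by (rule B.star_ring_hom_snd)
  have lift: "x \<in> ?F ` carrier ?U" if "fst x \<in> \<phi> ` carrier A" for x
    using that by (cases x) (force simp: image_iff)
  obtain p' where p': "p' \<in> projections ?U" "sqmat_map ?F p' = p"
    using F.projection_lift[OF inj p lift[OF im(1)]] .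
  obtain q' where q': "q' \<in> projections ?U" "sqmat_map ?F q' = q"
    using F.projection_lift[OF inj q lift[OF im(2)]] .
  have snd: "sqmat_map snd (sqmat_map ?F r) = sqmat_map snd r" for r
    by (cases r) (simp add: sqmat_map_def unitization_map_def case_prod_unfold)
  let ?k = "K0_rel ?U `` {(p', q')}"
  have "K0_unital_map complex_cstar snd ?k = K0_unital_map complex_cstar snd (K0_rel ?V `` {(p, q)})"
    unfolding SU.K0_unital_map_class[OF p'(1) q'(1)] SV.K0_unital_map_class[OF p q]
    by (simp only: snd p'(2)[symmetric] q'(2)[symmetric])
  then have "?k \<in> carrier (K0 A)"
    using K p' q' by (auto simp: K0_def kernel_def K0_unital_def intro: quotientI)
  moreover have "K0_map B \<phi> ?k = K0_rel ?V `` {(p, q)}"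
    unfolding K0_map_def F.K0_unital_map_class[OF p'(1) q'(1)] p'(2) q'(2) ..
  ultimately show ?thesis
    by (metis image_eqI)
qed

lemma K1_class_lift:
  assumes A: "pre_cstar_algebra A" and B: "pre_cstar_algebra B" and \<phi>: "injective_star_hom A B \<phi>"
    and le: "\<And>a. a \<in> carrier A \<Longrightarrow> cnorm B (\<phi> a) \<le> cnorm A a"
    and u: "u \<in> unitaries (unitization B)" and im: "\<And>i j. fst (snd u i j) \<in> \<phi> ` carrier A"
  shows "K1_rel (unitization B) `` {u} \<in> K1_map B \<phi> ` carrier (K1 A)"
proof -
  interpret A: pre_cstar_algebra A by fact
  interpret B: pre_cstar_algebra B by fact
  let ?U = "unitization A" and ?V = "unitization B" and ?F = "unitization_map \<phi>"
  have hom: "star_hom A B \<phi>" and inj: "inj_on ?F (carrier ?U)"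
    using \<phi> inj_on_unitization_map by (auto simp: injective_star_hom_def)
  interpret F: star_ring_hom ?U ?V ?F
    by (rule star_ring_hom_unitization_map[OF A B hom])
  have lift: "x \<in> ?F ` carrier ?U" if "fst x \<in> \<phi> ` carrier A" for x
    using that by (cases x) (force simp: image_iff)
  obtain u' where u': "u' \<in> unitaries ?U" "sqmat_map ?F u' = u"
    using F.unitary_lift[OF inj u lift[OF im]] .
  have "K1_map B \<phi> (K1_rel ?U `` {u'}) = K1_rel ?V `` {u}"
    unfolding K1_map_def
    using F.K1_map_class[OF B.topological_star_ring_unitization A.topological_star_ring_unitization 
      continuous_map_unitization_map[OF A B hom le] u'(1)] u'(2) by simp
  moreover have "K1_rel ?U `` {u'} \<in> carrier (K1 A)"
    using u' by (auto simp: K1_def intro: quotientI)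
  ultimately show ?thesis
    by (metis image_eqI)
qed


section \<open>Metrizable compactifications dominating countably many functions\<close>

text \<open>Closed balls of integral radius are compact, hence totally bounded, and exhaust the space.\<close>

lemma dense_sequence:
  assumes coarse: "\<And>S :: 'x::metric_space set. bounded S \<Longrightarrow> compact (closure S)"
  obtains x :: "nat \<Rightarrow> 'x::metric_space" where "\<And>y \<epsilon>. \<epsilon> > 0 \<Longrightarrow> \<exists>k. dist (x k) y < \<epsilon>"
proof -
  define a :: 'x where "a = undefined"
  have "\<exists>K. finite K \<and> closure (cball a (real n)) \<subseteq> (\<Union>k\<in>K. ball k (1 / Suc m))" for n m :: nat
    using coarse[OF bounded_cball, of a "real n"] unfolding compact_eq_totally_bounded by simp
  then obtain K where K: "\<And>n m. finite (K n m)" "\<And>n m. closure (cball a (real n)) \<subseteq> (\<Union>k\<in>K n m. ball k (1 / Suc m))"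
    by metis
  define D where "D = (\<Union>n. \<Union>m. K n m)"
  \<comment> \<open>the finite sets \<open>K n m\<close> are nets for all balls and all scales\<close>
  have near: "\<exists>k\<in>D. dist k y < \<epsilon>" if \<epsilon>: "\<epsilon> > 0" for y \<epsilon>
  proof -
    obtain n where n: "dist a y \<le> real n" using real_arch_simple by blast
    obtain m where m: "1 / Suc m < \<epsilon>" using nat_approx_posE[OF \<epsilon>] .
    have "y \<in> closure (cball a (real n))" using n by simp
    then obtain k where "k \<in> K n m" "dist k y < 1 / Suc m"
      using K(2)[of n m] by auto
    then show ?thesis using m by (intro bexI[of _ k]) (auto simp: D_def)
  qed
  have "countable D"
    unfolding D_def using K(1) by (intro countable_UN countableI_type) (auto intro: countable_finite)
  moreover have "D \<noteq> {}" using near[of 1 a] by auto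
  ultimately have "range (from_nat_into D) = D"
    by (rule range_from_nat_into[rotated])
  then have "\<exists>k. dist (from_nat_into D k) y < \<epsilon>" if "\<epsilon> > 0" for y \<epsilon>
    using near[OF that, of y] by (metis imageE)
  then show thesis by (rule that)
qed

text \<open>The map \<open>\<Phi> : \<eta>X \<rightarrow> \<real>\<^sup>\<nat>\<close> has two kinds of coordinates: bump functions at a dense sequence of \<open>X\<close>, which
  make it an embedding of \<open>X\<close>, and the distances of each \<open>F t\<close> from its values along the dense sequence,
  which determine \<open>F t\<close>. The compactification is the image of \<open>\<Phi>\<close>. As \<open>\<Phi>\<close> is a quotient map onto its
  image, each \<open>F t\<close> factors continuously through it.\<close>

lemma dominating_compactification:
  fixes F :: "nat \<Rightarrow> (('x::metric_space \<Rightarrow> complex) \<Rightarrow> complex) \<Rightarrow> 'b"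
  assumes coarse: "\<And>S :: 'x set. bounded S \<Longrightarrow> compact (closure S)"
    and B: "pre_cstar_algebra B" 
    and F: "\<And>t. continuous_map higson_compactification (cstar_topology B) (F t)"
  obtains Z :: "(nat \<Rightarrow> real) topology" and i :: "'x \<Rightarrow> nat \<Rightarrow> real" and \<pi> 
    where "admissible_compactification Z i" "is_higson_extension Z i \<pi>"
      "\<And>t. \<exists>G. continuous_map Z (cstar_topology B) G \<and> (\<forall>\<omega>\<in>topspace higson_compactification. G (\<pi> \<omega>) = F t \<omega>)"
proof -
  interpret B: pre_cstar_algebra B by fact
  let ?Y = "higson_compactification :: (('x \<Rightarrow> complex) \<Rightarrow> complex) topology"
  let ?e = "higson_embedding :: 'x \<Rightarrow> ('x \<Rightarrow> complex) \<Rightarrow> complex"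
  obtain x :: "nat \<Rightarrow> 'x" where x: "\<And>y \<epsilon>. \<epsilon> > 0 \<Longrightarrow> \<exists>k. dist (x k) y < \<epsilon>"
    using dense_sequence[OF coarse] by metis
  define \<psi> where "\<psi> k = (\<lambda>y. complex_of_real (max 0 (1 - dist (x k) y)))" for k
  have \<psi>: "\<psi> k \<in> carrier higson_algebra" for k
    unfolding \<psi>_def by (rule bump_in_higson_algebra[OF coarse])
  define D where "D t k \<omega> = cnorm B (F t \<omega> \<ominus>\<^bsub>B\<^esub> F t (?e (x k)))" for t k \<omega>
  define \<Phi> where "\<Phi> \<omega> c = (case prod_decode c of (0, k) \<Rightarrow> Re (\<omega> (\<psi> k)) | (Suc t, k) \<Rightarrow> D t k \<omega>)" for \<omega> c
  have \<Phi>0: "\<Phi> \<omega> (prod_encode (0, k)) = Re (\<omega> (\<psi> k))" and \<Phi>S: "\<Phi> \<omega> (prod_encode (Suc t, k)) = D t k \<omega>" for \<omega> t k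
    by (simp_all add: \<Phi>_def)
  have Fc: "F t \<omega> \<in> carrier B" if "\<omega> \<in> topspace ?Y" for t \<omega>
    by (rule B.continuous_map_in_carrier[OF F that])
  have cont_minus: "continuous_map ?Y (cstar_topology B) (\<lambda>\<omega>. F t \<omega> \<ominus>\<^bsub>B\<^esub> b)" if "b \<in> carrier B" for t b
    unfolding a_minus_def using that by (intro B.continuous_map_add_cstar F B.continuous_map_const_cstar) simp
  have cont_coord: "continuous_map ?Y euclideanreal (\<lambda>\<omega>. \<Phi> \<omega> c)" for c
  proof -
    obtain s k where c: "c = prod_encode (s, k)" by (metis prod_decode_inverse surj_pair)
    show ?thesis
    proof (cases s)
      case 0
      have "continuous_map ?Y euclideanreal (Re \<circ> (\<lambda>\<omega>. \<omega> (\<psi> k)))"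
        by (rule continuous_map_compose[OF continuous_map_evaluation[OF \<psi>]]) (auto intro: continuous_intros)
      then show ?thesis by (simp add: c 0 \<Phi>0 o_def)
    next
      case (Suc t)
      have "continuous_map ?Y euclideanreal (D t k)"
        unfolding D_def by (intro B.continuous_map_cnorm cont_minus Fc) simp
      then show ?thesis by (simp add: c Suc \<Phi>S)
    qed
  qed
  define T where "T = product_topology (\<lambda>_ :: nat. euclideanreal) UNIV"
  define Z where "Z = subtopology T (\<Phi> ` topspace ?Y)"
  define i where "i y = \<Phi> (?e y)" for y
  have topT: "topspace T = UNIV" by (simp add: T_def)
  have topZ: "topspace Z = \<Phi> ` topspace ?Y" by (simp add: Z_def topT)
  have contT: "continuous_map ?Y T \<Phi>"
    unfolding T_def by (rule continuous_map_componentwise_UNIV[THEN iffD2]) (use cont_coord in blast)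
  then have cont: "continuous_map ?Y Z \<Phi>"
    by (simp add: Z_def continuous_map_in_subtopology)
  have compZ: "compact_space Z"
    unfolding Z_def by (intro compact_space_subtopology image_compactin[OF _ contT])
      (metis compact_higson_compactification compact_space_def)
  have metrT: "metrizable_space T"
    unfolding T_def by (simp add: metrizable_space_product_topology metrizable_space_euclidean)
  then have metrZ: "metrizable_space Z"
    unfolding Z_def by (rule metrizable_space_subtopology)
  have HausZ: "Hausdorff_space Z"
    using metrZ by (rule metrizable_imp_Hausdorff_space)
  have conti: "continuous_map euclidean Z i"
    using continuous_map_compose[OF continuous_map_higson_embedding cont] by (simp add: i_def[abs_def] o_def)
  have close: "Z closure_of (range i) = topspace Z"
  proof
    have "\<Phi> ` (?Y closure_of (range ?e)) \<subseteq> Z closure_of (\<Phi> ` range ?e)"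
      by (rule continuous_map_image_closure_subset[OF cont])
    then show "topspace Z \<subseteq> Z closure_of (range i)"
      by (simp add: dense_higson_embedding topZ i_def image_image)
  qed (rule closure_of_subset_topspace)
  \<comment> \<open>a coordinate that exceeds \<open>r\<close> at \<open>y\<close> exceeds it only near \<open>y\<close>; this gives injectivity and openness\<close>
  have separate: "\<exists>k r. i y (prod_encode (0, k)) > r \<and> (\<forall>y'. i y' (prod_encode (0, k)) > r \<longrightarrow> dist y y' < \<epsilon>)"
    if \<epsilon>: "\<epsilon> > 0" for y \<epsilon>
  proof -
    \<comment> \<open>\<open>3 \<delta> \<le> 1\<close> keeps the threshold \<open>1 - 2 \<delta>\<close> positive, where the bump function determines the distance\<close>
    define \<delta> where "\<delta> = min 1 \<epsilon> / 3"
    have \<delta>: "\<delta> > 0" "3 * \<delta> \<le> 1" "3 * \<delta> \<le> \<epsilon>" using \<epsilon> by (auto simp: \<delta>_def)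
    obtain k where k: "dist (x k) y < \<delta>" using x[OF \<delta>(1)] by blast
    have i: "i y' (prod_encode (0, k)) = max 0 (1 - dist (x k) y')" for y'
      by (simp add: i_def \<Phi>0 higson_embedding_apply[OF \<psi>]) (simp add: \<psi>_def)
    show ?thesis
    proof (intro exI[of _ k] exI[of _ "1 - 2 * \<delta>"] conjI allI impI)
      show "1 - 2 * \<delta> < i y (prod_encode (0, k))"
        unfolding i using k \<delta> by simp
      fix y' assume "1 - 2 * \<delta> < i y' (prod_encode (0, k))"
      then have "dist (x k) y' < 2 * \<delta>"
        unfolding i using \<delta> by (simp add: max_def split: if_splits)
      then show "dist y y' < \<epsilon>"
        using k \<delta> dist_triangle[of y y' "x k"] by (simp add: dist_commute)
    qed
  qed
  have inj: "inj i"
  proof (rule injI, rule ccontr)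
    fix y y' assume "i y = i y'" "y \<noteq> y'"
    then show False
      using separate[of "dist y y'" y] by auto
  qed
  have "open_map euclidean (subtopology Z (range i)) i"
    unfolding open_map_def
  proof (intro allI impI)
    fix U :: "'x set" assume U: "openin euclidean U"
    show "openin (subtopology Z (range i)) (i ` U)"
    proof (subst openin_subopen, intro ballI)
      fix z assume "z \<in> i ` U"
      then obtain y where y: "y \<in> U" "z = i y" by blast
      obtain \<epsilon> where \<epsilon>: "\<epsilon> > 0" "ball y \<epsilon> \<subseteq> U"
        using U y by (meson open_contains_ball open_openin)
      obtain k r where kr: "i y (prod_encode (0, k)) > r" 
          "\<And>y'. i y' (prod_encode (0, k)) > r \<Longrightarrow> dist y y' < \<epsilon>"
        using separate[OF \<epsilon>(1)] by blast
      let ?W = "{z \<in> topspace (subtopology Z (range i)). z (prod_encode (0, k)) \<in> {r<..}}"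
      have "continuous_map (subtopology Z (range i)) euclideanreal (\<lambda>z. z (prod_encode (0, k)))"
        unfolding Z_def T_def
        by (intro continuous_map_from_subtopology continuous_map_product_projection) simp
      then have "openin (subtopology Z (range i)) ?W"
        by (rule openin_continuous_map_preimage) simp
      moreover have "z \<in> ?W"
        using y kr(1) by (simp add: topZ i_def)
      moreover have "?W \<subseteq> i ` U"
      proof
        fix z' assume "z' \<in> ?W"
        then obtain y' where "z' = i y'" "i y' (prod_encode (0, k)) > r" by auto
        moreover from this(2) have "y' \<in> U" using kr(2)[of y'] \<epsilon>(2) by auto
        ultimately show "z' \<in> i ` U" by blast
      qed
      ultimately show "\<exists>W. openin (subtopology Z (range i)) W \<and> z \<in> W \<and> W \<subseteq> i ` U"
        by blast
    qed
  qed
  then have "embedding_map euclidean Z i"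
    unfolding embedding_map_def using conti inj
    by (intro bijective_open_imp_homeomorphic_map) 
      (auto simp: continuous_map_in_subtopology topZ i_def)
  then have compactification: "compactification Z i"
    by (simp add: compactification_def compZ HausZ close)
  obtain M d where Md: "Metric_space M d" "Z = Metric_space.mtopology M d"
    using metrZ by (auto simp: metrizable_space_def)
  have M: "M = topspace Z"
    unfolding Md(2) by (simp add: Metric_space.topspace_mtopology[OF Md(1)])
  have "vanishing_variation d i"
    unfolding i_def using vanishing_variation_if_continuous[OF Md(1)] cont unfolding Md(2) by blast
  then have adm: "admissible_compactification Z i"
    unfolding admissible_compactification_def 
    using compactification Md(1)[unfolded M] Md(2)[unfolded M, symmetric] by blast
  define \<pi> where "\<pi> = restrict \<Phi> (topspace ?Y)"
  have ext: "is_higson_extension Z i \<pi>"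
    unfolding is_higson_extension_def \<pi>_def using cont 
    by (auto simp: i_def elim!: continuous_map_eq)
  have factor: "\<exists>G. continuous_map Z (cstar_topology B) G \<and> (\<forall>\<omega>\<in>topspace ?Y. G (\<pi> \<omega>) = F t \<omega>)" for t
  proof -
    have determined: "F t \<omega> = F t \<omega>'" 
      if \<omega>: "\<omega> \<in> topspace ?Y" and \<omega>': "\<omega>' \<in> topspace ?Y" and eq: "\<Phi> \<omega> = \<Phi> \<omega>'" for \<omega> \<omega>'
    proof -
      have D: "D t k \<omega> = D t k \<omega>'" for k
        using fun_cong[OF eq, of "prod_encode (Suc t, k)"] by (simp add: \<Phi>S)
      have "cnorm B (F t \<omega> \<ominus>\<^bsub>B\<^esub> F t \<omega>') \<le> \<epsilon>" if \<epsilon>: "\<epsilon> > 0" for \<epsilon>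
      proof -
        define W where "W = {\<omega>' \<in> topspace ?Y. cnorm B (F t \<omega>' \<ominus>\<^bsub>B\<^esub> F t \<omega>) \<in> {..<\<epsilon> / 2}}"
        have W: "openin ?Y W"
          unfolding W_def
          by (rule openin_continuous_map_preimage[OF B.continuous_map_cnorm[OF cont_minus[OF Fc[OF \<omega>]]]]) simp
        have "\<omega> \<in> W"
          using \<omega> \<epsilon> Fc[OF \<omega>] by (simp add: W_def B.minus_eq_0_iff[THEN iffD2])
        then obtain y where y: "?e y \<in> W"
          by (rule dense_higson_embeddingE[OF W])
        have opn: "open {y. ?e y \<in> W}"
          using openin_continuous_map_preimage[OF continuous_map_higson_embedding W] by simp
        have "y \<in> {y. ?e y \<in> W}"
          using y by simp
        then obtain \<delta> where \<delta>: "\<delta> > 0" "ball y \<delta> \<subseteq> {y. ?e y \<in> W}"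
          by (rule openE[OF opn])
        obtain k where "dist (x k) y < \<delta>"
          using x[OF \<delta>(1)] by blast
        then have "?e (x k) \<in> W"
          using \<delta>(2) by (auto simp: dist_commute)
        then have "D t k \<omega> < \<epsilon> / 2"
          using B.cnorm_minus_commute[OF Fc Fc, of \<omega> "?e (x k)" t t] \<omega> by (simp add: D_def W_def)
        moreover have "cnorm B (F t \<omega> \<ominus>\<^bsub>B\<^esub> F t \<omega>') \<le> D t k \<omega> + D t k \<omega>'"
          using B.cnorm_triangle[OF Fc[OF \<omega>] Fc[of "?e (x k)"] Fc[OF \<omega>'], of t t t]
            B.cnorm_minus_commute[OF Fc[OF \<omega>'] Fc[of "?e (x k)"], of t t] by (simp add: D_def)
        ultimately show ?thesis using D[of k] by simp
      qed
      then have "cnorm B (F t \<omega> \<ominus>\<^bsub>B\<^esub> F t \<omega>') \<le> 0"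
        by (rule field_le_epsilon) simp
      then have "cnorm B (F t \<omega> \<ominus>\<^bsub>B\<^esub> F t \<omega>') = 0"
        using Fc[OF \<omega>] Fc[OF \<omega>'] by (intro antisym) auto
      then show ?thesis
        using Fc[OF \<omega>] Fc[OF \<omega>'] by (simp add: B.cnorm_eq_0 B.minus_eq_0_iff)
    qed
    have quotient: "quotient_map ?Y Z \<Phi>"
      by (rule continuous_imp_quotient_map[OF cont compact_higson_compactification HausZ topZ[symmetric]])
    obtain G where "continuous_map Z (cstar_topology B) G" "\<And>\<omega>. \<omega> \<in> topspace ?Y \<Longrightarrow> G (\<Phi> \<omega>) = F t \<omega>"
      by (rule quotient_map_lift_exists[OF quotient F[of t]]) (use determined in blast)+
    then show ?thesis by (auto simp: \<pi>_def)
  qed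
  show thesis
    by (rule that[OF adm ext factor])
qed

text \<open>Extend the functions to \<open>\<eta>X\<close> and restrict the factorizations to the remainder.\<close>

lemma corona_functions_factor:
  fixes g :: "nat \<Rightarrow> (('x::metric_space \<Rightarrow> complex) \<Rightarrow> complex) \<Rightarrow> 'b"
  assumes coarse: "\<And>S :: 'x set. bounded S \<Longrightarrow> compact (closure S)"
    and B: "cstar_algebra B" and g: "\<And>t. g t \<in> carrier (cont_algebra higson_corona B)"
  obtains Z :: "(nat \<Rightarrow> real) topology" and i :: "'x \<Rightarrow> nat \<Rightarrow> real"
    where "admissible_compactification Z i"
      "\<And>t. g t \<in> pullback higson_corona (higson_extension Z i) ` carrier (cont_algebra (remainder Z i) B)"
proof -
  let ?Y = "higson_compactification :: (('x \<Rightarrow> complex) \<Rightarrow> complex) topology"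
  have preB: "pre_cstar_algebra B" by (rule cstar_algebra_imp_pre_cstar_algebra[OF B])
  have "\<exists>f. f \<in> carrier (cont_algebra ?Y B) \<and> restrict f (topspace higson_corona) = g t" for t
    by (rule corona_function_extends[OF coarse B g[of t]]) blast+
  then obtain F where F: "\<And>t. F t \<in> carrier (cont_algebra ?Y B)" "\<And>t. restrict (F t) (topspace higson_corona) = g t"
    by metis
  have contF: "continuous_map ?Y (cstar_topology B) (F t)" for t
    using F(1)[of t] by (simp add: carrier_cont_algebra)
  obtain Z :: "(nat \<Rightarrow> real) topology" and i :: "'x \<Rightarrow> nat \<Rightarrow> real" and \<pi> 
    where adm: "admissible_compactification Z i" and ext: "is_higson_extension Z i \<pi>"
      and factor: "\<And>t. \<exists>G. continuous_map Z (cstar_topology B) G \<and> (\<forall>\<omega>\<in>topspace ?Y. G (\<pi> \<omega>) = F t \<omega>)"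
    by (rule dominating_compactification[where F = F, OF coarse preB contF]) blast+
  have Z: "compactification Z i"
    using adm by (simp add: admissible_compactification_def)
  have \<pi>: "higson_extension Z i = \<pi>"
    using Z ext by (intro higson_extension_eqI) (auto simp: compactification_def)
  have "g t \<in> pullback higson_corona \<pi> ` carrier (cont_algebra (remainder Z i) B)" for t
  proof -
    obtain G where G: "continuous_map Z (cstar_topology B) G" "\<And>\<omega>. \<omega> \<in> topspace ?Y \<Longrightarrow> G (\<pi> \<omega>) = F t \<omega>"
      using factor[of t] by blast
    let ?G = "restrict G (topspace (remainder Z i))"
    have "?G \<in> carrier (cont_algebra (remainder Z i) B)"
      unfolding remainder_def by (intro restrict_in_cont_algebra continuous_map_from_subtopology G)
    moreover have "g t = pullback higson_corona \<pi> ?G"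
    proof (rule extensionalityI[OF _ pullback_extensional])
      show "g t \<in> extensional (topspace higson_corona)"
        using g[of t] by (simp add: carrier_cont_algebra)
      fix \<omega> :: "('x \<Rightarrow> complex) \<Rightarrow> complex" assume \<omega>: "\<omega> \<in> topspace higson_corona"
      then have "g t \<omega> = F t \<omega>"
        by (simp add: F(2)[symmetric])
      also have "\<dots> = G (\<pi> \<omega>)"
        using G(2) \<omega> by (simp add: topspace_higson_corona)
      finally show "g t \<omega> = pullback higson_corona \<pi> ?G \<omega>"
        using \<omega> higson_extension_preserves_remainder[OF coarse Z ext \<omega>] by simp
    qed
    ultimately show ?thesis by blast
  qed
  then show thesis
    using that[OF adm] unfolding \<pi> by blast
qed


theorem proposition12:
  fixes D :: "'d cstar_alg" and DK :: "'b cstar_alg"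
    and \<tau> :: "'d \<Rightarrow> ('h::complex_hilbert \<Rightarrow> 'h) \<Rightarrow> 'b"
  assumes coarse: "\<forall>S::'x::metric_space set. bounded S \<longrightarrow> compact (closure S)"
    and D: "cstar_algebra D"
    and H: "separable_space (euclidean :: 'h topology)"
    and DK: "cstar_tensor_product D compact_operators DK \<tau>"
  shows
    "(\<forall>(Z :: 'z topology) (i :: 'x \<Rightarrow> 'z). admissible_compactification Z i \<longrightarrow>
        (\<exists>!\<pi>. is_higson_extension Z i \<pi>) \<and>
        injective_star_hom (cont_algebra Z DK) (cont_algebra higson_compactification DK)
          (pullback higson_compactification (higson_extension Z i)) \<and>
        injective_star_hom (cont_algebra higson_compactification DK)
          (vv_algebra DK :: ('x \<Rightarrow> 'b) cstar_alg) restrict_to_space \<and>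
        injective_star_hom (cont_algebra (remainder Z i) DK) (cont_algebra higson_corona DK)
          (pullback higson_corona (higson_extension Z i)) \<and>
        injective_star_hom (cont_algebra higson_corona DK)
          (stable_higson_corona DK :: ('x \<Rightarrow> 'b) set cstar_alg) (corona_map DK))
     \<and> (\<forall>\<kappa>\<^sub>0 \<in> carrier (K0 (cont_algebra
             (higson_corona :: (('x \<Rightarrow> complex) \<Rightarrow> complex) topology) DK)).
          \<forall>\<kappa>\<^sub>1 \<in> carrier (K1 (cont_algebra
             (higson_corona :: (('x \<Rightarrow> complex) \<Rightarrow> complex) topology) DK)).
          \<exists>(Z :: (nat \<Rightarrow> real) topology) (i :: 'x \<Rightarrow> nat \<Rightarrow> real).
            admissible_compactification Z i \<and>
            \<kappa>\<^sub>0 \<in> K0_map (cont_algebra higson_corona DK)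
                  (pullback higson_corona (higson_extension Z i)) `
                carrier (K0 (cont_algebra (remainder Z i) DK)) \<and>
            \<kappa>\<^sub>1 \<in> K1_map (cont_algebra higson_corona DK)
                  (pullback higson_corona (higson_extension Z i)) `
                carrier (K1 (cont_algebra (remainder Z i) DK)))"
proof -
  have bounded_compact: "compact (closure S)" if "bounded S" for S :: "'x set"
    using coarse that by blast
  have cstar: "cstar_algebra DK"
    using DK by (simp add: cstar_tensor_product_def)
  then have pre: "pre_cstar_algebra DK"
    by (rule cstar_algebra_imp_pre_cstar_algebra)
  let ?dX = "higson_corona :: (('x \<Rightarrow> complex) \<Rightarrow> complex) topology"
  let ?A = "cont_algebra ?dX DK"
  have preA: "pre_cstar_algebra ?A"
    by (rule pre_cstar_algebra_cont_algebra[OF pre compact_higson_corona[OF bounded_compact]])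
  have pullback_hom: "injective_star_hom (cont_algebra (remainder Z i) DK) ?A (pullback ?dX (higson_extension Z i))"
    and pullback_le: "f \<in> carrier (cont_algebra (remainder Z i) DK) \<Longrightarrow>
      cnorm ?A (pullback ?dX (higson_extension Z i) f) \<le> cnorm (cont_algebra (remainder Z i) DK) f"
    and compact_remainder: "compact_space (remainder Z i)"
    if adm: "admissible_compactification Z i" 
    for Z :: "'y topology" and i :: "'x \<Rightarrow> 'y" and f
  proof -
    have Z: "compactification Z i"
      using adm by (simp add: admissible_compactification_def)
    obtain \<pi> where \<pi>: "is_higson_extension Z i \<pi>"
      using ex1_higson_extension[OF adm] by blast
    have ext: "higson_extension Z i = \<pi>"
      using Z \<pi> by (intro higson_extension_eqI) (auto simp: compactification_def)
    have cont: "continuous_map ?dX (remainder Z i) \<pi>"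
      by (rule continuous_map_remainder[OF bounded_compact Z \<pi>])
    have onto: "\<pi> ` topspace ?dX = topspace (remainder Z i)"
      by (rule higson_extension_onto_remainder[OF bounded_compact Z \<pi>])
    show "injective_star_hom (cont_algebra (remainder Z i) DK) ?A (pullback ?dX (higson_extension Z i))"
      unfolding ext by (rule injective_star_hom_pullback[OF cont onto])
    have "compactin (remainder Z i) (\<pi> ` topspace ?dX)"
      using compact_higson_corona[OF bounded_compact] unfolding compact_space_def by (rule image_compactin[OF _ cont])
    then show compact: "compact_space (remainder Z i)"
      unfolding onto compact_space_def .
    show "cnorm ?A (pullback ?dX (higson_extension Z i) f) \<le> cnorm (cont_algebra (remainder Z i) DK) f"
      if "f \<in> carrier (cont_algebra (remainder Z i) DK)"
      unfolding ext by (rule cnorm_pullback_le[OF pre compact cont that])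
  qed
  have maps: "(\<exists>!\<pi>. is_higson_extension Z i \<pi>) \<and>
        injective_star_hom (cont_algebra Z DK) (cont_algebra higson_compactification DK)
          (pullback higson_compactification (higson_extension Z i)) \<and>
        injective_star_hom (cont_algebra higson_compactification DK)
          (vv_algebra DK :: ('x \<Rightarrow> 'b) cstar_alg) restrict_to_space \<and>
        injective_star_hom (cont_algebra (remainder Z i) DK) (cont_algebra higson_corona DK)
          (pullback higson_corona (higson_extension Z i)) \<and>
        injective_star_hom (cont_algebra higson_corona DK)
          (stable_higson_corona DK :: ('x \<Rightarrow> 'b) set cstar_alg) (corona_map DK)"
    if adm: "admissible_compactification Z i" for Z :: "'z topology" and i :: "'x \<Rightarrow> 'z"
  proof (intro conjI)
    have Z: "compactification Z i"
      using adm by (simp add: admissible_compactification_def)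
    show ex1: "\<exists>!\<pi>. is_higson_extension Z i \<pi>"
      by (rule ex1_higson_extension[OF adm])
    then obtain \<pi> where \<pi>: "is_higson_extension Z i \<pi>" by blast
    have ext: "higson_extension Z i = \<pi>"
      using Z \<pi> by (intro higson_extension_eqI) (auto simp: compactification_def)
    show "injective_star_hom (cont_algebra Z DK) (cont_algebra higson_compactification DK)
        (pullback higson_compactification (higson_extension Z i))"
      unfolding ext using \<pi> higson_extension_onto[OF Z \<pi>] 
      by (intro injective_star_hom_pullback) (auto simp: is_higson_extension_def)
    show "injective_star_hom (cont_algebra higson_compactification DK)
        (vv_algebra DK :: ('x \<Rightarrow> 'b) cstar_alg) restrict_to_space"
      by (rule injective_star_hom_restrict_to_space[OF pre])
    show "injective_star_hom (cont_algebra (remainder Z i) DK) (cont_algebra higson_corona DK)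
        (pullback higson_corona (higson_extension Z i))"
      by (rule pullback_hom[OF adm])
    show "injective_star_hom (cont_algebra higson_corona DK)
        (stable_higson_corona DK :: ('x \<Rightarrow> 'b) set cstar_alg) (corona_map DK)"
      by (rule injective_star_hom_corona_map[OF bounded_compact cstar])
  qed
  have lift: "\<exists>(Z :: (nat \<Rightarrow> real) topology) (i :: 'x \<Rightarrow> nat \<Rightarrow> real).
      admissible_compactification Z i \<and>
      \<kappa>\<^sub>0 \<in> K0_map ?A (pullback ?dX (higson_extension Z i)) ` carrier (K0 (cont_algebra (remainder Z i) DK)) \<and>
      \<kappa>\<^sub>1 \<in> K1_map ?A (pullback ?dX (higson_extension Z i)) ` carrier (K1 (cont_algebra (remainder Z i) DK))"
    if \<kappa>0: "\<kappa>\<^sub>0 \<in> carrier (K0 ?A)" and \<kappa>1: "\<kappa>\<^sub>1 \<in> carrier (K1 ?A)" for \<kappa>\<^sub>0 \<kappa>\<^sub>1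
  proof -
    have "\<kappa>\<^sub>0 \<in> (projections (unitization ?A) \<times> projections (unitization ?A)) // K0_rel (unitization ?A)"
      using \<kappa>0 by (simp add: K0_def kernel_def K0_unital_def)
    then obtain p q where p: "p \<in> projections (unitization ?A)" and q: "q \<in> projections (unitization ?A)"
        and pq: "\<kappa>\<^sub>0 = K0_rel (unitization ?A) `` {(p, q)}"
      by (auto elim!: quotientE)
    obtain u where u: "u \<in> unitaries (unitization ?A)" and \<kappa>u: "\<kappa>\<^sub>1 = K1_rel (unitization ?A) `` {u}"
      using \<kappa>1 by (auto simp: K1_def elim!: quotientE)
    \<comment> \<open>all entries of the three matrices, enumerated as one sequence of functions\<close>
    define g where "g t = (case prod_decode t of (s, ij) \<Rightarrow> case prod_decode ij of (i, j) \<Rightarrow>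
      fst (snd (if s = 0 then p else if s = 1 then q else u) i j))" for t
    have entry: "fst (snd x i j) \<in> carrier ?A" if "snd x \<in> matrices (unitization ?A) (fst x) (fst x)" for x i j
    proof -
      have "snd x i j \<in> carrier (unitization ?A)"
        using that by (simp add: matrices_def)
      then show ?thesis by (auto simp: mem_Times_iff)
    qed
    have "fst (snd p i j) \<in> carrier ?A" "fst (snd q i j) \<in> carrier ?A" "fst (snd u i j) \<in> carrier ?A" for i j
      by (rule entry, use p q u in \<open>force simp: projections_def unitaries_def\<close>)+
    then have gA: "g t \<in> carrier ?A" for t
      by (simp add: g_def split: prod.split)
    obtain Z :: "(nat \<Rightarrow> real) topology" and i :: "'x \<Rightarrow> nat \<Rightarrow> real"
      where adm: "admissible_compactification Z i"
        and im: "\<And>t. g t \<in> pullback ?dX (higson_extension Z i) ` carrier (cont_algebra (remainder Z i) DK)"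
      by (rule corona_functions_factor[where g = g, OF bounded_compact cstar gA]) blast+
    have g: "fst (snd p a b) = g (prod_encode (0, prod_encode (a, b)))" 
      "fst (snd q a b) = g (prod_encode (1, prod_encode (a, b)))"
      "fst (snd u a b) = g (prod_encode (2, prod_encode (a, b)))" for a b
      by (simp_all add: g_def)
    have preR: "pre_cstar_algebra (cont_algebra (remainder Z i) DK)"
      by (rule pre_cstar_algebra_cont_algebra[OF pre compact_remainder[OF adm]])
    have "\<kappa>\<^sub>0 \<in> K0_map ?A (pullback ?dX (higson_extension Z i)) ` carrier (K0 (cont_algebra (remainder Z i) DK))"
      using K0_class_lift[OF preR preA pullback_hom[OF adm] p q] \<kappa>0 im unfolding pq g by blast
    moreover have "\<kappa>\<^sub>1 \<in> K1_map ?A (pullback ?dX (higson_extension Z i)) ` carrier (K1 (cont_algebra (remainder Z i) DK))"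
      using K1_class_lift[OF preR preA pullback_hom[OF adm] pullback_le[OF adm] u] im unfolding \<kappa>u g by blast
    ultimately show ?thesis
      using adm by blast
  qed
  show ?thesis
    using maps lift by blast
qed

end
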